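(* Let $G$ be a minimally $2$-connected graph of order $n$. Then \[ \overline{\kappa}(G)\leq 2+\frac{(n-2)^2}{4n(n-1)}<\frac{9}{4}. \] Moreover, let $n=4k+\ell$, where $k,\ell\in\mathbb{Z}$ and $0\leq \ell<4$. (a) If $k\geq 8$ and $\ell=0$, then \[ \overline{\kappa}(G)\leq 2+\frac{n^2-4n}{4n(n-1)}=2+\frac{n-4}{4(n-1)}, \] with equality if and only if $G$ is obtained from an ideally connected $6$-regular graph of order $k$ by subdividing every edge. (b) If $k\geq 30$ and $\ell=1$, then \[ \overline{\kappa}(G)\leq 2+\frac{n^2-6n+13}{4n(n-1)}, \] with equality if and only if $G$ is obtained from an ideally connected nearly regular (multi)graph of order $k$ and size $n-k=3k+1$ by subdividing every edge. (c) If $k\geq 68$ and $\ell=2$, then \[ \overline{\kappa}(G)\leq 2+\frac{n^2-8n+60}{4n(n-1)}, \] with equality if and only if $G$ is obtained from an ideally connected nearly regular graph of either order $k$ and size $n-k=3k+2$, or order $k+1$ and size $n-k-1=3k+1$, by subdividing every edge. (d) If $k\geq 30$ and $\ell=3$, then \[ \overline{\kappa}(G)\leq 2+\frac{n^2-6n+17}{4n(n-1)}, \] with equality if and only if $G$ is obtained from an ideally connected nearly regular graph of order $k+1$ and size $n-k-1=3k+2$ by subdividing every edge.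
   Context: Graphs are finite and may have multiple edges but no loops; the degree of a vertex counts edges with multiplicity, the order of a graph is its number of vertices and its size is its number of edges (with multiplicity). For distinct vertices $u,v$ of a graph $G$, $\kappa_G(u,v)$ denotes the maximum number of internally disjoint $u$--$v$ paths in $G$ (a set of $u$--$v$ paths is internally disjoint if no two of them share an edge or a vertex other than $u,v$; parallel edges between $u$ and $v$ give different paths). The average connectivity of a graph $G$ of order $n$ is $\overline{\kappa}(G)=\sum_{\{u,v\}\subseteq V(G)}\kappa_G(u,v)/\binom{n}{2}$. The connectivity $\kappa(G)$ of a non-trivial graph $G$ is the smallest number of vertices whose removal disconnects $G$ or produces the trivial (one-vertex) graph. A graph $G$ is minimally $2$-connected if $\kappa(G)=2$ and $\kappa(G-e)<2$ for every edge $e$ of $G$. A graph $G$ is ideally connected if $\kappa_G(u,v)=\min\{\deg(u),\deg(v)\}$ for all pairs of distinct vertices $u,v$ of $G$. A graph is nearly regular if the difference between its maximum degree and its minimum degree is at most $1$. Subdividing an edge means replacing it by a path of length $2$ through a new vertex of degree $2$ (every edge, including each of several parallel edges, is subdivided exactly once). *)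

theory Defs
  imports Complex_Main
begin

text \<open>
  Undirected multigraphs: edges are named objects, and \<open>ends\<close> gives the set of end vertices
  of an edge, so parallel edges are distinct edges with the same \<open>ends\<close>. Requiring
  \<open>card (ends G e) = 2\<close> excludes loops.
\<close>

record ('v, 'e) mgraph =
  verts :: "'v set"
  edges :: "'e set"
  ends :: "'e \<Rightarrow> 'v set"

definition multigraph :: "('v, 'e) mgraph \<Rightarrow> bool" where
  "multigraph G \<longleftrightarrow> finite (verts G) \<and> finite (edges G) \<and>
     (\<forall>e\<in>edges G. ends G e \<subseteq> verts G \<and> card (ends G e) = 2)"

definition graph_order :: "('v, 'e) mgraph \<Rightarrow> nat" where
  "graph_order G = card (verts G)"

definition graph_size :: "('v, 'e) mgraph \<Rightarrow> nat" where
  "graph_size G = card (edges G)"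

definition vdegree :: "('v, 'e) mgraph \<Rightarrow> 'v \<Rightarrow> nat" where
  "vdegree G v = card {e \<in> edges G. v \<in> ends G e}"

definition max_degree :: "('v, 'e) mgraph \<Rightarrow> nat" where
  "max_degree G = Max (vdegree G ` verts G)"

definition min_degree :: "('v, 'e) mgraph \<Rightarrow> nat" where
  "min_degree G = Min (vdegree G ` verts G)"

definition regular :: "nat \<Rightarrow> ('v, 'e) mgraph \<Rightarrow> bool" where
  "regular d G \<longleftrightarrow> (\<forall>v\<in>verts G. vdegree G v = d)"

definition nearly_regular :: "('v, 'e) mgraph \<Rightarrow> bool" where
  "nearly_regular G \<longleftrightarrow> max_degree G - min_degree G \<le> 1"


text \<open>
  A path is given by its vertex sequence together with its edge sequence, so that two paths
  which differ only in the choice of a parallel edge are different.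
\<close>

definition is_path :: "('v, 'e) mgraph \<Rightarrow> 'v \<Rightarrow> 'v \<Rightarrow> 'v list \<times> 'e list \<Rightarrow> bool" where
  "is_path G u v p \<longleftrightarrow> (case p of (vs, es) \<Rightarrow>
     length vs = Suc (length es) \<and> hd vs = u \<and> last vs = v \<and> distinct vs \<and>
     set vs \<subseteq> verts G \<and> set es \<subseteq> edges G \<and>
     (\<forall>i<length es. ends G (es ! i) = {vs ! i, vs ! Suc i}))"

definition internally_disjoint_paths ::
    "('v, 'e) mgraph \<Rightarrow> 'v \<Rightarrow> 'v \<Rightarrow> ('v list \<times> 'e list) set \<Rightarrow> bool" where
  "internally_disjoint_paths G u v P \<longleftrightarrow> (\<forall>p\<in>P. is_path G u v p) \<and>
     (\<forall>p\<in>P. \<forall>q\<in>P. p \<noteq> q \<longrightarrow>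
        set (fst p) \<inter> set (fst q) \<subseteq> {u, v} \<and> set (snd p) \<inter> set (snd q) = {})"

definition local_connectivity :: "('v, 'e) mgraph \<Rightarrow> 'v \<Rightarrow> 'v \<Rightarrow> nat" where
  "local_connectivity G u v = Max {card P | P. internally_disjoint_paths G u v P}"

text \<open>
  The same quantity as a function of the unordered pair \<open>{u, v}\<close>; it is well defined by
  \<open>pair_connectivity_eq\<close> below.
\<close>

definition pair_connectivity :: "('v, 'e) mgraph \<Rightarrow> 'v set \<Rightarrow> nat" where
  "pair_connectivity G S =
     (THE m. \<exists>u v. u \<noteq> v \<and> S = {u, v} \<and> m = local_connectivity G u v)"

definition average_connectivity :: "('v, 'e) mgraph \<Rightarrow> real" where
  "average_connectivity G =
     (\<Sum>S \<in> {S. S \<subseteq> verts G \<and> card S = 2}. real (pair_connectivity G S)) /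
     real (graph_order G choose 2)"

definition ideally_connected :: "('v, 'e) mgraph \<Rightarrow> bool" where
  "ideally_connected G \<longleftrightarrow> (\<forall>u\<in>verts G. \<forall>v\<in>verts G. u \<noteq> v \<longrightarrow>
     local_connectivity G u v = min (vdegree G u) (vdegree G v))"

definition remove_verts :: "('v, 'e) mgraph \<Rightarrow> 'v set \<Rightarrow> ('v, 'e) mgraph" where
  "remove_verts G X =
     \<lparr>verts = verts G - X, edges = {e \<in> edges G. ends G e \<inter> X = {}}, ends = ends G\<rparr>"

definition remove_edge :: "('v, 'e) mgraph \<Rightarrow> 'e \<Rightarrow> ('v, 'e) mgraph" where
  "remove_edge G e = \<lparr>verts = verts G, edges = edges G - {e}, ends = ends G\<rparr>"

definition graph_connected :: "('v, 'e) mgraph \<Rightarrow> bool" where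
  "graph_connected G \<longleftrightarrow> (\<forall>u\<in>verts G. \<forall>v\<in>verts G. \<exists>p. is_path G u v p)"

text \<open>
  Only meaningful for graphs of order at least 2. The value is then at most
  \<open>graph_order G - 1\<close>, so it is immaterial whether the empty graph counts as connected.
\<close>

definition connectivity :: "('v, 'e) mgraph \<Rightarrow> nat" where
  "connectivity G = (LEAST m. \<exists>X. X \<subseteq> verts G \<and> card X = m \<and>
     (\<not> graph_connected (remove_verts G X) \<or> graph_order (remove_verts G X) = 1))"

definition minimally_2_connected :: "('v, 'e) mgraph \<Rightarrow> bool" where
  "minimally_2_connected G \<longleftrightarrow> graph_order G \<ge> 2 \<and> connectivity G = 2 \<and>
     (\<forall>e\<in>edges G. connectivity (remove_edge G e) < 2)"

definition mgraph_iso :: "('v, 'e) mgraph \<Rightarrow> ('w, 'f) mgraph \<Rightarrow> bool" where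
  "mgraph_iso G H \<longleftrightarrow> (\<exists>f g. bij_betw f (verts G) (verts H) \<and> bij_betw g (edges G) (edges H) \<and>
     (\<forall>e\<in>edges G. ends H (g e) = f ` ends G e))"

text \<open>
  Subdividing every edge: \<open>Inr e\<close> is the new vertex on the edge \<open>e\<close>, and \<open>(e, v)\<close> is the half
  of \<open>e\<close> joining it to the old vertex \<open>Inl v\<close>.
\<close>

definition subdivide :: "('v, 'e) mgraph \<Rightarrow> ('v + 'e, 'e \<times> 'v) mgraph" where
  "subdivide H =
     \<lparr>verts = Inl ` verts H \<union> Inr ` edges H,
      edges = {(e, v). e \<in> edges H \<and> v \<in> ends H e},
      ends = (\<lambda>(e, v). {Inl v, Inr e})\<rparr>"

text \<open>
  \<open>G\<close> arises, up to isomorphism, from a graph with property \<open>P\<close> by subdividing every edge.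
  Every finite multigraph is isomorphic to one whose vertices and edges are natural numbers, so
  quantifying over these loses nothing for isomorphism-invariant \<open>P\<close>.
\<close>

definition full_subdivision_of :: "('v, 'e) mgraph \<Rightarrow> ((nat, nat) mgraph \<Rightarrow> bool) \<Rightarrow> bool" where
  "full_subdivision_of G P \<longleftrightarrow> (\<exists>H. multigraph H \<and> P H \<and> mgraph_iso G (subdivide H))"


lemma is_path_rev:
  assumes "is_path G u v p"
  shows "is_path G v u (map_prod rev rev p)"
proof -
  obtain vs es where p: "p = (vs, es)" by (cases p)
  have l: "length vs = Suc (length es)" and ne: "vs \<noteq> []"
    and e: "\<And>i. i < length es \<Longrightarrow> ends G (es ! i) = {vs ! i, vs ! Suc i}"
    using assms by (auto simp: is_path_def p)
  have "ends G (rev es ! i) = {rev vs ! i, rev vs ! Suc i}" if i: "i < length es" for i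
  proof -
    have "rev es ! i = es ! (length es - Suc i)"
      and "rev vs ! i = vs ! Suc (length es - Suc i)"
      and "rev vs ! Suc i = vs ! (length es - Suc i)"
      using i l by (simp_all add: rev_nth Suc_diff_Suc)
    with e[of "length es - Suc i"] i show ?thesis by auto
  qed
  with assms ne show ?thesis
    by (auto simp: is_path_def p hd_rev last_rev)
qed

lemma internally_disjoint_paths_rev:
  assumes "internally_disjoint_paths G u v P"
  shows "internally_disjoint_paths G v u (map_prod rev rev ` P)"
proof -
  have paths: "is_path G v u (map_prod rev rev p)" if "p \<in> P" for p
  proof (rule is_path_rev)
    show "is_path G u v p" using assms that by (simp add: internally_disjoint_paths_def)
  qed
  have disj: "set (fst (map_prod rev rev p)) \<inter> set (fst (map_prod rev rev q)) \<subseteq> {v, u} \<and>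
      set (snd (map_prod rev rev p)) \<inter> set (snd (map_prod rev rev q)) = {}"
    if "p \<in> P" "q \<in> P" "map_prod rev rev p \<noteq> map_prod rev rev q" for p q
  proof -
    from that(3) have "p \<noteq> q" by (rule contrapos_nn) (rule arg_cong)
    with assms that(1,2)
    have "set (fst p) \<inter> set (fst q) \<subseteq> {u, v} \<and> set (snd p) \<inter> set (snd q) = {}"
      unfolding internally_disjoint_paths_def by (elim conjE) (drule (1) bspec, drule (1) bspec, erule (1) mp)
    then show ?thesis by (simp only: fst_map_prod snd_map_prod set_rev insert_commute[of v u])
  qed
  show ?thesis unfolding internally_disjoint_paths_def ball_simps
    by (intro conjI ballI impI) (erule paths, (erule (2) disj[THEN conjunct1]), (erule (2) disj[THEN conjunct2]))
qed

lemma card_map_prod_rev: "card (map_prod rev rev ` P) = card P"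
  by (intro card_image inj_on_subset[OF prod.inj_map] inj_on_rev subset_UNIV)

lemma local_connectivity_commute: "local_connectivity G u v = local_connectivity G v u"
proof -
  have sub: "{card P | P. internally_disjoint_paths G x y P}
      \<subseteq> {card P | P. internally_disjoint_paths G y x P}" for x y
  proof
    fix m assume "m \<in> {card P | P. internally_disjoint_paths G x y P}"
    then obtain P where "m = card P" and P: "internally_disjoint_paths G x y P" by blast
    then have "m = card (map_prod rev rev ` P)" by (simp only: card_map_prod_rev)
    with internally_disjoint_paths_rev[OF P]
    show "m \<in> {card P | P. internally_disjoint_paths G y x P}" by blast
  qed
  show ?thesis unfolding local_connectivity_def
    by (rule arg_cong[where f = Max], rule subset_antisym) (rule sub)+
qed

lemma pair_connectivity_eq:
  assumes "u \<noteq> v"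
  shows "pair_connectivity G {u, v} = local_connectivity G u v"
  unfolding pair_connectivity_def
proof (rule the_equality)
  show "\<exists>a b. a \<noteq> b \<and> {u, v} = {a, b} \<and> local_connectivity G u v = local_connectivity G a b"
    using assms by blast
next
  fix m assume "\<exists>a b. a \<noteq> b \<and> {u, v} = {a, b} \<and> m = local_connectivity G a b"
  then show "m = local_connectivity G u v"
    by (metis doubleton_eq_iff local_connectivity_commute)
qed

end

theory Submission
  imports Defs
begin

text \<open>
  Call a vertex of degree at least 3 a branch vertex. Since \<open>\<kappa>(u, v) \<le> min (deg u) (deg v)\<close>, only pairs of
  branch vertices can have connectivity above 2. If \<open>e = uv\<close> joins two branch vertices, then \<open>G - e\<close> has a
  cut vertex \<open>c\<close> separating \<open>u\<close> from \<open>v\<close>. Contracting \<open>e\<close> gives again a minimally 2-connected graph, and the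
  sum of \<open>\<kappa> - 2\<close> over all pairs does not decrease: pairs separated by \<open>{e, c}\<close> contributed nothing, and
  what is lost on the pairs \<open>{u, c}\<close> and \<open>{v, c}\<close> is regained on the pair formed by \<open>c\<close> and the contracted
  vertex. So one may assume that the \<open>s\<close> branch vertices are independent; then their degrees sum to at
  most \<open>2 (n - s)\<close>, with equality exactly for subdivisions of a graph on the branch vertices. Under this
  constraint the sum of the minima of the degrees is largest exactly for nearly equal degrees, and it
  remains to optimise over \<open>s\<close>, which leads to \<open>s\<close> close to \<open>n / 4\<close>.
\<close>

section \<open>Internally disjoint paths as edge sets\<close>

text \<open>Contracting an edge can turn a path into a walk, and subdividing splits its edges.
  Routes are therefore arbitrary edge sets connecting their ends: they can be mapped and restricted
  freely, and only their span has to be controlled. Minimality is kept as explicit cuts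
  \<open>{g, c}\<close> whose sides are carried along a contraction; this is where degree at least 3
  at both ends is used. The contraction is shown not to decrease the excess, never to increase it
  strictly. Equality is still settled, because every contraction costs a vertex: a graph of order
  \<open>n\<close> that is not reduced has excess at most \<open>(n - 3)^2 / 4\<close>, which is
  below the claimed value for remainders 0, 1, 3; for remainder 2 the exact value for order
  \<open>4 * k + 1\<close> is used as well. The thresholds on \<open>k\<close> are ties of the
  numerical bounds. For remainders 0, 1, 2, 3 and \<open>k\<close> = 7, 29, 67, 29, the competing
  numbers of branch vertices 8, 26, 60, 34, with all degrees equal to 5, 7, 7, 5, give the claimed
  value too.\<close>

definition joins :: "('v, 'e) mgraph \<Rightarrow> 'e set \<Rightarrow> 'v \<Rightarrow> 'v \<Rightarrow> bool" where
  "joins G F x y \<longleftrightarrow> (x, y) \<in> {(p, q). \<exists>e\<in>F. ends G e = {p, q}}\<^sup>*"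

lemma joins_refl [simp]: "joins G F x x"
  by (simp add: joins_def)

lemma joins_edge: "e \<in> F \<Longrightarrow> ends G e = {x, y} \<Longrightarrow> joins G F x y"
  unfolding joins_def by (rule r_into_rtrancl) auto

lemma joins_trans [trans]: "joins G F x y \<Longrightarrow> joins G F y z \<Longrightarrow> joins G F x z"
  unfolding joins_def by (rule rtrancl_trans)

lemma joins_sym: "joins G F x y \<Longrightarrow> joins G F y x"
proof -
  have "sym ({(p, q). \<exists>e\<in>F. ends G e = {p, q}}\<^sup>*)"
    by (intro sym_rtrancl) (auto simp: sym_def insert_commute)
  then show "joins G F x y \<Longrightarrow> joins G F y x"
    unfolding joins_def by (rule symD)
qed

lemma joins_induct [consumes 1, case_names refl step]:
  assumes "joins G F x y" "P x"
    "\<And>p q e. joins G F x p \<Longrightarrow> P p \<Longrightarrow> e \<in> F \<Longrightarrow> ends G e = {p, q} \<Longrightarrow> P q"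
  shows "P y"
  using assms(1) unfolding joins_def
proof (induction rule: rtrancl_induct)
  case base
  show ?case by (rule assms(2))
next
  case (step p q)
  then obtain e where "e \<in> F" "ends G e = {p, q}" by auto
  with step assms(3)[of p e q] show ?case by (auto simp: joins_def)
qed

text \<open>All maps between graphs below act on connections in this way: a single step may become a
  whole connection, or nothing at all when its ends are identified.\<close>

lemma joins_morphism:
  assumes "joins G F x y"
    and "\<And>e p q. e \<in> F \<Longrightarrow> ends G e = {p, q} \<Longrightarrow> joins G' F' (r p) (r q)"
  shows "joins G' F' (r x) (r y)"
  using assms(1)
proof (induction rule: joins_induct)
  case (step p q e)
  then show ?case using assms(2) joins_trans by metis
qed simp

lemma joins_mono: "joins G F x y \<Longrightarrow> F \<subseteq> F' \<Longrightarrow> joins G F' x y"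
  by (rule joins_morphism[where r = "\<lambda>x. x"]) (auto intro: joins_edge)

lemma joins_nonempty:
  assumes "joins G F x y" "x \<noteq> y"
  obtains e z where "e \<in> F" "ends G e = {x, z}"
proof -
  from assms(1) have "(x, y) \<in> {(p, q). \<exists>e\<in>F. ends G e = {p, q}}\<^sup>*"
    by (simp add: joins_def)
  then show thesis
    by (cases rule: converse_rtranclE) (use assms(2) that in auto)
qed

lemma joins_end_in: "joins G F x y \<Longrightarrow> x \<noteq> y \<Longrightarrow> x \<in> \<Union> (ends G ` F)"
  by (erule (1) joins_nonempty) auto

lemma multigraph_ends:
  assumes "multigraph G" "e \<in> edges G"
  obtains x y where "ends G e = {x, y}" "x \<noteq> y" "x \<in> verts G" "y \<in> verts G"
  using assms unfolding multigraph_def by (auto simp: card_2_iff)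

lemma multigraph_endsD:
  assumes "multigraph G" "e \<in> edges G" "ends G e = {x, y}"
  shows "x \<noteq> y" "x \<in> verts G" "y \<in> verts G"
  using multigraph_ends[OF assms(1,2)] assms(3) by (metis doubleton_eq_iff)+

text \<open>Edge sets in place of paths: a route need not be minimal, since the span condition is
  inherited by any path inside it. Disjointness of the edge sets is a separate condition because
  parallel edges between \<open>x\<close> and \<open>y\<close> have the same span.\<close>

definition route_system :: "('v, 'e) mgraph \<Rightarrow> 'v \<Rightarrow> 'v \<Rightarrow> 'e set set \<Rightarrow> bool" where
  "route_system G x y \<F> \<longleftrightarrow> (\<forall>F\<in>\<F>. F \<subseteq> edges G \<and> joins G F x y) \<and>
     (\<forall>F\<in>\<F>. \<forall>F'\<in>\<F>. F \<noteq> F' \<longrightarrow>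
        F \<inter> F' = {} \<and> \<Union> (ends G ` F) \<inter> \<Union> (ends G ` F') \<subseteq> {x, y})"

lemma route_systemD:
  assumes "route_system G x y \<F>" "F \<in> \<F>"
  shows "F \<subseteq> edges G" "joins G F x y"
    "F' \<in> \<F> \<Longrightarrow> F \<noteq> F' \<Longrightarrow> F \<inter> F' = {}"
    "F' \<in> \<F> \<Longrightarrow> F \<noteq> F' \<Longrightarrow> \<Union> (ends G ` F) \<inter> \<Union> (ends G ` F') \<subseteq> {x, y}"
  using assms unfolding route_system_def by simp_all

text \<open>Routes are nonempty because \<open>x\<close> and \<open>y\<close> differ, so
  disjointness makes the family injective, and indices can be counted instead of sets.\<close>

lemma route_system_image:
  assumes "x \<noteq> y"
    and "\<And>i. i \<in> I \<Longrightarrow> h i \<subseteq> edges G" "\<And>i. i \<in> I \<Longrightarrow> joins G (h i) x y"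
    and dis: "\<And>i j. i \<in> I \<Longrightarrow> j \<in> I \<Longrightarrow> i \<noteq> j \<Longrightarrow> h i \<inter> h j = {}"
    and "\<And>i j. i \<in> I \<Longrightarrow> j \<in> I \<Longrightarrow> i \<noteq> j \<Longrightarrow>
      \<Union> (ends G ` h i) \<inter> \<Union> (ends G ` h j) \<subseteq> {x, y}"
  shows "route_system G x y (h ` I)" "inj_on h I"
proof -
  show "inj_on h I"
  proof (rule inj_onI, rule ccontr)
    fix i j assume ij: "i \<in> I" "j \<in> I" "h i = h j" "i \<noteq> j"
    with dis have "h i = {}" by blast
    moreover have "joins G (h i) x y" using assms(3) ij by blast
    ultimately show False using assms(1) joins_nonempty by (metis emptyE)
  qed
  show "route_system G x y (h ` I)"
    unfolding route_system_def ball_simps using assms(2-5) by metis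
qed

lemma path_joins:
  assumes "is_path G x y (vs, es)"
  shows "joins G (set es) x y"
proof -
  have l: "length vs = Suc (length es)" and h: "hd vs = x" "last vs = y"
    and e: "\<And>i. i < length es \<Longrightarrow> ends G (es ! i) = {vs ! i, vs ! Suc i}"
    using assms by (auto simp: is_path_def)
  have "i \<le> length es \<Longrightarrow> joins G (set es) (vs ! 0) (vs ! i)" for i
  proof (induction i)
    case (Suc i)
    then have "joins G (set es) (vs ! i) (vs ! Suc i)"
      by (intro joins_edge[of "es ! i"] e) auto
    with Suc show ?case using joins_trans by (metis Suc_leD)
  qed simp
  from this[of "length es"] have "joins G (set es) (vs ! 0) (vs ! length es)" by simp
  moreover have "vs ! 0 = x" "vs ! length es = y"
    using l h by (metis hd_conv_nth list.size(3) nat.distinct(1),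
        metis last_conv_nth diff_Suc_1 list.size(3) nat.distinct(1))
  ultimately show ?thesis by simp
qed

lemma path_span:
  assumes "is_path G x y (vs, es)"
  shows "\<Union> (ends G ` set es) \<subseteq> set vs"
proof
  fix z assume "z \<in> \<Union> (ends G ` set es)"
  then obtain i where "i < length es" "z \<in> ends G (es ! i)" by (auto simp: in_set_conv_nth)
  with assms show "z \<in> set vs" by (auto simp: is_path_def)
qed

lemma joins_path:
  assumes "multigraph G" "F \<subseteq> edges G" "x \<in> verts G" "joins G F x y"
  shows "\<exists>vs es. is_path G x y (vs, es) \<and> set es \<subseteq> F"
  using assms(4)
proof (induction rule: joins_induct)
  case refl
  show ?case using assms(3) by (intro exI[of _ "[x]"] exI[of _ "[]"]) (auto simp: is_path_def)
next
  case (step p q e)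
  then obtain vs es where p: "is_path G x p (vs, es)" and sub: "set es \<subseteq> F" by blast
  have eF: "e \<in> F" and ee: "ends G e = {p, q}" by fact+
  have eq: "p \<noteq> q" "q \<in> verts G"
    using multigraph_endsD[OF assms(1) _ ee] eF assms(2) by auto
  have l: "length vs = Suc (length es)" and h: "hd vs = x" "last vs = p"
    and e: "\<And>i. i < length es \<Longrightarrow> ends G (es ! i) = {vs ! i, vs ! Suc i}"
    and dv: "distinct vs" and vV: "set vs \<subseteq> verts G" and eE: "set es \<subseteq> edges G"
    using p by (auto simp: is_path_def)
  \<comment> \<open>If the walk returns to a vertex of the path built so far, the path is cut off
    there and stays simple.\<close>
  show ?case
  proof (cases "q \<in> set vs")
    case True
    then obtain i where i: "i < length vs" "vs ! i = q" by (auto simp: in_set_conv_nth)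
    have "last (take (Suc i) vs) = q" using i by (simp add: take_Suc_conv_app_nth)
    moreover have "hd (take (Suc i) vs) = x" using h by (cases vs) auto
    moreover have "ends G (take i es ! j) = {take (Suc i) vs ! j, take (Suc i) vs ! Suc j}"
      if "j < length (take i es)" for j
      using that e[of j] by simp
    moreover have "length (take (Suc i) vs) = Suc (length (take i es))" using l i by simp
    moreover have "set (take (Suc i) vs) \<subseteq> verts G" "set (take i es) \<subseteq> edges G"
      using vV eE set_take_subset by fast+
    ultimately have "is_path G x q (take (Suc i) vs, take i es)"
      using dv unfolding is_path_def by simp
    then show ?thesis using sub set_take_subset by (meson subset_trans)
  next
    case False
    have "ends G ((es @ [e]) ! j) = {(vs @ [q]) ! j, (vs @ [q]) ! Suc j}"
      if "j < length (es @ [e])" for j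
    proof (cases "j < length es")
      case True
      then show ?thesis using e[of j] l by (simp add: nth_append)
    next
      case False
      with that have j: "j = length es" by simp
      have "vs ! length es = p" using h l by (metis last_conv_nth length_0_conv diff_Suc_1 nat.distinct(1))
      then show ?thesis using l ee j by (simp add: nth_append)
    qed
    then have "is_path G x q (vs @ [q], es @ [e])"
      using l h dv vV eE False eq subsetD[OF assms(2) eF] by (cases vs) (auto simp: is_path_def)
    moreover have "set (es @ [e]) \<subseteq> F" using sub eF by simp
    ultimately show ?thesis
      by (intro exI[of _ "vs @ [q]"] exI[of _ "es @ [e]"]) simp
  qed
qed

lemma route_system_finite:
  "finite (edges G) \<Longrightarrow> route_system G x y \<F> \<Longrightarrow> finite \<F>"
  unfolding route_system_def by (rule finite_subset[of _ "Pow (edges G)"]) auto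

lemma paths_route_system:
  assumes "multigraph G" "x \<noteq> y" "internally_disjoint_paths G x y P"
  shows "route_system G x y ((\<lambda>p. set (snd p)) ` P)" "inj_on (\<lambda>p. set (snd p)) P"
proof -
  have path: "is_path G x y (fst p, snd p)" if "p \<in> P" for p
    using assms(3) that by (simp add: internally_disjoint_paths_def)
  have sub: "set (snd p) \<subseteq> edges G" if "p \<in> P" for p
    using path[OF that] by (simp add: is_path_def case_prod_unfold)
  have dis: "set (fst p) \<inter> set (fst q) \<subseteq> {x, y}" "set (snd p) \<inter> set (snd q) = {}"
    if "p \<in> P" "q \<in> P" "p \<noteq> q" for p q
    using assms(3) that by (simp_all add: internally_disjoint_paths_def)
  have "\<Union> (ends G ` set (snd p)) \<inter> \<Union> (ends G ` set (snd q)) \<subseteq> {x, y}"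
    if "p \<in> P" "q \<in> P" "p \<noteq> q" for p q
    using path_span[OF path[OF that(1)]] path_span[OF path[OF that(2)]] dis(1)[OF that]
    by (meson Int_mono order_trans)
  then show "route_system G x y ((\<lambda>p. set (snd p)) ` P)" "inj_on (\<lambda>p. set (snd p)) P"
    using route_system_image[of x y P "\<lambda>p. set (snd p)" G] assms(2) path_joins[OF path] sub dis(2)
    by presburger+
qed

lemma route_system_paths:
  assumes "multigraph G" "x \<noteq> y" "x \<in> verts G" "route_system G x y \<F>"
  shows "\<exists>P. internally_disjoint_paths G x y P \<and> card P = card \<F>"
proof -
  have "\<forall>F\<in>\<F>. \<exists>p. is_path G x y p \<and> set (snd p) \<subseteq> F"
    using joins_path[OF assms(1)] assms(3,4) unfolding route_system_def by (metis snd_conv)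
  then obtain p where p: "\<And>F. F \<in> \<F> \<Longrightarrow> is_path G x y (p F)" "\<And>F. F \<in> \<F> \<Longrightarrow> set (snd (p F)) \<subseteq> F"
    by metis
  have dis: "F \<inter> F' = {}" "\<Union> (ends G ` F) \<inter> \<Union> (ends G ` F') \<subseteq> {x, y}"
    if "F \<in> \<F>" "F' \<in> \<F>" "F \<noteq> F'" for F F'
    using assms(4) that unfolding route_system_def by auto
  have ne: "set (snd (p F)) \<noteq> {}" if "F \<in> \<F>" for F
    using joins_nonempty[OF path_joins assms(2)] p(1)[OF that] by (metis emptyE prod.collapse)
  \<comment> \<open>A path with at least one edge has each vertex on one of its edges; the
    one-vertex path is ruled out by \<open>ne\<close>.\<close>
  have verts: "set (fst (p F)) \<subseteq> \<Union> (ends G ` F)" if "F \<in> \<F>" for F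
  proof
    obtain vs es where q: "p F = (vs, es)" by (cases "p F")
    have l: "length vs = Suc (length es)"
      and e: "\<And>i. i < length es \<Longrightarrow> ends G (es ! i) = {vs ! i, vs ! Suc i}"
      using p(1)[OF that] by (auto simp: is_path_def q)
    have es: "es \<noteq> []" "set es \<subseteq> F" using ne[OF that] p(2)[OF that] q by auto
    fix z assume "z \<in> set (fst (p F))"
    then obtain i where i: "i < length vs" "z = vs ! i" by (auto simp: q in_set_conv_nth)
    show "z \<in> \<Union> (ends G ` F)"
    proof (cases i)
      case 0
      then show ?thesis using e[of 0] es i by (auto intro!: bexI[of _ "es ! 0"])
    next
      case (Suc j)
      then show ?thesis using e[of j] es i l by (auto intro!: bexI[of _ "es ! j"])
    qed
  qed
  have inj: "inj_on p \<F>"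
  proof (rule inj_onI, rule ccontr)
    fix F F' assume F: "F \<in> \<F>" "F' \<in> \<F>" "p F = p F'" "F \<noteq> F'"
    then have "set (snd (p F)) \<subseteq> F \<inter> F'" using p(2) by (metis Int_greatest)
    with dis(1)[OF F(1,2,4)] ne[OF F(1)] show False by simp
  qed
  have "internally_disjoint_paths G x y (p ` \<F>)"
    unfolding internally_disjoint_paths_def
  proof (intro conjI ballI impI)
    fix q assume "q \<in> p ` \<F>" then show "is_path G x y q" using p(1) by auto
  next
    fix q q' assume "q \<in> p ` \<F>" "q' \<in> p ` \<F>" "q \<noteq> q'"
    then obtain F F' where F: "q = p F" "q' = p F'" "F \<in> \<F>" "F' \<in> \<F>" "F \<noteq> F'" by auto
    show "set (fst q) \<inter> set (fst q') \<subseteq> {x, y}"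
      using verts[OF F(3)] verts[OF F(4)] dis(2)[OF F(3-5)] F(1,2) by blast
    show "set (snd q) \<inter> set (snd q') = {}"
      using p(2)[OF F(3)] p(2)[OF F(4)] dis(1)[OF F(3-5)] F(1,2) by blast
  qed
  then show ?thesis using card_image[OF inj] by blast
qed

lemma local_connectivity_routes:
  assumes "multigraph G" "x \<noteq> y" "x \<in> verts G"
  shows "local_connectivity G x y = Max {card \<F> | \<F>. route_system G x y \<F>}"
proof -
  have "{card P | P. internally_disjoint_paths G x y P} = {card \<F> | \<F>. route_system G x y \<F>}"
  proof (intro subset_antisym subsetI)
    fix m assume "m \<in> {card P | P. internally_disjoint_paths G x y P}"
    then obtain P where "m = card P" and P: "internally_disjoint_paths G x y P" by blast
    with card_image[OF paths_route_system(2)[OF assms(1,2) P]]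
      paths_route_system(1)[OF assms(1,2) P]
    show "m \<in> {card \<F> | \<F>. route_system G x y \<F>}" by (metis (mono_tags, lifting) mem_Collect_eq)
  next
    fix m assume "m \<in> {card \<F> | \<F>. route_system G x y \<F>}"
    then obtain \<F> where "m = card \<F>" and "route_system G x y \<F>" by blast
    with route_system_paths[OF assms] show "m \<in> {card P | P. internally_disjoint_paths G x y P}"
      by (metis (mono_tags, lifting) mem_Collect_eq)
  qed
  then show ?thesis by (simp add: local_connectivity_def)
qed

lemma route_system_cards_finite:
  assumes "finite (edges G)"
  shows "finite {card \<F> | \<F>. route_system G x y \<F>}"
proof -
  have "{card \<F> | \<F>. route_system G x y \<F>} \<subseteq> card ` Pow (Pow (edges G))"
    by (auto simp: route_system_def)
  then show ?thesis by (rule finite_subset) (simp add: assms)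
qed

lemma le_local_connectivity:
  assumes "multigraph G" "x \<noteq> y" "x \<in> verts G" "route_system G x y \<F>"
  shows "card \<F> \<le> local_connectivity G x y"
proof -
  have "finite (edges G)" using assms(1) by (simp add: multigraph_def)
  then show ?thesis unfolding local_connectivity_routes[OF assms(1-3)]
    using assms(4) by (intro Max_ge route_system_cards_finite) auto
qed

lemma local_connectivity_attained:
  assumes "multigraph G" "x \<noteq> y" "x \<in> verts G"
  obtains \<F> where "route_system G x y \<F>" "card \<F> = local_connectivity G x y" "finite \<F>"
proof -
  have fin: "finite (edges G)" using assms(1) by (simp add: multigraph_def)
  have "route_system G x y {}" by (simp add: route_system_def)
  then have "{card \<F> | \<F>. route_system G x y \<F>} \<noteq> {}" by auto
  from Max_in[OF route_system_cards_finite[OF fin] this]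
  show thesis using local_connectivity_routes[OF assms] route_system_finite[OF fin] that by auto
qed

text \<open>The lower bounds for contraction, isomorphism and subdivision all come from transforming
  a maximum route system route by route.\<close>

lemma le_local_connectivity_image:
  assumes G: "multigraph G" "x \<in> verts G" and xy: "x \<noteq> y"
    and h: "\<And>i. i \<in> I \<Longrightarrow> h i \<subseteq> edges G" "\<And>i. i \<in> I \<Longrightarrow> joins G (h i) x y"
    and dis: "\<And>i j. i \<in> I \<Longrightarrow> j \<in> I \<Longrightarrow> i \<noteq> j \<Longrightarrow> h i \<inter> h j = {}"
    and span: "\<And>i j. i \<in> I \<Longrightarrow> j \<in> I \<Longrightarrow> i \<noteq> j \<Longrightarrow>
      \<Union> (ends G ` h i) \<inter> \<Union> (ends G ` h j) \<subseteq> {x, y}"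
  shows "card I \<le> local_connectivity G x y"
proof -
  have "route_system G x y (h ` I)"
    by (rule route_system_image(1)) (fact xy h dis span)+
  moreover have "inj_on h I"
    by (rule route_system_image(2)) (fact xy h dis span)+
  ultimately show ?thesis
    using le_local_connectivity[OF G(1) xy G(2)] card_image by metis
qed

section \<open>Separations and contraction\<close>

text \<open>The mixed cut \<open>{g, c}\<close>. The sides are parameters, rather than the
  disconnectedness of a smaller graph, because a cut of the contracted graph is obtained from images
  of the sides.\<close>

definition separation :: "('v, 'e) mgraph \<Rightarrow> 'e \<Rightarrow> 'v set \<Rightarrow> 'v \<Rightarrow> 'v set \<Rightarrow> bool" where
  "separation G g A c B \<longleftrightarrow> verts G = insert c (A \<union> B) \<and> c \<notin> A \<and> c \<notin> B \<and> A \<inter> B = {} \<and>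
     (\<exists>x\<in>A. \<exists>y\<in>B. ends G g = {x, y}) \<and>
     (\<forall>h\<in>edges G. h \<noteq> g \<longrightarrow> ends G h \<subseteq> insert c A \<or> ends G h \<subseteq> insert c B)"

text \<open>Minimal 2-connectedness without a lower bound on the order, in a form that can be followed through
  contractions.\<close>

definition critical :: "('v, 'e) mgraph \<Rightarrow> bool" where
  "critical G \<longleftrightarrow> multigraph G \<and>
     (\<forall>z\<in>verts G. \<forall>a\<in>verts G - {z}. \<forall>b\<in>verts G - {z}. joins G {h \<in> edges G. z \<notin> ends G h} a b) \<and>
     (\<forall>g\<in>edges G. \<exists>A c B. separation G g A c B)"

lemma separation_sym: "separation G g A c B \<Longrightarrow> separation G g B c A"
  unfolding separation_def by (auto simp: Un_commute insert_commute) blast+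

lemma separationD:
  assumes "separation G g A c B"
  shows "verts G = insert c (A \<union> B)" "c \<notin> A" "c \<notin> B" "A \<inter> B = {}"
    "h \<in> edges G \<Longrightarrow> h \<noteq> g \<Longrightarrow> ends G h \<subseteq> insert c A \<or> ends G h \<subseteq> insert c B"
  using assms unfolding separation_def by blast+

lemma separation_ends:
  assumes "separation G g A c B"
  obtains x y where "x \<in> A" "y \<in> B" "ends G g = {x, y}"
  using assms unfolding separation_def by blast

text \<open>Collapsing \<open>B\<close> to \<open>c\<close> is a retraction, since \<open>g\<close> is the only edge between \<open>A\<close> and \<open>B\<close>.\<close>

lemma separation_restrict:
  assumes sep: "separation G g A c B" and F: "F \<subseteq> edges G" "g \<notin> F"
    and xy: "x \<in> insert c A" "y \<in> insert c A" and j: "joins G F x y"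
  shows "joins G {h \<in> F. ends G h \<subseteq> insert c A} x y"
proof -
  let ?r = "\<lambda>z. if z \<in> B then c else z"
  let ?F = "{h \<in> F. ends G h \<subseteq> insert c A}"
  have "joins G ?F (?r x) (?r y)"
    using j
  proof (rule joins_morphism)
    fix h p q assume h: "h \<in> F" "ends G h = {p, q}"
    then have "ends G h \<subseteq> insert c A \<or> ends G h \<subseteq> insert c B"
      using separationD(5)[OF sep, of h] F by auto
    then show "joins G ?F (?r p) (?r q)"
    proof
      assume a: "ends G h \<subseteq> insert c A"
      then have "joins G ?F p q" using h by (intro joins_edge[of h]) auto
      moreover have "?r p = p" "?r q = q" using a h(2) separationD(3,4)[OF sep] by auto
      ultimately show ?thesis by simp
    next
      assume "ends G h \<subseteq> insert c B"
      then have "?r p = c" "?r q = c" using h(2) by auto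
      then show ?thesis by simp
    qed
  qed
  moreover have "?r x = x" "?r y = y" using xy separationD(3,4)[OF sep] by auto
  ultimately show ?thesis by simp
qed

text \<open>Without \<open>g\<close> and \<open>c\<close> no edge leaves \<open>A\<close>.\<close>

lemma separation_hits:
  assumes sep: "separation G g A c B" and F: "F \<subseteq> edges G" "g \<notin> F"
    and xy: "x \<in> A" "y \<in> B" and j: "joins G F x y"
  shows "c \<in> \<Union> (ends G ` F)"
proof (rule ccontr)
  assume c: "c \<notin> \<Union> (ends G ` F)"
  from j have "y \<in> A"
  proof (induction rule: joins_induct)
    case (step p q h)
    moreover have "c \<notin> ends G h" "h \<in> edges G" "h \<noteq> g" using c F step by auto
    ultimately have "ends G h \<subseteq> A \<or> ends G h \<subseteq> B" using separationD(5)[OF sep, of h] by blast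
    with step show ?case using separationD(4)[OF sep] by auto
  qed (fact xy)
  then show False using xy separationD(4)[OF sep] by blast
qed

lemma card_le_1I: "(\<And>x y. x \<in> S \<Longrightarrow> y \<in> S \<Longrightarrow> x = y) \<Longrightarrow> card S \<le> 1"
  by (cases "finite S") (auto simp: card_le_Suc0_iff_eq)

lemma route_system_edge_card:
  assumes "route_system G x y \<F>"
  shows "card {F \<in> \<F>. e \<in> F} \<le> 1"
  using route_systemD(3)[OF assms] by (intro card_le_1I) blast

lemma route_system_vert_card:
  assumes "route_system G x y \<F>" "z \<noteq> x" "z \<noteq> y"
  shows "card {F \<in> \<F>. z \<in> \<Union> (ends G ` F)} \<le> 1"
  using route_systemD(4)[OF assms(1)] assms(2,3) by (intro card_le_1I) blast

text \<open>Each route from \<open>A\<close> to \<open>B\<close> uses \<open>g\<close> or passes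
  \<open>c\<close>, and each of these two serves at most one route.\<close>

lemma local_connectivity_across:
  assumes G: "multigraph G" and sep: "separation G g A c B" and xy: "x \<in> A" "y \<in> B"
  shows "local_connectivity G x y \<le> 2"
proof -
  have ne: "x \<noteq> y" "x \<in> verts G" "x \<noteq> c" "y \<noteq> c"
    using xy separationD(1-4)[OF sep] by auto
  obtain \<F> where \<F>: "route_system G x y \<F>" "card \<F> = local_connectivity G x y" "finite \<F>"
    by (rule local_connectivity_attained[OF G ne(1,2)])
  have "F \<in> {F \<in> \<F>. g \<in> F} \<union> {F \<in> \<F>. c \<in> \<Union> (ends G ` F)}" if "F \<in> \<F>" for F
    using that separation_hits[OF sep route_systemD(1)[OF \<F>(1) that] _ xy route_systemD(2)[OF \<F>(1) that]]
    by blast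
  then have "\<F> \<subseteq> {F \<in> \<F>. g \<in> F} \<union> {F \<in> \<F>. c \<in> \<Union> (ends G ` F)}" by blast
  then have "card \<F> \<le> card ({F \<in> \<F>. g \<in> F} \<union> {F \<in> \<F>. c \<in> \<Union> (ends G ` F)})"
    using \<F>(3) by (intro card_mono) auto
  also have "\<dots> \<le> card {F \<in> \<F>. g \<in> F} + card {F \<in> \<F>. c \<in> \<Union> (ends G ` F)}"
    by (rule card_Un_le)
  also have "\<dots> \<le> 1 + 1"
    using ne by (intro add_mono route_system_edge_card[OF \<F>(1)] route_system_vert_card[OF \<F>(1)]) auto
  finally show ?thesis using \<F>(2) by simp
qed

lemma local_connectivity_le_degree:
  assumes G: "multigraph G" and "x \<noteq> y" "x \<in> verts G"
  shows "local_connectivity G x y \<le> vdegree G x"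
proof -
  obtain \<F> where \<F>: "route_system G x y \<F>" "card \<F> = local_connectivity G x y" "finite \<F>"
    by (rule local_connectivity_attained[OF assms])
  have "\<exists>e. e \<in> F \<and> x \<in> ends G e" if "F \<in> \<F>" for F
    by (rule joins_nonempty[OF route_systemD(2)[OF \<F>(1) that] assms(2)]) blast
  then obtain h where h: "\<And>F. F \<in> \<F> \<Longrightarrow> h F \<in> F \<and> x \<in> ends G (h F)" by metis
  have "inj_on h \<F>"
    using h route_systemD(3)[OF \<F>(1)] by (intro inj_onI) (metis disjoint_iff)
  moreover have "h ` \<F> \<subseteq> {e \<in> edges G. x \<in> ends G e}"
    using h route_systemD(1)[OF \<F>(1)] by blast
  moreover have "finite {e \<in> edges G. x \<in> ends G e}" using G by (simp add: multigraph_def)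
  ultimately show ?thesis unfolding vdegree_def \<F>(2)[symmetric] by (metis card_inj_on_le)
qed

lemma local_connectivity_le_min_degree:
  assumes G: "multigraph G" and "x \<noteq> y" "x \<in> verts G" "y \<in> verts G"
  shows "local_connectivity G x y \<le> min (vdegree G x) (vdegree G y)"
  using local_connectivity_le_degree[OF G assms(2,3)]
    local_connectivity_le_degree[OF G assms(2)[symmetric] assms(4)]
  by (simp add: local_connectivity_commute[of G y x])

section \<open>Contraction of an edge and local connectivity\<close>

definition contract :: "('v, 'e) mgraph \<Rightarrow> 'e \<Rightarrow> ('v \<Rightarrow> 'w) \<Rightarrow> ('w, 'e) mgraph" where
  "contract G e f = \<lparr>verts = f ` verts G, edges = edges G - {e}, ends = (\<lambda>h. f ` ends G h)\<rparr>"

lemma contract_simps [simp]: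
  "verts (contract G e f) = f ` verts G" "edges (contract G e f) = edges G - {e}"
  "ends (contract G e f) h = f ` ends G h"
  by (simp_all add: contract_def)

text \<open>\<open>f\<close> is any map identifying exactly \<open>u\<close> and \<open>v\<close>,
  with no preferred representative. The hypotheses are then symmetric in the two ends, and
  \<open>flip\<close> transfers each statement about \<open>u\<close> and \<open>A\<close> to
  \<open>v\<close> and \<open>B\<close>.\<close>

locale contraction =
  fixes G :: "('v, 'e) mgraph" and e u v A c B and f :: "'v \<Rightarrow> 'w"
  assumes crit: "critical G" and e: "e \<in> edges G" and ends_e: "ends G e = {u, v}"
    and sep: "separation G e A c B" and uA: "u \<in> A" and vB: "v \<in> B"
    and f: "f u = f v" "inj_on f (verts G - {u})" "inj_on f (verts G - {v})"
begin

lemma flip: "contraction G e v u B c A f"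
  using crit e ends_e separation_sym[OF sep] uA vB f
  by unfold_locales (auto simp: insert_commute)

lemma G: "multigraph G"
  using crit by (simp add: critical_def)

lemmas verts_eq = separationD(1)[OF sep] and cA = separationD(2)[OF sep]
  and cB = separationD(3)[OF sep] and AB = separationD(4)[OF sep]

lemma uv: "u \<in> verts G" "v \<in> verts G" "c \<in> verts G" "u \<noteq> v" "u \<noteq> c" "v \<noteq> c" "v \<notin> A" "u \<notin> B"
  using verts_eq uA vB AB cA cB by auto

lemma f_eq: "x \<in> verts G \<Longrightarrow> y \<in> verts G \<Longrightarrow> f x = f y \<longleftrightarrow> x = y \<or> x = u \<and> y = v \<or> x = v \<and> y = u"
  using f uv by (metis DiffI inj_onD singletonD)

text \<open>An edge parallel to \<open>e\<close> would become a loop, but it would also join the two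
  sides of the cut, which only \<open>e\<close> does.\<close>

lemma ends_f_inj:
  assumes "h \<in> edges G" "h \<noteq> e" "ends G h = {p, q}"
  shows "f p \<noteq> f q"
proof -
  have "p \<noteq> q" "p \<in> verts G" "q \<in> verts G" using multigraph_endsD[OF G assms(1,3)] by auto
  moreover have "\<not> (p = u \<and> q = v \<or> p = v \<and> q = u)"
    using separationD(5)[OF sep assms(1,2)] assms(3) uA vB uv by auto
  ultimately show ?thesis using f_eq by blast
qed

lemma contract_multigraph: "multigraph (contract G e f)"
proof -
  have "f ` ends G h \<subseteq> f ` verts G \<and> card (f ` ends G h) = 2" if h: "h \<in> edges G" "h \<noteq> e" for h
  proof -
    obtain p q where "ends G h = {p, q}" "p \<in> verts G" "q \<in> verts G"
      using multigraph_ends[OF G h(1)] by metis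
    with ends_f_inj[OF h] show ?thesis by auto
  qed
  with G show ?thesis by (auto simp: multigraph_def)
qed

lemma contract_joins:
  assumes "joins G F x y"
  shows "joins (contract G e f) (F - {e}) (f x) (f y)"
  using assms
proof (rule joins_morphism)
  fix h p q assume h: "h \<in> F" "ends G h = {p, q}"
  show "joins (contract G e f) (F - {e}) (f p) (f q)"
  proof (cases "h = e")
    case True
    then have "f p = f q" using h ends_e f(1) by (metis doubleton_eq_iff)
    then show ?thesis by simp
  next
    case False
    then show ?thesis using h by (intro joins_edge[of h]) auto
  qed
qed

lemma span_verts: "F \<subseteq> edges G \<Longrightarrow> z \<in> \<Union> (ends G ` F) \<Longrightarrow> z \<in> verts G"
  using G by (auto simp: multigraph_def)

lemma contract_span: "\<Union> (ends (contract G e f) ` F) = f ` \<Union> (ends G ` F)"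
  by auto

text \<open>The merged vertex is an end of the new routes, so visits to \<open>u\<close> and
  \<open>v\<close> by different routes create no conflict, and a use of \<open>e\<close> simply
  disappears.\<close>

lemma contract_connectivity_end:
  assumes y: "y \<in> verts G" "y \<noteq> u" "y \<noteq> v"
  shows "local_connectivity G u y \<le> local_connectivity (contract G e f) (f u) (f y)"
proof -
  let ?G = "contract G e f"
  have fne: "f u \<noteq> f y" using f_eq uv y by metis
  obtain \<F> where \<F>: "route_system G u y \<F>" "card \<F> = local_connectivity G u y" "finite \<F>"
    using local_connectivity_attained[OF G] uv y by metis
  have span: "f ` \<Union> (ends G ` (F - {e})) \<inter> f ` \<Union> (ends G ` (F' - {e})) \<subseteq> {f u, f y}"
    if FF: "F \<in> \<F>" "F' \<in> \<F>" "F \<noteq> F'" for F F'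
  proof
    fix w assume "w \<in> f ` \<Union> (ends G ` (F - {e})) \<inter> f ` \<Union> (ends G ` (F' - {e}))"
    then obtain z z' where z: "w = f z" "w = f z'" "z \<in> \<Union> (ends G ` F)" "z' \<in> \<Union> (ends G ` F')"
      by blast
    then have "z \<in> verts G" "z' \<in> verts G"
      using span_verts route_systemD(1)[OF \<F>(1)] FF(1,2) by metis+
    then have "z = z' \<or> z = u \<and> z' = v \<or> z = v \<and> z' = u" using f_eq z by metis
    then show "w \<in> {f u, f y}"
      using route_systemD(4)[OF \<F>(1) FF] z f(1) by auto
  qed
  have "card \<F> \<le> local_connectivity ?G (f u) (f y)"
  proof (rule le_local_connectivity_image[where h = "\<lambda>F. F - {e}"])
    fix F F' assume FF: "F \<in> \<F>" "F' \<in> \<F>" "F \<noteq> F'"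
    show "(F - {e}) \<inter> (F' - {e}) = {}" using route_systemD(3)[OF \<F>(1) FF] by blast
    show "\<Union> (ends ?G ` (F - {e})) \<inter> \<Union> (ends ?G ` (F' - {e})) \<subseteq> {f u, f y}"
      unfolding contract_span by (rule span[OF FF])
  next
    fix F assume F: "F \<in> \<F>"
    show "F - {e} \<subseteq> edges ?G" using route_systemD(1)[OF \<F>(1) F] by auto
    show "joins ?G (F - {e}) (f u) (f y)" by (rule contract_joins[OF route_systemD(2)[OF \<F>(1) F]])
  qed (use uv contract_multigraph fne in auto)
  with \<F>(2) show ?thesis by simp
qed

lemma restrict:
  assumes "F \<subseteq> edges G" "e \<notin> F" "x \<in> insert c A" "y \<in> insert c A" "joins G F x y"
  shows "joins (contract G e f) {h \<in> F. ends G h \<subseteq> insert c A} (f x) (f y)"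
proof -
  have "e \<notin> {h \<in> F. ends G h \<subseteq> insert c A}" using assms(2) by simp
  then show ?thesis
    using contract_joins[OF separation_restrict[OF sep assms]] by simp
qed

text \<open>A route avoiding \<open>u\<close> can be pushed out of \<open>B\<close>, so only one route ever meets \<open>v\<close>.\<close>

lemma contract_connectivity_side:
  assumes x: "x \<in> insert c A" "x \<noteq> u" and y: "y \<in> insert c A" "y \<noteq> u" and ne: "x \<noteq> y"
  shows "local_connectivity G x y \<le> local_connectivity (contract G e f) (f x) (f y)"
proof -
  let ?G = "contract G e f"
  have xyV: "x \<in> verts G" "y \<in> verts G" "x \<noteq> v" "y \<noteq> v" using x y verts_eq uv by auto
  have fne: "f x \<noteq> f y" using f_eq xyV x y ne by metis
  obtain \<F> where \<F>: "route_system G x y \<F>" "card \<F> = local_connectivity G x y" "finite \<F>"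
    using local_connectivity_attained[OF G ne xyV(1)] by metis
  define \<phi> where "\<phi> F = (if u \<in> \<Union> (ends G ` F) then F - {e} else {h \<in> F. ends G h \<subseteq> insert c A})" for F
  have \<phi>_sub: "\<phi> F \<subseteq> F - {e}" for F
    using ends_e uv by (auto simp: \<phi>_def)
  have \<phi>_v: "u \<in> \<Union> (ends G ` F)" if "v \<in> \<Union> (ends G ` \<phi> F)" for F
    using that uv by (auto simp: \<phi>_def split: if_splits)
  have \<phi>_joins: "joins ?G (\<phi> F) (f x) (f y)" if "F \<in> \<F>" for F
  proof (cases "u \<in> \<Union> (ends G ` F)")
    case True
    then show ?thesis using contract_joins[OF route_systemD(2)[OF \<F>(1) that]] by (simp add: \<phi>_def)
  next
    case False
    then have "e \<notin> F" using ends_e by auto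
    with False show ?thesis
      using restrict[OF route_systemD(1)[OF \<F>(1) that] _ x(1) y(1) route_systemD(2)[OF \<F>(1) that]]
      by (simp add: \<phi>_def)
  qed
  have span: "f ` \<Union> (ends G ` \<phi> F) \<inter> f ` \<Union> (ends G ` \<phi> F') \<subseteq> {f x, f y}"
    if FF: "F \<in> \<F>" "F' \<in> \<F>" "F \<noteq> F'" for F F'
  proof
    fix w assume "w \<in> f ` \<Union> (ends G ` \<phi> F) \<inter> f ` \<Union> (ends G ` \<phi> F')"
    then obtain z z' where z: "w = f z" "w = f z'" "z \<in> \<Union> (ends G ` \<phi> F)" "z' \<in> \<Union> (ends G ` \<phi> F')"
      by blast
    then have z2: "z \<in> \<Union> (ends G ` F)" "z' \<in> \<Union> (ends G ` F')" using \<phi>_sub by blast+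
    then have "z \<in> verts G" "z' \<in> verts G"
      using span_verts route_systemD(1)[OF \<F>(1)] FF(1,2) by metis+
    then have "z = z' \<or> z = u \<and> z' = v \<or> z = v \<and> z' = u" using f_eq z by metis
    then show "w \<in> {f x, f y}"
    proof (elim disjE conjE)
      assume "z = z'" then show ?thesis using route_systemD(4)[OF \<F>(1) FF] z z2 by auto
    next
      assume "z = u" "z' = v"
      then have "u \<in> \<Union> (ends G ` F) \<inter> \<Union> (ends G ` F')" using z2 z(4) \<phi>_v[of F'] by simp
      then show ?thesis using route_systemD(4)[OF \<F>(1) FF] x y by blast
    next
      assume "z = v" "z' = u"
      then have "u \<in> \<Union> (ends G ` F) \<inter> \<Union> (ends G ` F')" using z2 z(3) \<phi>_v[of F] by simp
      then show ?thesis using route_systemD(4)[OF \<F>(1) FF] x y by blast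
    qed
  qed
  have "card \<F> \<le> local_connectivity ?G (f x) (f y)"
  proof (rule le_local_connectivity_image[where h = \<phi>])
    fix F F' assume FF: "F \<in> \<F>" "F' \<in> \<F>" "F \<noteq> F'"
    show "\<phi> F \<inter> \<phi> F' = {}"
      using route_systemD(3)[OF \<F>(1) FF] \<phi>_sub[of F] \<phi>_sub[of F'] by blast
    show "\<Union> (ends ?G ` \<phi> F) \<inter> \<Union> (ends ?G ` \<phi> F') \<subseteq> {f x, f y}"
      unfolding contract_span by (rule span[OF FF])
  next
    fix F assume F: "F \<in> \<F>"
    show "\<phi> F \<subseteq> edges ?G" using route_systemD(1)[OF \<F>(1) F] \<phi>_sub[of F] by auto
    show "joins ?G (\<phi> F) (f x) (f y)" by (rule \<phi>_joins[OF F])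
  qed (use xyV contract_multigraph fne in auto)
  with \<F>(2) show ?thesis by simp
qed

text \<open>At most one route from \<open>u\<close> to \<open>c\<close> uses \<open>e\<close>; the others live on the \<open>A\<close> side.\<close>

lemma contract_connectivity_cut:
  "local_connectivity G u c + local_connectivity G v c
     \<le> local_connectivity (contract G e f) (f u) (f c) + 2"
proof -
  let ?G = "contract G e f"
  interpret flip: contraction G e v u B c A f by (rule flip)
  have fne: "f u \<noteq> f c" using f_eq uv by metis
  obtain \<U> where \<U>: "route_system G u c \<U>" "card \<U> = local_connectivity G u c" "finite \<U>"
    using local_connectivity_attained[OF G] uv by metis
  obtain \<V> where \<V>: "route_system G v c \<V>" "card \<V> = local_connectivity G v c" "finite \<V>"
    using local_connectivity_attained[OF G] uv by metis
  \<comment> \<open>Tags keep the families apart, as the same edge set may occur in both. Each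
    family loses at most the one route through \<open>e\<close>, which accounts for the 2 in the
    claim.\<close>
  define I where "I = Inl ` {F \<in> \<U>. e \<notin> F} \<union> Inr ` {F \<in> \<V>. e \<notin> F}"
  define \<phi> where "\<phi> i = (case i of Inl F \<Rightarrow> {h \<in> F. ends G h \<subseteq> insert c A}
    | Inr F \<Rightarrow> {h \<in> F. ends G h \<subseteq> insert c B})" for i
  have cardI: "card I = card {F \<in> \<U>. e \<notin> F} + card {F \<in> \<V>. e \<notin> F}"
    unfolding I_def using \<U>(3) \<V>(3)
    by (subst card_Un_disjoint) (auto simp: card_image)
  have I_iff: "Inl F \<in> I \<longleftrightarrow> F \<in> \<U> \<and> e \<notin> F" "Inr F \<in> I \<longleftrightarrow> F \<in> \<V> \<and> e \<notin> F" for F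
    by (auto simp: I_def)
  have split: "card \<F> \<le> card {F \<in> \<F>. e \<notin> F} + 1" if "route_system G x y \<F>" "finite \<F>" for x y \<F>
  proof -
    have "\<F> = {F \<in> \<F>. e \<notin> F} \<union> {F \<in> \<F>. e \<in> F}" by blast
    then have "card \<F> \<le> card {F \<in> \<F>. e \<notin> F} + card {F \<in> \<F>. e \<in> F}" by (metis card_Un_le)
    with route_system_edge_card[OF that(1), of e] show ?thesis by linarith
  qed
  have spanA: "\<Union> (ends G ` \<phi> (Inl F)) \<subseteq> insert c A" and spanB: "\<Union> (ends G ` \<phi> (Inr F)) \<subseteq> insert c B" for F
    by (auto simp: \<phi>_def)
  have \<phi>_sub: "\<phi> (Inl F) \<subseteq> F" "\<phi> (Inr F) \<subseteq> F" for F by (auto simp: \<phi>_def)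
  have fA: "f z = f z' \<longleftrightarrow> z = z'" if "z \<in> insert c A" "z' \<in> insert c A" for z z'
    using f_eq[of z z'] that verts_eq uv by auto
  have fB: "f z = f z' \<longleftrightarrow> z = z'" if "z \<in> insert c B" "z' \<in> insert c B" for z z'
    using f_eq[of z z'] that verts_eq uv by auto
  have fAB: "f z \<in> {f u, f c}" if "z \<in> insert c A" "z' \<in> insert c B" "f z = f z'" for z z'
    using f_eq[of z z'] that verts_eq uv cA cB AB by auto
  have 1: "f ` \<Union> (ends G ` \<phi> (Inl F)) \<inter> f ` \<Union> (ends G ` \<phi> (Inl F')) \<subseteq> {f u, f c}"
    if "F \<in> \<U>" "F' \<in> \<U>" "F \<noteq> F'" for F F'
  proof
    fix w assume "w \<in> f ` \<Union> (ends G ` \<phi> (Inl F)) \<inter> f ` \<Union> (ends G ` \<phi> (Inl F'))"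
    then obtain z z' where z: "w = f z" "w = f z'" "z \<in> \<Union> (ends G ` \<phi> (Inl F))" "z' \<in> \<Union> (ends G ` \<phi> (Inl F'))"
      by blast
    then have "z = z'" using fA spanA by (metis subsetD)
    then have "z \<in> \<Union> (ends G ` F) \<inter> \<Union> (ends G ` F')" using z \<phi>_sub by blast
    then show "w \<in> {f u, f c}" using route_systemD(4)[OF \<U>(1) that] z(1) by blast
  qed
  have 2: "f ` \<Union> (ends G ` \<phi> (Inr F)) \<inter> f ` \<Union> (ends G ` \<phi> (Inr F')) \<subseteq> {f u, f c}"
    if "F \<in> \<V>" "F' \<in> \<V>" "F \<noteq> F'" for F F'
  proof
    fix w assume "w \<in> f ` \<Union> (ends G ` \<phi> (Inr F)) \<inter> f ` \<Union> (ends G ` \<phi> (Inr F'))"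
    then obtain z z' where z: "w = f z" "w = f z'" "z \<in> \<Union> (ends G ` \<phi> (Inr F))" "z' \<in> \<Union> (ends G ` \<phi> (Inr F'))"
      by blast
    then have "z = z'" using fB spanB by (metis subsetD)
    then have "z \<in> \<Union> (ends G ` F) \<inter> \<Union> (ends G ` F')" using z \<phi>_sub by blast
    then have "z \<in> {v, c}" using route_systemD(4)[OF \<V>(1) that] by blast
    then show "w \<in> {f u, f c}" using z(1) f(1) by auto
  qed
  have 3: "f ` \<Union> (ends G ` \<phi> (Inl F)) \<inter> f ` \<Union> (ends G ` \<phi> (Inr F')) \<subseteq> {f u, f c}" for F F'
  proof
    fix w assume "w \<in> f ` \<Union> (ends G ` \<phi> (Inl F)) \<inter> f ` \<Union> (ends G ` \<phi> (Inr F'))"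
    then obtain z z' where z: "w = f z" "w = f z'" "z \<in> \<Union> (ends G ` \<phi> (Inl F))" "z' \<in> \<Union> (ends G ` \<phi> (Inr F'))"
      by blast
    then show "w \<in> {f u, f c}" using fAB[of z z'] subsetD[OF spanA z(3)] subsetD[OF spanB z(4)] by simp
  qed
  \<comment> \<open>An edge inside both closed sides would have only the end
    \<open>c\<close>.\<close>
  have 4: "\<phi> (Inl F) \<inter> \<phi> (Inr F') = {}" if "F \<in> \<U>" for F F'
  proof -
    have "\<not> (ends G h \<subseteq> insert c A \<and> ends G h \<subseteq> insert c B)" if "h \<in> edges G" for h
      by (rule multigraph_ends[OF G that]) (use AB cA cB in auto)
    then show ?thesis using route_systemD(1)[OF \<U>(1) that] unfolding \<phi>_def sum.case by blast
  qed
  have disj: "\<phi> i \<inter> \<phi> j = {}" if ij: "i \<in> I" "j \<in> I" "i \<noteq> j" for i j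
  proof (cases i; cases j)
    fix F F' assume i: "i = Inl F" "j = Inl F'"
    with ij have "F \<inter> F' = {}" by (intro route_systemD(3)[OF \<U>(1)]) (auto simp: I_iff)
    then show ?thesis using \<phi>_sub[of F] \<phi>_sub[of F'] i by blast
  next
    fix F F' assume i: "i = Inr F" "j = Inr F'"
    with ij have "F \<inter> F' = {}" by (intro route_systemD(3)[OF \<V>(1)]) (auto simp: I_iff)
    then show ?thesis using \<phi>_sub[of F] \<phi>_sub[of F'] i by blast
  next
    fix F F' assume "i = Inl F" "j = Inr F'"
    then show ?thesis using ij 4 by (auto simp: I_iff)
  next
    fix F F' assume "i = Inr F" "j = Inl F'"
    then show ?thesis using ij 4[of F' F] by (simp add: I_iff Int_commute)
  qed
  have span: "f ` \<Union> (ends G ` \<phi> i) \<inter> f ` \<Union> (ends G ` \<phi> j) \<subseteq> {f u, f c}"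
    if ij: "i \<in> I" "j \<in> I" "i \<noteq> j" for i j
  proof (cases i; cases j)
    fix F F' assume "i = Inl F" "j = Inl F'"
    then show ?thesis using ij 1[of F F'] by (simp add: I_iff)
  next
    fix F F' assume "i = Inr F" "j = Inr F'"
    then show ?thesis using ij 2[of F F'] by (simp add: I_iff)
  next
    fix F F' assume "i = Inl F" "j = Inr F'"
    then show ?thesis using 3[of F F'] by simp
  next
    fix F F' assume "i = Inr F" "j = Inl F'"
    then show ?thesis using 3[of F' F] by (simp add: Int_commute)
  qed
  have joins: "joins ?G (\<phi> i) (f u) (f c)" if "i \<in> I" for i
  proof (cases i)
    case (Inl F)
    then have "F \<in> \<U>" "e \<notin> F" using that by (auto simp: I_iff)
    then show ?thesis
      using restrict[of F u c] route_systemD(1,2)[OF \<U>(1)] uA by (simp add: \<phi>_def Inl)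
  next
    case (Inr F)
    then have "F \<in> \<V>" "e \<notin> F" using that by (auto simp: I_iff)
    then show ?thesis
      using flip.restrict[of F v c] route_systemD(1,2)[OF \<V>(1)] vB f(1) by (simp add: \<phi>_def Inr)
  qed
  have sub: "\<phi> i \<subseteq> edges ?G" if "i \<in> I" for i
    using that route_systemD(1)[OF \<U>(1)] route_systemD(1)[OF \<V>(1)] by (cases i) (auto simp: I_iff \<phi>_def)
  have "card I \<le> local_connectivity ?G (f u) (f c)"
  proof (rule le_local_connectivity_image[where h = \<phi>])
    fix i j assume ij: "i \<in> I" "j \<in> I" "i \<noteq> j"
    show "\<phi> i \<inter> \<phi> j = {}" by (rule disj[OF ij])
    show "\<Union> (ends ?G ` \<phi> i) \<inter> \<Union> (ends ?G ` \<phi> j) \<subseteq> {f u, f c}"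
      unfolding contract_span by (rule span[OF ij])
  qed (use uv contract_multigraph fne joins sub in auto)
  with split[OF \<U>(1,3)] split[OF \<V>(1,3)] cardI \<U>(2) \<V>(2) show ?thesis by linarith
qed

end

lemma criticalD:
  assumes "critical G"
  shows "multigraph G"
    "z \<in> verts G \<Longrightarrow> a \<in> verts G \<Longrightarrow> b \<in> verts G \<Longrightarrow> a \<noteq> z \<Longrightarrow> b \<noteq> z \<Longrightarrow>
      joins G {h \<in> edges G. z \<notin> ends G h} a b"
    "g \<in> edges G \<Longrightarrow> \<exists>A c B. separation G g A c B"
  using assms unfolding critical_def by auto

section \<open>Contraction preserves criticality\<close>

locale branch_contraction = contraction +
  assumes deg_u: "3 \<le> vdegree G u" and deg_v: "3 \<le> vdegree G v"
begin

lemma flip_branch: "branch_contraction G e v u B c A f"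
  using flip deg_u deg_v by (simp add: branch_contraction_def branch_contraction_axioms_def)

text \<open>The critical situation is \<open>x = u\<close>: then \<open>u\<close> is joined to \<open>v\<close> avoiding \<open>e\<close> once through
  \<open>A'\<close> and once through \<open>B'\<close>, and both connections would have to use \<open>c\<close>.\<close>

lemma separation_contract_end:
  assumes sep': "separation G g A' v B'" and g: "g \<noteq> e" "g \<in> edges G" and uA': "u \<in> A'"
  shows "\<exists>A2 c2 B2. separation (contract G e f) g A2 c2 B2"
proof -
  obtain x y where xy: "x \<in> A'" "y \<in> B'" "ends G g = {x, y}"
    by (rule separation_ends[OF sep'])
  note S = separationD(1-4)[OF sep']
  have uB': "u \<notin> B'" using uA' S by blast
  have yne: "y \<in> verts G" "y \<noteq> u" "y \<noteq> v" using xy S uB' by auto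
  have "x \<noteq> u"
  proof
    assume xu: "x = u"
    \<comment> \<open>Degree at least 3 enters here: besides \<open>e\<close> and \<open>g\<close>
      some edge \<open>h\<close> leaves \<open>u\<close>, and its other end lies in
      \<open>A'\<close>. Continuing from \<open>h\<close> in the closed side of \<open>A'\<close>
      and from \<open>g\<close> in that of \<open>B'\<close> gives two connections from
      \<open>u\<close> to \<open>v\<close> that avoid \<open>e\<close>.\<close>
    have "\<exists>h\<in>edges G. u \<in> ends G h \<and> h \<noteq> e \<and> h \<noteq> g"
    proof (rule ccontr)
      assume "\<not> ?thesis"
      then have "{h \<in> edges G. u \<in> ends G h} \<subseteq> {e, g}" by blast
      then have "vdegree G u \<le> card {e, g}" unfolding vdegree_def by (intro card_mono) auto
      also have "\<dots> \<le> 2" by (simp add: card_insert_if)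
      finally show False using deg_u by simp
    qed
    then obtain h where h: "h \<in> edges G" "u \<in> ends G h" "h \<noteq> e" "h \<noteq> g" by blast
    obtain a where a: "ends G h = {u, a}" "a \<noteq> u" "a \<in> verts G"
      by (rule multigraph_ends[OF G h(1)]) (use h(2) that in auto)
    have av: "a \<noteq> v"
      using separationD(5)[OF sep h(1,3)] a(1) uA vB uv by auto
    have hA': "ends G h \<subseteq> insert v A'"
      using separationD(5)[OF sep' h(1,4)] h(2) uB' uv by auto
    then have aA': "a \<in> A'" using a av by auto
    let ?D = "{k \<in> edges G. u \<notin> ends G k}"
    have gD: "g \<notin> ?D" using xy xu by simp
    have "joins G ?D a v" using criticalD(2)[OF crit] uv a by auto
    then have ja: "joins G {k \<in> ?D. ends G k \<subseteq> insert v A'} a v"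
      using separation_restrict[OF sep' _ gD] aA' by auto
    have "joins G ?D y v" using criticalD(2)[OF crit] uv yne by auto
    then have jy: "joins G {k \<in> ?D. ends G k \<subseteq> insert v B'} y v"
      using separation_restrict[OF separation_sym[OF sep'] _ gD] xy(2) by auto
    let ?F1 = "insert h {k \<in> ?D. ends G k \<subseteq> insert v A'}"
    let ?F2 = "insert g {k \<in> ?D. ends G k \<subseteq> insert v B'}"
    have "joins G ?F1 u a" using a by (intro joins_edge[of h]) auto
    moreover have "joins G ?F1 a v" by (rule joins_mono[OF ja]) auto
    ultimately have j1: "joins G ?F1 u v" by (rule joins_trans)
    have "joins G ?F2 u y" using xy xu by (intro joins_edge[of g]) auto
    moreover have "joins G ?F2 y v" by (rule joins_mono[OF jy]) auto
    ultimately have j2: "joins G ?F2 u v" by (rule joins_trans)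
    have "c \<in> \<Union> (ends G ` ?F1)"
      using separation_hits[OF sep _ _ uA vB j1] h ends_e by auto
    then have "c \<in> insert v A'" using hA' by auto
    then have cA': "c \<in> A'" using uv by auto
    have "c \<in> \<Union> (ends G ` ?F2)"
      using separation_hits[OF sep _ _ uA vB j2] g ends_e by auto
    then have "c \<in> insert v B' \<union> {u, y}" using xy xu by auto
    then have "c \<in> B'" using uv xy by auto
    with cA' S show False by blast
  qed
  have AV: "a \<in> verts G" if "a \<in> A' \<or> a \<in> B'" for a using that S by blast
  \<comment> \<open>The merged vertex becomes the cut vertex, so \<open>u\<close> leaves its side;
    \<open>x \<noteq> u\<close> ensures that \<open>g\<close> still joins the two remaining
    sides.\<close>
  have "separation (contract G e f) g (f ` (A' - {u})) (f u) (f ` B')"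
    unfolding separation_def
  proof (intro conjI ballI impI)
    show "verts (contract G e f) = insert (f u) (f ` (A' - {u}) \<union> f ` B')"
      using S(1) uA' f(1) by auto
    show "f u \<notin> f ` (A' - {u})"
    proof
      assume "f u \<in> f ` (A' - {u})"
      then obtain a where a: "a \<in> A'" "a \<noteq> u" "f u = f a" by blast
      then have "a = v" using f_eq[of u a] uv AV by blast
      with a S show False by blast
    qed
    show "f u \<notin> f ` B'"
    proof
      assume "f u \<in> f ` B'"
      then obtain a where a: "a \<in> B'" "f u = f a" by blast
      then have "a = u \<or> a = v" using f_eq[of u a] uv AV by blast
      with a S uB' show False by blast
    qed
    show "f ` (A' - {u}) \<inter> f ` B' = {}"
    proof (rule ccontr)
      assume "f ` (A' - {u}) \<inter> f ` B' \<noteq> {}"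
      then obtain a b where a: "a \<in> A'" "b \<in> B'" "f a = f b" by blast
      then have "a = b \<or> a = v \<or> b = v" using f_eq[of a b] AV by blast
      with a S show False by blast
    qed
    show "\<exists>x\<in>f ` (A' - {u}). \<exists>y\<in>f ` B'. ends (contract G e f) g = {x, y}"
      using xy \<open>x \<noteq> u\<close> by auto
    fix h assume "h \<in> edges (contract G e f)" "h \<noteq> g"
    then have "ends G h \<subseteq> insert v A' \<or> ends G h \<subseteq> insert v B'"
      using separationD(5)[OF sep', of h] by auto
    then show "ends (contract G e f) h \<subseteq> insert (f u) (f ` (A' - {u})) \<or>
        ends (contract G e f) h \<subseteq> insert (f u) (f ` B')"
      using f(1) by (auto simp: image_subset_iff)
  qed
  then show ?thesis by blast
qed

lemma separation_contract_away:
  assumes sep': "separation G g A' c' B'" and g: "g \<noteq> e" "g \<in> edges G"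
    and uA': "u \<in> A'" "v \<in> A'"
  shows "\<exists>A2 c2 B2. separation (contract G e f) g A2 c2 B2"
proof -
  obtain x y where xy: "x \<in> A'" "y \<in> B'" "ends G g = {x, y}"
    by (rule separation_ends[OF sep'])
  note S = separationD(1-4)[OF sep']
  have AV: "a \<in> verts G" if "a \<in> A' \<or> a \<in> B' \<or> a = c'" for a using that S by blast
  have ne: "u \<noteq> c'" "v \<noteq> c'" "u \<notin> B'" "v \<notin> B'" using S uA' by auto
  have "separation (contract G e f) g (f ` A') (f c') (f ` B')"
    unfolding separation_def
  proof (intro conjI ballI impI)
    show "verts (contract G e f) = insert (f c') (f ` A' \<union> f ` B')" using S(1) by auto
    show "f c' \<notin> f ` A'" "f c' \<notin> f ` B'"
    proof -
      have "f a \<noteq> f c'" if "a \<in> A' \<or> a \<in> B'" for a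
        using f_eq[of a c'] AV that ne S by blast
      then show "f c' \<notin> f ` A'" "f c' \<notin> f ` B'" by fastforce+
    qed
    show "f ` A' \<inter> f ` B' = {}"
    proof (rule ccontr)
      assume "f ` A' \<inter> f ` B' \<noteq> {}"
      then obtain a b where a: "a \<in> A'" "b \<in> B'" "f a = f b" by blast
      then have "a = b \<or> b = u \<or> b = v" using f_eq[of a b] AV by blast
      with a S ne show False by blast
    qed
    show "\<exists>x\<in>f ` A'. \<exists>y\<in>f ` B'. ends (contract G e f) g = {x, y}"
      using xy by auto
    fix h assume "h \<in> edges (contract G e f)" "h \<noteq> g"
    then have "ends G h \<subseteq> insert c' A' \<or> ends G h \<subseteq> insert c' B'"
      using separationD(5)[OF sep', of h] by auto
    then show "ends (contract G e f) h \<subseteq> insert (f c') (f ` A') \<or>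
        ends (contract G e f) h \<subseteq> insert (f c') (f ` B')"
      by (auto simp: image_subset_iff)
  qed
  then show ?thesis by blast
qed

text \<open>As \<open>e\<close> is not \<open>g\<close>, both ends of \<open>e\<close> lie in one
  closed side of the cut for \<open>g\<close>. Either \<open>e\<close> is contracted inside that
  side, or one of its ends is the cut vertex.\<close>

lemma contract_separation:
  assumes g: "g \<noteq> e" "g \<in> edges G"
  shows "\<exists>A2 c2 B2. separation (contract G e f) g A2 c2 B2"
proof -
  interpret flip: branch_contraction G e v u B c A f by (rule flip_branch)
  have *: "\<exists>A2 c2 B2. separation (contract G e f) g A2 c2 B2"
    if sep': "separation G g A' c' B'" and s: "ends G e \<subseteq> insert c' A'" for A' c' B'
  proof -
    consider "u \<in> A'" "v \<in> A'" | "c' = v" "u \<in> A'" | "c' = u" "v \<in> A'"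
      using s ends_e uv by auto
    then show ?thesis
    proof cases
      case 1
      then show ?thesis using separation_contract_away[OF sep' g] by blast
    next
      case 2
      then show ?thesis using separation_contract_end[of g A' B'] sep' g by blast
    next
      case 3
      then show ?thesis using flip.separation_contract_end[of g A' B'] sep' g by blast
    qed
  qed
  obtain A' c' B' where s: "separation G g A' c' B'" using criticalD(3)[OF crit g(2)] by blast
  from separationD(5)[OF s e g(1)[symmetric]] show ?thesis
    using *[OF s] *[OF separation_sym[OF s]] by blast
qed

text \<open>Deleting the merged vertex amounts to deleting \<open>u\<close> and \<open>v\<close>
  together, while \<open>G\<close> is only known to survive one deletion. A connection from
  \<open>a\<close> to \<open>c\<close> avoiding \<open>u\<close> can be retracted into
  \<open>insert c A\<close>, and then it avoids \<open>v\<close> as well.\<close>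

lemma avoid_joins_cut:
  assumes a: "a \<in> A" "a \<noteq> u"
  shows "joins G {h \<in> edges G. u \<notin> ends G h \<and> v \<notin> ends G h} a c"
proof -
  let ?D = "{h \<in> edges G. u \<notin> ends G h}"
  have "joins G ?D a c" using criticalD(2)[OF crit] uv a verts_eq by auto
  then have "joins G {h \<in> ?D. ends G h \<subseteq> insert c A} a c"
    using separation_restrict[OF sep, of ?D] a ends_e by auto
  moreover have "{h \<in> ?D. ends G h \<subseteq> insert c A} \<subseteq> {h \<in> edges G. u \<notin> ends G h \<and> v \<notin> ends G h}"
    using uv by auto
  ultimately show ?thesis by (rule joins_mono)
qed

lemma contract_critical: "critical (contract G e f)"
proof -
  interpret flip: branch_contraction G e v u B c A f by (rule flip_branch)
  let ?G = "contract G e f"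
  have conn: "joins ?G {h \<in> edges ?G. f z \<notin> ends ?G h} (f a) (f b)"
    if V: "z \<in> verts G" "a \<in> verts G" "b \<in> verts G" and ne: "f a \<noteq> f z" "f b \<noteq> f z" for z a b
  proof (cases "z = u \<or> z = v")
    case False
    have "joins G {h \<in> edges G. z \<notin> ends G h} a b" using criticalD(2)[OF crit V] ne by auto
    from contract_joins[OF this] show ?thesis
    proof (rule joins_mono)
      show "{h \<in> edges G. z \<notin> ends G h} - {e} \<subseteq> {h \<in> edges ?G. f z \<notin> ends ?G h}"
      proof (rule subsetI, rule ccontr)
        fix h assume "h \<in> {h \<in> edges G. z \<notin> ends G h} - {e}" "h \<notin> {h \<in> edges ?G. f z \<notin> ends ?G h}"
        then have h: "h \<in> edges G" "z \<notin> ends G h" "f z \<in> f ` ends G h" by auto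
        then obtain p where p: "p \<in> ends G h" "f z = f p" by blast
        then have "p \<in> verts G" using G h by (auto simp: multigraph_def)
        then show False using f_eq[of z p] V p h False by auto
      qed
    qed
  next
    case True
    \<comment> \<open>When the merged vertex is deleted, \<open>c\<close> is the meeting point:
      vertices of either side reach it without \<open>u\<close> and \<open>v\<close>.\<close>
    let ?D = "{h \<in> edges G. u \<notin> ends G h \<and> v \<notin> ends G h}"
    have abc: "joins G ?D a c" if "a \<in> verts G" "f a \<noteq> f z" for a
    proof -
      have "a \<noteq> u" "a \<noteq> v" using that True f(1) by auto
      moreover have "joins G {h \<in> edges G. v \<notin> ends G h \<and> u \<notin> ends G h} a c" if "a \<in> B"
        using flip.avoid_joins_cut that \<open>a \<noteq> v\<close> by blast
      then have "joins G ?D a c" if "a \<in> B" using that by (simp add: conj_commute)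
      ultimately show ?thesis using avoid_joins_cut[of a] that(1) verts_eq by auto
    qed
    have "joins G ?D a b" using joins_trans[OF abc joins_sym[OF abc]] V ne by blast
    from contract_joins[OF this] show ?thesis
    proof (rule joins_mono)
      show "?D - {e} \<subseteq> {h \<in> edges ?G. f z \<notin> ends ?G h}"
      proof (rule subsetI, rule ccontr)
        fix h assume "h \<in> ?D - {e}" "h \<notin> {h \<in> edges ?G. f z \<notin> ends ?G h}"
        then have h: "h \<in> edges G" "u \<notin> ends G h" "v \<notin> ends G h" "f z \<in> f ` ends G h" by auto
        then obtain p where p: "p \<in> ends G h" "f z = f p" by blast
        then have "p \<in> verts G" using G h by (auto simp: multigraph_def)
        then show False using f_eq[of z p] V p h True by auto
      qed
    qed
  qed
  show ?thesis
    unfolding critical_def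
    using contract_multigraph conn contract_separation by auto
qed

end

section \<open>The excess over 2 does not decrease under contraction\<close>

definition excess :: "('v, 'e) mgraph \<Rightarrow> 'v \<Rightarrow> 'v \<Rightarrow> nat" where
  "excess G x y = (if x = y then 0 else local_connectivity G x y - 2)"

text \<open>The sum runs over ordered pairs, so the average connectivity is
  \<open>2 + total_excess G / (n * (n - 1))\<close>.\<close>

definition total_excess :: "('v, 'e) mgraph \<Rightarrow> nat" where
  "total_excess G = (\<Sum>x\<in>verts G. \<Sum>y\<in>verts G. excess G x y)"

lemma excess_refl [simp]: "excess G x x = 0"
  by (simp add: excess_def)

lemma excess_commute: "excess G x y = excess G y x"
  by (simp add: excess_def local_connectivity_commute)

lemma sum2_insert:
  fixes p :: "'a \<Rightarrow> 'a \<Rightarrow> nat"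
  assumes "finite X" "z \<notin> X" "\<And>x y. p x y = p y x" "p z z = 0"
  shows "(\<Sum>x\<in>insert z X. \<Sum>y\<in>insert z X. p x y) = (\<Sum>x\<in>X. \<Sum>y\<in>X. p x y) + 2 * (\<Sum>y\<in>X. p z y)"
proof -
  have "(\<Sum>x\<in>X. p x z) = (\<Sum>y\<in>X. p z y)" by (intro sum.cong refl assms(3))
  then show ?thesis using assms(1,2,4) by (simp add: sum.distrib)
qed

context contraction
begin

lemma contract_excess_pair:
  assumes "x \<in> verts G - {u, v}" "y \<in> verts G - {u, v}"
  shows "excess G x y \<le> excess (contract G e f) (f x) (f y)"
proof (cases "x = y")
  case False
  interpret flip: contraction G e v u B c A f by (rule flip)
  have fne: "f x \<noteq> f y" using f_eq[of x y] assms False by auto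
  consider "x \<in> insert c A" "y \<in> insert c A" | "x \<in> insert c B" "y \<in> insert c B"
    | "x \<in> A" "y \<in> B" | "y \<in> A" "x \<in> B"
    using assms verts_eq by blast
  then show ?thesis
  proof cases
    case 1
    then show ?thesis
      using contract_connectivity_side[of x y] assms False fne by (simp add: excess_def diff_le_mono)
  next
    case 2
    then show ?thesis
      using flip.contract_connectivity_side[of x y] assms False fne by (simp add: excess_def diff_le_mono)
  next
    case 3
    then show ?thesis using local_connectivity_across[OF G sep, of x y] by (simp add: excess_def)
  next
    case 4
    then show ?thesis using local_connectivity_across[OF G sep, of y x]
      by (simp add: excess_def local_connectivity_commute[of G x y])
  qed
qed simp

text \<open>For \<open>y\<close> inside a side only the end of \<open>e\<close> in the same side can
  contribute. For \<open>y = c\<close> both ends may, and then the routes of the two sides add up at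
  the merged vertex.\<close>

lemma contract_excess_ends:
  assumes y: "y \<in> verts G - {u, v}"
  shows "excess G u y + excess G v y \<le> excess (contract G e f) (f u) (f y)"
proof -
  interpret flip: contraction G e v u B c A f by (rule flip)
  have yne: "u \<noteq> y" "v \<noteq> y" using y by auto
  have fne: "f u \<noteq> f y" using f_eq[of u y] uv y by auto
  have 1: "local_connectivity G u y \<le> local_connectivity (contract G e f) (f u) (f y)"
    using contract_connectivity_end y by auto
  have 2: "local_connectivity G v y \<le> local_connectivity (contract G e f) (f u) (f y)"
    using flip.contract_connectivity_end[of y] y f(1) by auto
  consider "y = c" | "y \<in> A" | "y \<in> B" using y verts_eq by blast
  then show ?thesis
  proof cases
    case 1
    then show ?thesis using 1 2 contract_connectivity_cut yne fne \<open>local_connectivity G u y \<le> _\<close>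
      by (auto simp: excess_def)
  next
    case 2
    then have "local_connectivity G v y \<le> 2"
      using local_connectivity_across[OF G sep _ vB] by (simp add: local_connectivity_commute[of G v y])
    then show ?thesis using yne fne \<open>local_connectivity G u y \<le> _\<close> by (simp add: excess_def diff_le_mono)
  next
    case 3
    then have "local_connectivity G u y \<le> 2" using local_connectivity_across[OF G sep uA] by blast
    then show ?thesis using yne fne \<open>local_connectivity G v y \<le> _\<close> by (simp add: excess_def diff_le_mono)
  qed
qed

lemma contract_total_excess: "total_excess G \<le> total_excess (contract G e f)"
proof -
  let ?G = "contract G e f" and ?V = "verts G - {u, v}"
  have fin: "finite ?V" using G by (simp add: multigraph_def)
  have V: "verts G = insert u (insert v ?V)" using uv by auto
  have inj: "inj_on f ?V" using f(2) by (rule inj_on_subset) auto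
  have V': "verts ?G = insert (f u) (f ` ?V)" using f(1) uv by (subst V) auto
  have fu: "f u \<notin> f ` ?V"
  proof
    assume "f u \<in> f ` ?V"
    then obtain y where "y \<in> ?V" "f u = f y" by blast
    then show False using f_eq[of u y] uv by auto
  qed
  \<comment> \<open>The pair of \<open>u\<close> and \<open>v\<close> vanishes in the contraction,
    so it must not have contributed.\<close>
  have uv0: "excess G u v = 0"
    using local_connectivity_across[OF G sep uA vB] by (simp add: excess_def)
  have fin': "finite (insert v ?V)" "u \<notin> insert v ?V" "v \<notin> ?V" using fin uv by auto
  have "total_excess G = (\<Sum>x\<in>?V. \<Sum>y\<in>?V. excess G x y) + 2 * (\<Sum>y\<in>?V. excess G v y)
      + 2 * (\<Sum>y\<in>insert v ?V. excess G u y)"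
    unfolding total_excess_def
    using sum2_insert[of _ _ "excess G", OF fin'(1,2) excess_commute excess_refl]
      sum2_insert[of _ _ "excess G", OF fin fin'(3) excess_commute excess_refl] V by simp
  also have "\<dots> = (\<Sum>x\<in>?V. \<Sum>y\<in>?V. excess G x y) + 2 * (\<Sum>y\<in>?V. excess G u y + excess G v y)"
    using fin uv0 by (simp add: sum.distrib)
  also have "\<dots> \<le> (\<Sum>x\<in>?V. \<Sum>y\<in>?V. excess ?G (f x) (f y)) + 2 * (\<Sum>y\<in>?V. excess ?G (f u) (f y))"
    by (intro add_mono mult_left_mono sum_mono contract_excess_pair contract_excess_ends) auto
  also have "\<dots> = (\<Sum>x\<in>f ` ?V. \<Sum>y\<in>f ` ?V. excess ?G x y) + 2 * (\<Sum>y\<in>f ` ?V. excess ?G (f u) y)"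
    by (simp add: sum.reindex[OF inj])
  also have "\<dots> = total_excess ?G"
    unfolding total_excess_def V'
    using sum2_insert[of _ _ "excess ?G", OF finite_imageI[OF fin] fu excess_commute excess_refl] by simp
  finally show ?thesis .
qed

end

definition branch_verts :: "('v, 'e) mgraph \<Rightarrow> 'v set" where
  "branch_verts G = {x \<in> verts G. 3 \<le> vdegree G x}"

text \<open>The two conditions on the number of vertices record that every contraction costs a
  vertex. Equality can therefore be studied on \<open>G\<close> itself, and the contraction need not
  be strict.\<close>

lemma exists_reduced:
  assumes "critical G"
  obtains G' :: "('v, 'e) mgraph" where "critical G'" "total_excess G \<le> total_excess G'"
    "card (verts G') \<le> card (verts G)" "card (verts G') = card (verts G) \<Longrightarrow> G' = G"
    "\<And>h. h \<in> edges G' \<Longrightarrow> \<not> ends G' h \<subseteq> branch_verts G'"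
proof -
  have "\<exists>G'. critical G' \<and> total_excess G \<le> total_excess G' \<and> card (verts G') \<le> card (verts G) \<and>
    (card (verts G') = card (verts G) \<longrightarrow> G' = G) \<and>
    (\<forall>h\<in>edges G'. \<not> ends G' h \<subseteq> branch_verts G')" if "critical G" for G :: "('v, 'e) mgraph"
    using that
  proof (induction "card (verts G)" arbitrary: G rule: less_induct)
    case less
    show ?case
    proof (cases "\<exists>h\<in>edges G. ends G h \<subseteq> branch_verts G")
      case False
      then show ?thesis using less.prems by (intro exI[of _ G]) auto
    next
      case True
      then obtain e where e: "e \<in> edges G" "ends G e \<subseteq> branch_verts G" by blast
      obtain A c B where sep: "separation G e A c B" using criticalD(3)[OF less.prems e(1)] by blast
      obtain u v where uv: "u \<in> A" "v \<in> B" "ends G e = {u, v}" by (rule separation_ends[OF sep])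
      \<comment> \<open>Sending \<open>v\<close> to \<open>u\<close> keeps the vertex type, as the
        induction requires.\<close>
      define f where "f = (\<lambda>z. if z = v then u else z)"
      have uvne: "u \<noteq> v" using uv separationD(4)[OF sep] by auto
      interpret branch_contraction G e u v A c B f
        using less.prems e sep uv uvne
        by unfold_locales (auto simp: f_def inj_on_def branch_verts_def)
      have V: "verts (contract G e f) = verts G - {v}"
        using uvne uv separationD(1)[OF sep] by (auto simp: f_def)
      have fin: "finite (verts G)" using criticalD(1)[OF less.prems] by (simp add: multigraph_def)
      have "v \<in> verts G" using uv separationD(1)[OF sep] by auto
      then have lt: "card (verts (contract G e f)) < card (verts G)"
        unfolding V using fin card_Diff1_less by metis
      from less.hyps[OF lt contract_critical] obtain G' :: "('v, 'e) mgraph" where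
        "critical G'" "total_excess (contract G e f) \<le> total_excess G'"
        "card (verts G') \<le> card (verts (contract G e f))" "\<forall>h\<in>edges G'. \<not> ends G' h \<subseteq> branch_verts G'"
        by blast
      with lt contract_total_excess show ?thesis by (intro exI[of _ G']) auto
    qed
  qed
  from this[OF assms] show thesis using that by blast
qed

section \<open>Minimally 2-connected graphs\<close>

lemma joins_remove [simp]:
  "joins (remove_verts G X) F = joins G F" "joins (remove_edge G g) F = joins G F"
  by (simp_all add: joins_def remove_verts_def remove_edge_def fun_eq_iff)

lemma remove_simps [simp]:
  "verts (remove_verts G X) = verts G - X" "verts (remove_edge G g) = verts G"
  "edges (remove_verts G X) = {h \<in> edges G. ends G h \<inter> X = {}}"
  "edges (remove_edge G g) = edges G - {g}"
  "ends (remove_verts G X) = ends G" "ends (remove_edge G g) = ends G"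
  by (simp_all add: remove_verts_def remove_edge_def)

lemma multigraph_remove:
  "multigraph G \<Longrightarrow> multigraph (remove_verts G X)" "multigraph G \<Longrightarrow> multigraph (remove_edge G g)"
  by (auto simp: multigraph_def remove_verts_def remove_edge_def)

lemma graph_connected_iff:
  assumes "multigraph G"
  shows "graph_connected G \<longleftrightarrow> (\<forall>u\<in>verts G. \<forall>v\<in>verts G. joins G (edges G) u v)"
proof
  assume c: "graph_connected G"
  show "\<forall>u\<in>verts G. \<forall>v\<in>verts G. joins G (edges G) u v"
  proof (intro ballI)
    fix u v assume "u \<in> verts G" "v \<in> verts G"
    with c obtain vs es where p: "is_path G u v (vs, es)"
      unfolding graph_connected_def by (metis prod.collapse)
    then have "set es \<subseteq> edges G" by (simp add: is_path_def)
    with path_joins[OF p] show "joins G (edges G) u v" by (rule joins_mono)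
  qed
next
  assume "\<forall>u\<in>verts G. \<forall>v\<in>verts G. joins G (edges G) u v"
  then show "graph_connected G"
    using joins_path[OF assms subset_refl] unfolding graph_connected_def by blast
qed

lemma graph_connected_remove_iff:
  assumes "multigraph G"
  shows "graph_connected (remove_verts G X) \<longleftrightarrow>
    (\<forall>a\<in>verts G - X. \<forall>b\<in>verts G - X. joins G {h \<in> edges G. ends G h \<inter> X = {}} a b)"
  unfolding graph_connected_iff[OF multigraph_remove(1)[OF assms]] by simp

lemma separation_from_cut:
  assumes G: "multigraph G" and g: "g \<in> edges G" "ends G g = {x, y}"
    and c: "c \<in> verts G" "c \<noteq> x" "c \<noteq> y"
    and cut: "\<not> joins G {h \<in> edges G. h \<noteq> g \<and> c \<notin> ends G h} x y"
  shows "\<exists>A c B. separation G g A c B"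
proof -
  let ?D = "{h \<in> edges G. h \<noteq> g \<and> c \<notin> ends G h}"
  define A where "A = {a \<in> verts G - {c}. joins G ?D x a}"
  define B where "B = verts G - {c} - A"
  note xy = multigraph_endsD[OF G g]
  have "separation G g A c B"
    unfolding separation_def
  proof (intro conjI ballI impI)
    show "verts G = insert c (A \<union> B)" using c by (auto simp: A_def B_def)
    show "\<exists>x\<in>A. \<exists>y\<in>B. ends G g = {x, y}"
    proof (intro bexI)
      show "ends G g = {x, y}" by (fact g(2))
      show "x \<in> A" using xy c by (simp add: A_def)
      show "y \<in> B" using xy c cut by (simp add: A_def B_def)
    qed
    fix h assume h: "h \<in> edges G" "h \<noteq> g"
    obtain p q where pq: "ends G h = {p, q}" "p \<in> verts G" "q \<in> verts G"
      by (rule multigraph_ends[OF G h(1)])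
    show "ends G h \<subseteq> insert c A \<or> ends G h \<subseteq> insert c B"
    proof (cases "c \<in> ends G h")
      case True
      then show ?thesis using pq by (auto simp: B_def)
    next
      case False
      then have "joins G ?D p q" using h pq by (intro joins_edge[of h]) auto
      then have "joins G ?D x p \<longleftrightarrow> joins G ?D x q"
        using joins_trans[of G ?D x p q] joins_trans[of G ?D x q p] joins_sym[of G ?D p q] by blast
      then show ?thesis using pq False by (auto simp: A_def B_def)
    qed
  qed (auto simp: A_def B_def)
  then show ?thesis by blast
qed

lemma minimally_2_connected_critical:
  assumes G: "multigraph G" and m: "minimally_2_connected G"
  shows "critical G" "3 \<le> card (verts G)"
proof -
  have fin: "finite (verts G)" using G by (simp add: multigraph_def)
  have n2: "2 \<le> card (verts G)" and k2: "connectivity G = 2"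
    and crit: "\<And>e. e \<in> edges G \<Longrightarrow> connectivity (remove_edge G e) < 2"
    using m by (auto simp: minimally_2_connected_def graph_order_def)
  have small: "graph_connected (remove_verts G X) \<and> card (verts G - X) \<noteq> 1"
    if "X \<subseteq> verts G" "card X < 2" for X
    using not_less_Least[OF that(2)[folded k2, unfolded connectivity_def]] that(1)
    by (auto simp: graph_order_def remove_verts_def)
  \<comment> \<open>With two vertices, removing one already leaves the trivial graph, however many
    parallel edges there are.\<close>
  show n3: "3 \<le> card (verts G)"
  proof (rule ccontr)
    assume "\<not> 3 \<le> card (verts G)"
    with n2 have "card (verts G) = 2" by simp
    then obtain a b where "verts G = {a, b}" "a \<noteq> b" by (auto simp: card_2_iff)
    then show False using small[of "{a}"] by simp
  qed
  have conn: "joins G {h \<in> edges G. z \<notin> ends G h} a b"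
    if "z \<in> verts G" "a \<in> verts G - {z}" "b \<in> verts G - {z}" for z a b
  proof -
    have "graph_connected (remove_verts G {z})" using small[of "{z}"] that(1) by simp
    with that(2,3) have "joins G {h \<in> edges G. ends G h \<inter> {z} = {}} a b"
      unfolding graph_connected_remove_iff[OF G] by blast
    then show ?thesis by simp
  qed
  have "\<exists>A c B. separation G g A c B" if g: "g \<in> edges G" for g
  proof -
    let ?G = "remove_edge G g"
    obtain x y where xy: "ends G g = {x, y}" "x \<noteq> y" "x \<in> verts G" "y \<in> verts G"
      by (rule multigraph_ends[OF G g])
    let ?P = "\<lambda>m. \<exists>X. X \<subseteq> verts ?G \<and> card X = m \<and>
      (\<not> graph_connected (remove_verts ?G X) \<or> graph_order (remove_verts ?G X) = 1)"
    \<comment> \<open>Keeping a single vertex produces the trivial graph. The set behind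
      \<open>LEAST\<close> is thus nonempty, so the value is attained and a small cut of
      \<open>G - g\<close> can be extracted.\<close>
    have "?P (card (verts G - {x}))"
      using xy by (intro exI[of _ "verts G - {x}"]) 
        (auto simp: remove_edge_def remove_verts_def graph_order_def Diff_Diff_Int)
    then have "?P (connectivity ?G)" unfolding connectivity_def by (rule LeastI)
    then obtain X where X: "X \<subseteq> verts G" "card X < 2"
      and dis: "\<not> graph_connected (remove_verts ?G X) \<or> card (verts G - X) = 1"
      using crit[OF g] by (auto simp: remove_edge_def remove_verts_def graph_order_def)
    have "\<not> graph_connected (remove_verts ?G X)" using dis small[OF X] by blast
    then obtain a b where ab: "a \<in> verts G - X" "b \<in> verts G - X"
      and nj: "\<not> joins G {h \<in> edges G - {g}. ends G h \<inter> X = {}} a b"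
      unfolding graph_connected_remove_iff[OF multigraph_remove(2)[OF G]] joins_remove
      by (auto simp: remove_edge_def)
    let ?D = "{h \<in> edges G - {g}. ends G h \<inter> X = {}}"
    have j: "joins G {h \<in> edges G. ends G h \<inter> X = {}} a b"
      using small[OF X] ab unfolding graph_connected_remove_iff[OF G] by blast
    have gX: "ends G g \<inter> X = {}"
    proof (rule ccontr)
      assume "ends G g \<inter> X \<noteq> {}"
      then have "{h \<in> edges G. ends G h \<inter> X = {}} = ?D" by auto
      with j nj show False by simp
    qed
    have njxy: "\<not> joins G ?D x y"
    proof
      assume xyj: "joins G ?D x y"
      have "joins G ?D a b"
        using j
      proof (rule joins_morphism[where r = "\<lambda>z. z"])
        fix h p q assume h: "h \<in> {h \<in> edges G. ends G h \<inter> X = {}}" "ends G h = {p, q}"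
        show "joins G ?D p q"
        proof (cases "h = g")
          case True
          then have "p = x \<and> q = y \<or> p = y \<and> q = x" using h(2) xy(1) by (auto simp: doubleton_eq_iff)
          then show ?thesis using xyj joins_sym[OF xyj] by blast
        next
          case False
          then show ?thesis using h by (intro joins_edge[of h]) auto
        qed
      qed
      with nj show False by simp
    qed
    \<comment> \<open>If \<open>G - g\<close> is disconnected without removing a vertex, any third
      vertex can play the role of \<open>c\<close>.\<close>
    have "\<exists>c\<in>verts G. c \<noteq> x \<and> c \<noteq> y \<and> X \<subseteq> {c}"
    proof (cases "X = {}")
      case True
      have "card {x, y} < card (verts G)" using n3 by (simp add: card_insert_if)
      then have "\<not> verts G \<subseteq> {x, y}" using card_mono[of "{x, y}" "verts G"] by auto
      then show ?thesis using True by blast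
    next
      case False
      have "finite X" using X(1) fin by (rule finite_subset)
      then have "card X = 1" using False X(2) by (metis One_nat_def card_0_eq less_2_cases)
      then obtain z where "X = {z}" by (auto simp: card_1_singleton_iff)
      then show ?thesis using X(1) gX xy(1) by auto
    qed
    then obtain c where c: "c \<in> verts G" "c \<noteq> x" "c \<noteq> y" "X \<subseteq> {c}" by blast
    have "\<not> joins G {h \<in> edges G. h \<noteq> g \<and> c \<notin> ends G h} x y"
    proof
      assume "joins G {h \<in> edges G. h \<noteq> g \<and> c \<notin> ends G h} x y"
      then have "joins G ?D x y" by (rule joins_mono) (use c(4) in auto)
      with njxy show False by simp
    qed
    with separation_from_cut[OF G g xy(1) c(1-3)] show ?thesis by blast
  qed
  with G conn show "critical G" unfolding critical_def by blast
qed

section \<open>Two internally disjoint routes between any two vertices\<close>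

definition two_routes :: "('v, 'e) mgraph \<Rightarrow> 'v \<Rightarrow> 'v \<Rightarrow> 'e set \<Rightarrow> 'e set \<Rightarrow> bool" where
  "two_routes G x y F F' \<longleftrightarrow> F \<subseteq> edges G \<and> F' \<subseteq> edges G \<and> joins G F x y \<and> joins G F' x y \<and>
     F \<inter> F' = {} \<and> \<Union> (ends G ` F) \<inter> \<Union> (ends G ` F') \<subseteq> {x, y}"

lemma two_routes_sym: "two_routes G x y F F' \<Longrightarrow> two_routes G x y F' F"
  unfolding two_routes_def by (simp add: Int_commute)

text \<open>For a path \<open>F\<close> this is the part preceding \<open>y\<close>. An arbitrary
  edge set has no order, so the component of \<open>x\<close> after deleting \<open>y\<close> takes
  its place.\<close>

definition before :: "('v, 'e) mgraph \<Rightarrow> 'v \<Rightarrow> 'v \<Rightarrow> 'e set \<Rightarrow> 'v set" where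
  "before G x y F = {z. joins G {h \<in> F. y \<notin> ends G h} x z}"

lemma before_start: "x \<noteq> y \<Longrightarrow> x \<in> before G x y F" 
  by (simp add: before_def)

lemma before_avoids:
  assumes "x \<noteq> y"
  shows "y \<notin> before G x y F"
proof
  assume "y \<in> before G x y F"
  then have "joins G {h \<in> F. y \<notin> ends G h} y x" by (simp add: before_def joins_sym)
  from joins_end_in[OF this] assms show False by auto
qed

lemma before_span: "z \<in> before G x y F \<Longrightarrow> z \<noteq> x \<Longrightarrow> z \<in> \<Union> (ends G ` F)"
  using joins_end_in[OF joins_sym, of G "{h \<in> F. y \<notin> ends G h}" x z] by (auto simp: before_def)

lemma before_joins:
  assumes "z \<in> before G x y F"
  shows "joins G {h \<in> F. ends G h \<subseteq> before G x y F} x z"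
proof -
  have "joins G {h \<in> F. y \<notin> ends G h} x z" using assms by (simp add: before_def)
  then show ?thesis
  proof (induction rule: joins_induct)
    case (step p q e)
    then have "joins G {h \<in> F. y \<notin> ends G h} p q" by (intro joins_edge[of e])
    from joins_trans[OF step(1) this] step(1) have "p \<in> before G x y F" "q \<in> before G x y F"
      by (simp_all add: before_def)
    then have "joins G {h \<in> F. ends G h \<subseteq> before G x y F} p q"
      using step by (intro joins_edge[of e]) auto
    from joins_trans[OF _ this] step show ?case by blast
  qed simp
qed

lemma before_exit:
  assumes "joins G F x y" "x \<noteq> y"
  shows "\<exists>k\<in>F. \<exists>a\<in>before G x y F. ends G k = {a, y}"
proof -
  have "w \<in> before G x y F \<or> (\<exists>k\<in>F. \<exists>a\<in>before G x y F. ends G k = {a, y})"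
    if "joins G F x w" for w
    using that
  proof (induction rule: joins_induct)
    case refl
    show ?case by (intro disjI1 before_start assms(2))
  next
    case (step p q e)
    show ?case
    proof (cases "p \<in> before G x y F \<and> q \<noteq> y")
      case True
      then have "p \<noteq> y" using before_avoids[OF assms(2)] by metis
      then have "joins G {h \<in> F. y \<notin> ends G h} p q" using step True by (intro joins_edge[of e]) auto
      from joins_trans[OF _ this, of x] True show ?thesis by (simp add: before_def)
    next
      case False
      then show ?thesis using step by blast
    qed
  qed
  from this[OF assms(1)] show ?thesis using before_avoids[OF assms(2)] by metis
qed

text \<open>\<open>Q\<close> is the part of a walk from \<open>x\<close> to \<open>w\<close> after
  its last visit to \<open>Y\<close>: whenever the walk enters \<open>Y\<close>, the witnesses are
  reset to the current vertex and the empty set.\<close>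

lemma joins_first_hit:
  assumes "joins G D w x" "x \<in> Y"
  shows "\<exists>z\<in>Y. \<exists>Q\<subseteq>D. joins G Q z w \<and> \<Union> (ends G ` Q) \<inter> Y \<subseteq> {z}"
  using joins_sym[OF assms(1)]
proof (induction rule: joins_induct)
  case refl
  show ?case using assms(2) by (intro bexI[of _ x] exI[of _ "{}"]) auto
next
  case (step p q e)
  then obtain z Q where zQ: "z \<in> Y" "Q \<subseteq> D" "joins G Q z p" "\<Union> (ends G ` Q) \<inter> Y \<subseteq> {z}" by blast
  show ?case
  proof (cases "q \<in> Y")
    case True
    then show ?thesis by (intro bexI[of _ q] exI[of _ "{}"]) auto
  next
    case False
    have "p \<in> Y \<Longrightarrow> p = z" using joins_end_in[OF joins_sym[OF zQ(3)]] zQ(4) by blast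
    then have "\<Union> (ends G ` insert e Q) \<inter> Y \<subseteq> {z}" using zQ(4) False step by auto
    moreover have "joins G (insert e Q) z q"
    proof (rule joins_trans)
      show "joins G (insert e Q) z p" by (rule joins_mono[OF zQ(3)]) blast
      show "joins G (insert e Q) p q" by (rule joins_edge[of e]) (use step in auto)
    qed
    ultimately show ?thesis using zQ(1,2) step by (intro bexI[of _ z] exI[of _ "insert e Q"]) auto
  qed
qed

text \<open>The exchange step for moving the target from \<open>y\<close> to its neighbour
  \<open>q\<close>. One new route follows \<open>F\<close> up to \<open>z\<close> and then
  \<open>Q\<close>; the other follows \<open>F'\<close> up to \<open>y\<close> and then takes
  \<open>g\<close>.\<close>

lemma two_routes_extend_side:
  assumes G: "multigraph G" and r: "two_routes G x y F F'" and ne: "x \<noteq> y" "q \<noteq> x"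
    and g: "g \<in> edges G" "ends G g = {y, q}"
    and z: "z \<in> before G x y F" and Q: "Q \<subseteq> edges G" "joins G Q z q" "y \<notin> \<Union> (ends G ` Q)"
      "\<Union> (ends G ` Q) \<inter> (before G x y F \<union> before G x y F') \<subseteq> {z}"
  shows "\<exists>F1 F2. two_routes G x q F1 F2"
proof -
  let ?K = "before G x y F" and ?K' = "before G x y F'"
  have r': "F \<subseteq> edges G" "F' \<subseteq> edges G" "joins G F x y" "joins G F' x y" "F \<inter> F' = {}"
     "\<Union> (ends G ` F) \<inter> \<Union> (ends G ` F') \<subseteq> {x, y}" using r by (auto simp: two_routes_def)
  have yq: "y \<noteq> q" using multigraph_endsD[OF G g] by simp
  obtain k a where k: "k \<in> F'" "a \<in> ?K'" "ends G k = {a, y}"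
    using before_exit[OF r'(4) ne(1)] by blast
  have yK: "y \<notin> ?K" "y \<notin> ?K'" by (rule before_avoids[OF ne(1)])+
  have KK: "w = x" if "w \<in> ?K" "w \<in> ?K'" for w
  proof (rule ccontr)
    assume wx: "w \<noteq> x"
    have "w \<in> {x, y}"
      by (rule subsetD[OF r'(6) IntI[OF before_span[OF that(1) wx] before_span[OF that(2) wx]]])
    with wx that(1) yK(1) show False by auto
  qed
  let ?N = "{h \<in> F. ends G h \<subseteq> ?K}" and ?N' = "{h \<in> F'. ends G h \<subseteq> ?K'}"
  let ?F = "?N \<union> Q" and ?F' = "?N' \<union> {k, g}"
  have j: "joins G ?F x q"
  proof (rule joins_trans)
    show "joins G ?F x z" by (rule joins_mono[OF before_joins[OF z]]) simp
    show "joins G ?F z q" by (rule joins_mono[OF Q(2)]) simp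
  qed
  have j': "joins G ?F' x q"
  proof (rule joins_trans, rule joins_trans)
    show "joins G ?F' x a" by (rule joins_mono[OF before_joins[OF k(2)]]) blast
    show "joins G ?F' a y" by (rule joins_edge[of k]) (use k in auto)
    show "joins G ?F' y q" by (rule joins_edge[of g]) (use g in auto)
  qed
  have span: "w = x \<or> w = q" if w: "w \<in> \<Union> (ends G ` ?F)" "w \<in> \<Union> (ends G ` ?F')" for w
  proof -
    have "w \<in> ?K' \<or> w = y \<or> w = q" using w(2) k g by auto
    moreover have "w \<in> ?K \<or> w \<in> \<Union> (ends G ` Q)" using w(1) by auto
    ultimately consider "w \<in> ?K'" "w \<in> ?K" | "w \<in> ?K'" "w \<in> \<Union> (ends G ` Q)" | "w = q"
      using yK(1) Q(3) by metis
    then show ?thesis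
    proof cases
      case 2
      then have "w = z" using Q(4) by blast
      with 2 z KK show ?thesis by blast
    qed (use KK in auto)
  qed
  \<comment> \<open>The spans share at most \<open>x\<close> and \<open>q\<close>, so a common edge
    joins these two and is neither \<open>k\<close> nor \<open>g\<close>. It then lies in
    \<open>F'\<close>, hence not in \<open>F\<close>; and if it were in \<open>Q\<close>, then
    \<open>Q\<close> would meet \<open>before G x y F'\<close> in two vertices.\<close>
  have dis: "?F \<inter> ?F' = {}"
  proof (rule ccontr)
    assume "?F \<inter> ?F' \<noteq> {}"
    then obtain h where h: "h \<in> ?F" "h \<in> ?F'" by blast
    have "h \<in> edges G" using h(1) r'(1) Q(1) by blast
    then obtain p s where ps: "ends G h = {p, s}" "p \<noteq> s" using multigraph_ends[OF G] by metis
    have "w = x \<or> w = q" if "w \<in> ends G h" for w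
      by (rule span; rule UN_I[where a = h]; fact h that)
    then have "p = x \<or> p = q" "s = x \<or> s = q" using ps(1) by auto
    then have eh: "ends G h = {x, q}" using ps by auto
    then have "h \<noteq> k" "h \<noteq> g" using k(3) g(2) ne yq by auto
    then have N': "h \<in> F'" "ends G h \<subseteq> ?K'" using h(2) by auto
    show False
    proof (cases "h \<in> Q")
      case True
      then have "{x, q} \<subseteq> \<Union> (ends G ` Q) \<inter> ?K'" using eh N' by blast
      then have "{x, q} \<subseteq> {z}" using Q(4) by blast
      with ne show False by auto
    next
      case False
      then show False using h(1) N'(1) r'(5) by blast
    qed
  qed
  have "?F \<subseteq> edges G" "?F' \<subseteq> edges G" using r'(1,2) Q(1) k(1) g(1) by auto
  moreover have "\<Union> (ends G ` ?F) \<inter> \<Union> (ends G ` ?F') \<subseteq> {x, q}" using span by blast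
  ultimately show ?thesis using j j' dis unfolding two_routes_def by blast
qed

text \<open>Whitney's theorem on 2-connected graphs, by induction along a walk starting at
  \<open>x\<close>. Through \<open>two_le_local_connectivity\<close> it makes the truncated
  difference in \<open>excess\<close> exact.\<close>

lemma two_routes_exist:
  assumes crit: "critical G" and n3: "3 \<le> card (verts G)"
    and xy: "x \<in> verts G" "y \<in> verts G" "x \<noteq> y"
  shows "\<exists>F F'. two_routes G x y F F'"
proof -
  note G = criticalD(1)[OF crit] and conn = criticalD(2)[OF crit]
  have third: "\<exists>z\<in>verts G. z \<noteq> a \<and> z \<noteq> b" for a b
  proof (rule ccontr)
    assume "\<not> ?thesis"
    then have "verts G \<subseteq> {a, b}" by blast
    then have "card (verts G) \<le> card {a, b}" by (intro card_mono) auto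
    moreover have "card {a, b} \<le> 2" by (simp add: card_insert_if)
    ultimately show False using n3 by linarith
  qed
  obtain z where z: "z \<in> verts G" "z \<noteq> x" "z \<noteq> y" using third by blast
  have "joins G (edges G) x y"
    by (rule joins_mono[OF conn[OF z(1) xy(1,2)]]) (use z in auto)
  then have "y = x \<or> (\<exists>F F'. two_routes G x y F F')"
  proof (induction rule: joins_induct)
    case (step p q g)
    have g: "g \<in> edges G" "ends G g = {p, q}" by fact+
    note pq = multigraph_endsD[OF G g]
    show ?case
    proof (cases "q = x")
      case qx: False
      show ?thesis
      proof (cases "p = x")
        case px: True
        obtain z where z: "z \<in> verts G" "z \<noteq> x" "z \<noteq> q" using third by blast
        \<comment> \<open>The edge \<open>g\<close> is one route. The other passes a third vertex
          \<open>z\<close>, reached without \<open>q\<close> and left without \<open>x\<close>, so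
          neither half contains \<open>g\<close>.\<close>
        let ?F = "{h \<in> edges G. q \<notin> ends G h} \<union> {h \<in> edges G. x \<notin> ends G h}"
        have "joins G ?F x z"
          by (rule joins_mono[OF conn[of q x z]]) (use z pq xy qx in auto)
        moreover have "joins G ?F z q"
          by (rule joins_mono[OF conn[of x z q]]) (use z pq xy qx in auto)
        ultimately have "joins G ?F x q" by (rule joins_trans)
        moreover have "joins G {g} x q" using g px by (intro joins_edge[of g]) auto
        ultimately have "two_routes G x q {g} ?F"
          using g px unfolding two_routes_def by auto
        then show ?thesis by blast
      next
        case px: False
        with step obtain F F' where r: "two_routes G x p F F'" by blast
        let ?Y = "before G x p F \<union> before G x p F'"
        have jq: "joins G {h \<in> edges G. p \<notin> ends G h} q x" using conn[of p q x] pq px xy by auto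
        have xY: "x \<in> ?Y" by (intro UnI1 before_start) (use px in auto)
        obtain z Q where zQ: "z \<in> ?Y" "Q \<subseteq> {h \<in> edges G. p \<notin> ends G h}" "joins G Q z q"
          "\<Union> (ends G ` Q) \<inter> ?Y \<subseteq> {z}"
          using joins_first_hit[OF jq xY] by (elim bexE exE conjE)
        have Q: "Q \<subseteq> edges G" "p \<notin> \<Union> (ends G ` Q)" using zQ(2) by auto
        from zQ(1) show ?thesis
        proof
          assume "z \<in> before G x p F"
          then have "\<exists>F F'. two_routes G x q F F'"
            by (rule two_routes_extend_side[OF G r px[symmetric] qx g _ Q(1) zQ(3) Q(2) zQ(4)])
          then show ?thesis by blast
        next
          assume "z \<in> before G x p F'"
          then have "\<exists>F F'. two_routes G x q F F'"
            by (rule two_routes_extend_side[OF G two_routes_sym[OF r] px[symmetric] qx g _ Q(1) zQ(3) Q(2)])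
              (use zQ(4) in \<open>simp add: Un_commute\<close>)
          then show ?thesis by blast
        qed
      qed
    qed simp
  qed simp
  with xy(3) show ?thesis by simp
qed

lemma two_le_local_connectivity:
  assumes "critical G" "3 \<le> card (verts G)" "x \<in> verts G" "y \<in> verts G" "x \<noteq> y"
  shows "2 \<le> local_connectivity G x y"
proof -
  obtain F F' where r: "two_routes G x y F F'" using two_routes_exist[OF assms] by blast
  then have "card {F, F'} \<le> local_connectivity G x y"
    using assms(1,3,5) criticalD(1)[OF assms(1)]
    by (intro le_local_connectivity) (auto simp: route_system_def two_routes_def)
  moreover have "F \<noteq> {}" using r assms(5) joins_nonempty unfolding two_routes_def by (metis empty_iff)
  then have "F \<noteq> F'" using r unfolding two_routes_def by blast
  ultimately show ?thesis by simp
qed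

section \<open>Sums of minima\<close>

definition min_sum :: "'a set \<Rightarrow> ('a \<Rightarrow> int) \<Rightarrow> int" where
  "min_sum S d = (\<Sum>x\<in>S. \<Sum>y\<in>S. if x = y then 0 else min (d x) (d y))"

text \<open>\<open>min a b\<close> is the mean of \<open>a\<close> and \<open>b\<close> minus half
  their distance, so for a given sum the minima are maximised by minimising the total
  distance.\<close>

lemma min_sum_abs:
  assumes "finite S"
  shows "2 * min_sum S d =
    2 * ((int (card S) - 1) * sum d S) - (\<Sum>x\<in>S. \<Sum>y\<in>S. \<bar>d x - d y\<bar>)"
proof -
  have "2 * min_sum S d =
      (\<Sum>x\<in>S. \<Sum>y\<in>S. d x + d y - \<bar>d x - d y\<bar> - (if x = y then 2 * d x else 0))"
    unfolding min_sum_def sum_distrib_left by (intro sum.cong) auto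
  also have "\<dots> = (\<Sum>x\<in>S. \<Sum>y\<in>S. d x) + (\<Sum>x\<in>S. \<Sum>y\<in>S. d y) - (\<Sum>x\<in>S. \<Sum>y\<in>S. \<bar>d x - d y\<bar>)
      - (\<Sum>x\<in>S. \<Sum>y\<in>S. if x = y then 2 * d x else 0)"
    by (simp only: sum_subtractf sum.distrib)
  also have "(\<Sum>x\<in>S. \<Sum>y\<in>S. if x = y then 2 * d x else 0) = 2 * sum d S"
    using assms by (simp add: sum_distrib_left)
  also have "(\<Sum>x\<in>S. \<Sum>y\<in>S. d x) = int (card S) * sum d S"
    by (simp add: sum_distrib_left)
  also have "(\<Sum>x\<in>S. \<Sum>y\<in>S. d y) = int (card S) * sum d S"
    by simp
  finally show ?thesis by (simp add: algebra_simps)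
qed

lemma min_sum_le_mean:
  assumes "finite S"
  shows "min_sum S d \<le> (int (card S) - 1) * sum d S"
proof -
  have "0 \<le> (\<Sum>x\<in>S. \<Sum>y\<in>S. \<bar>d x - d y\<bar>)" by (intro sum_nonneg) auto
  with min_sum_abs[OF assms, of d] show ?thesis by linarith
qed

text \<open>Distances within \<open>P\<close> and within its complement are dropped. Nothing is lost
  when \<open>d\<close> is constant on each of the two sets, as in the extremal case.\<close>

lemma abs_sum_ge_split:
  fixes d :: "'a \<Rightarrow> int"
  assumes "finite S" "P \<subseteq> S"
  shows "2 * (\<Sum>x\<in>P. \<Sum>y\<in>S - P. d x - d y) \<le> (\<Sum>x\<in>S. \<Sum>y\<in>S. \<bar>d x - d y\<bar>)"
proof -
  let ?N = "S - P" and ?f = "\<lambda>x y. \<bar>d x - d y\<bar>"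
  have fin: "finite P" "finite ?N" using assms finite_subset by auto
  have un: "sum g S = sum g P + sum g ?N" for g :: "'a \<Rightarrow> int"
    using sum.subset_diff[OF assms(2,1), of g] by simp
  have "(\<Sum>x\<in>P. \<Sum>y\<in>?N. d x - d y) \<le> (\<Sum>x\<in>P. \<Sum>y\<in>?N. ?f x y)"
    by (intro sum_mono) auto
  moreover have "(\<Sum>x\<in>P. \<Sum>y\<in>?N. ?f x y) = (\<Sum>x\<in>?N. \<Sum>y\<in>P. ?f x y)"
    by (subst sum.swap) (simp add: abs_minus_commute)
  moreover have "(\<Sum>x\<in>S. \<Sum>y\<in>S. ?f x y) = (\<Sum>x\<in>P. \<Sum>y\<in>P. ?f x y) + (\<Sum>x\<in>P. \<Sum>y\<in>?N. ?f x y)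
      + ((\<Sum>x\<in>?N. \<Sum>y\<in>P. ?f x y) + (\<Sum>x\<in>?N. \<Sum>y\<in>?N. ?f x y))"
    by (simp add: un sum.distrib)
  moreover have "0 \<le> (\<Sum>x\<in>P. \<Sum>y\<in>P. ?f x y)" "0 \<le> (\<Sum>x\<in>?N. \<Sum>y\<in>?N. ?f x y)"
    by (intro sum_nonneg; auto)+
  ultimately show ?thesis by linarith
qed

text \<open>In the application \<open>p\<close> of \<open>s\<close> values exceed \<open>q\<close>,
  by \<open>\<alpha>\<close> in total, and the others fall short of it by \<open>\<beta>\<close>.
  Then \<open>(s - p) * \<alpha> + p * \<beta>\<close> is the total distance across the threshold,
  and \<open>r * (s - r)\<close> is its value for \<open>r\<close> entries \<open>q + 1\<close> and
  \<open>s - r\<close> entries \<open>q\<close>.\<close>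

lemma split_bound:
  fixes \<alpha> \<beta> p r s :: int
  assumes "p \<le> \<alpha>" "0 \<le> p" "p \<le> s" "0 \<le> \<beta>" "\<alpha> - \<beta> = r" "0 \<le> r" "r \<le> s" "0 < s"
  shows "r * (s - r) \<le> (s - p) * \<alpha> + p * \<beta>"
    "(s - p) * \<alpha> + p * \<beta> = r * (s - r) \<Longrightarrow> p = r \<and> \<alpha> = p \<and> \<beta> = 0"
proof -
  have a: "\<alpha> = r + \<beta>" using assms by simp
  have e: "(s - p) * \<alpha> + p * \<beta> - r * (s - r) = (r - p) * r + s * \<beta>"
    unfolding a by (simp add: algebra_simps)
  have "0 \<le> (r - p) * r + s * \<beta> \<and> ((r - p) * r + s * \<beta> = 0 \<longrightarrow> p = r \<and> \<beta> = 0)"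
  proof (cases "r < p")
    case False
    have "0 \<le> (r - p) * r" "0 \<le> s * \<beta>" using False assms by auto
    moreover have "0 < (r - p) * r" if "p \<noteq> r" using False that assms by auto
    moreover have "0 < s * \<beta>" if "\<beta> \<noteq> 0" using that assms by auto
    ultimately show ?thesis by force
  next
    case True
    \<comment> \<open>From \<open>p \<le> \<alpha> = r + \<beta>\<close> the shortfall
      \<open>\<beta>\<close> is at least \<open>p - r\<close>; multiplied by \<open>s\<close> this
      outweighs the negative term \<open>(r - p) * r\<close>, because
      \<open>r < p \<le> s\<close>.\<close>
    have "s * (p - r) \<le> s * \<beta>" using assms a by (intro mult_left_mono) auto
    moreover have "0 < (s - r) * (p - r)" using True assms by (intro mult_pos_pos) auto
    moreover have "(s - r) * (p - r) = s * (p - r) + (r - p) * r" by (simp add: algebra_simps)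
    ultimately show ?thesis by linarith
  qed
  with e assms a show "r * (s - r) \<le> (s - p) * \<alpha> + p * \<beta>"
    "(s - p) * \<alpha> + p * \<beta> = r * (s - r) \<Longrightarrow> p = r \<and> \<alpha> = p \<and> \<beta> = 0"
    by auto
qed

text \<open>In the extremal value every ordered pair counts \<open>q\<close>, and a pair of entries
  \<open>q + 1\<close> counts one more. By the equality case of \<open>split_bound\<close> no entry
  may then lie above \<open>q + 1\<close> or below \<open>q\<close>.\<close>

lemma min_sum_bound_exact:
  assumes fin: "finite S" and D: "sum d S = q * int (card S) + r" and r: "0 \<le> r" "r \<le> int (card S)"
    and ne: "S \<noteq> {}"
  shows "min_sum S d \<le> q * int (card S) * (int (card S) - 1) + r * (r - 1)"
    "min_sum S d = q * int (card S) * (int (card S) - 1) + r * (r - 1) \<Longrightarrow>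
      x \<in> S \<Longrightarrow> d x = q \<or> d x = q + 1"
proof -
  define P where "P = {x \<in> S. q < d x}"
  let ?N = "S - P" and ?s = "int (card S)" and ?p = "int (card P)"
  define \<alpha> where "\<alpha> = (\<Sum>x\<in>P. d x - q)"
  define \<beta> where "\<beta> = (\<Sum>x\<in>?N. q - d x)"
  have PS: "P \<subseteq> S" by (auto simp: P_def)
  have finP: "finite P" using PS fin by (rule finite_subset)
  have pl: "?p \<le> ?s" using card_mono[OF fin PS] by simp
  have cN: "int (card ?N) = ?s - ?p"
    using card_Diff_subset[OF finP PS] card_mono[OF fin PS] by simp
  have \<alpha>p: "\<alpha> - ?p = (\<Sum>x\<in>P. d x - q - 1)" unfolding \<alpha>_def by (simp add: sum_subtractf)
  have "0 \<le> (\<Sum>x\<in>P. d x - q - 1)" by (rule sum_nonneg) (auto simp: P_def)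
  with \<alpha>p have \<alpha>: "?p \<le> \<alpha>" by simp
  have \<beta>: "0 \<le> \<beta>" unfolding \<beta>_def by (rule sum_nonneg) (auto simp: P_def)
  have "sum d S = sum d P + sum d ?N" using sum.subset_diff[OF PS fin, of d] by simp
  moreover have "q * ?s = q * ?p + q * int (card ?N)" unfolding cN by (simp add: algebra_simps)
  ultimately have ab: "\<alpha> - \<beta> = r"
    using D unfolding \<alpha>_def \<beta>_def by (simp add: sum_subtractf algebra_simps)
  have "(\<Sum>x\<in>P. \<Sum>y\<in>?N. d x - d y) = (\<Sum>x\<in>P. \<Sum>y\<in>?N. (d x - q) + (q - d y))" by simp
  also have "\<dots> = (?s - ?p) * \<alpha> + ?p * \<beta>"
    using cN unfolding sum.distrib \<alpha>_def \<beta>_def by (simp add: sum_distrib_left)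
  finally have "2 * ((?s - ?p) * \<alpha> + ?p * \<beta>) \<le> (\<Sum>x\<in>S. \<Sum>y\<in>S. \<bar>d x - d y\<bar>)"
    using abs_sum_ge_split[OF fin PS, of d] by simp
  moreover have "m \<le> a - x" if "2 * m = 2 * a - b" "2 * x \<le> b" for m a b x :: int
    using that by linarith
  ultimately have up: "min_sum S d \<le> (?s - 1) * sum d S - ((?s - ?p) * \<alpha> + ?p * \<beta>)"
    using min_sum_abs[OF fin, of d] by blast
  have eq: "(?s - 1) * sum d S - r * (?s - r) = q * ?s * (?s - 1) + r * (r - 1)"
    unfolding D by (simp add: algebra_simps)
  have s0: "0 < ?s" using ne fin by (simp add: card_gt_0_iff)
  note sb = split_bound[OF \<alpha> _ pl \<beta> ab r s0]
  show "min_sum S d \<le> q * ?s * (?s - 1) + r * (r - 1)" using up eq sb(1) by linarith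
  assume tight: "min_sum S d = q * ?s * (?s - 1) + r * (r - 1)" and x: "x \<in> S"
  have "(?s - ?p) * \<alpha> + ?p * \<beta> = r * (?s - r)" using up eq sb(1) tight by linarith
  then have "\<alpha> = ?p" "\<beta> = 0" using sb(2) by auto
  then have P0: "(\<Sum>x\<in>P. d x - q - 1) = 0" and N0: "(\<Sum>x\<in>?N. q - d x) = 0"
    using \<alpha>p by (simp_all add: \<beta>_def)
  show "d x = q \<or> d x = q + 1"
  proof (cases "q < d x")
    case True
    then have "d x - q - 1 = 0"
      using x by (intro sum_nonneg_0[OF finP _ P0]) (auto simp: P_def)
    then show ?thesis by simp
  next
    case False
    then have "q - d x = 0"
      using x fin by (intro sum_nonneg_0[OF _ _ N0]) (auto simp: P_def)
    then show ?thesis by simp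
  qed
qed

text \<open>A deficit in the degree sum is added to a single vertex; for \<open>r \<noteq> 1\<close> this is strictly
  increasing whenever it leads to an extremal sequence.\<close>

lemma min_sum_bound:
  assumes fin: "finite S" and D: "sum d S \<le> q * int (card S) + r" and r: "0 \<le> r" "r \<le> int (card S)"
    and s2: "2 \<le> card S"
  shows "min_sum S d \<le> q * int (card S) * (int (card S) - 1) + r * (r - 1)"
    "min_sum S d = q * int (card S) * (int (card S) - 1) + r * (r - 1) \<Longrightarrow> r \<noteq> 1 \<Longrightarrow>
      sum d S = q * int (card S) + r \<and> (\<forall>x\<in>S. d x = q \<or> d x = q + 1)"
proof -
  have ne: "S \<noteq> {}" using s2 by auto
  then obtain v where v: "v \<in> S" by blast
  define \<delta> where "\<delta> = q * int (card S) + r - sum d S"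
  define d' where "d' = (\<lambda>x. if x = v then d x + \<delta> else d x)"
  have \<delta>: "0 \<le> \<delta>" using D by (simp add: \<delta>_def)
  have "sum d' S = sum d S + (\<Sum>x\<in>S. if x = v then \<delta> else 0)"
    unfolding sum.distrib[symmetric] d'_def by (intro sum.cong) auto
  then have D': "sum d' S = q * int (card S) + r" using fin v by (simp add: \<delta>_def)
  note B = min_sum_bound_exact[OF fin D' r ne]
  let ?m = "\<lambda>d x y. if x = y then 0 else min (d x) (d y)"
  have le: "?m d x y \<le> ?m d' x y" for x y using \<delta> by (auto simp: d'_def min_def)
  have le': "(\<Sum>y\<in>S. ?m d x y) \<le> (\<Sum>y\<in>S. ?m d' x y)" for x by (intro sum_mono le)
  have mono: "min_sum S d \<le> min_sum S d'" unfolding min_sum_def by (intro sum_mono le')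
  show "min_sum S d \<le> q * int (card S) * (int (card S) - 1) + r * (r - 1)"
    using mono B(1) by linarith
  assume tight: "min_sum S d = q * int (card S) * (int (card S) - 1) + r * (r - 1)" and r1: "r \<noteq> 1"
  with mono B(1) have eq: "min_sum S d = min_sum S d'"
    and tight': "min_sum S d' = q * int (card S) * (int (card S) - 1) + r * (r - 1)" by linarith+
  have ext: "d' x = q \<or> d' x = q + 1" if "x \<in> S" for x using B(2)[OF tight' that] .
  \<comment> \<open>Otherwise raising \<open>d v\<close> would have changed no minimum, so
    \<open>d v\<close> was already a largest entry. Then \<open>d' v = q + 1\<close> is the only
    entry above \<open>q\<close>, that is \<open>r = 1\<close>: the case in which
    \<open>r * (r - 1)\<close> does not distinguish \<open>r\<close> from 0.\<close>
  have "\<delta> = 0"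
  proof (rule ccontr)
    assume "\<delta> \<noteq> 0"
    with \<delta> have pos: "0 < \<delta>" by simp
    have "(\<Sum>y\<in>S. ?m d v y) = (\<Sum>y\<in>S. ?m d' v y)"
    proof (rule ccontr)
      assume "(\<Sum>y\<in>S. ?m d v y) \<noteq> (\<Sum>y\<in>S. ?m d' v y)"
      with le'[of v] have "(\<Sum>y\<in>S. ?m d v y) < (\<Sum>y\<in>S. ?m d' v y)" by linarith
      then have "min_sum S d < min_sum S d'"
        unfolding min_sum_def using le' v fin by (intro sum_strict_mono_ex1) blast+
      with eq show False by simp
    qed
    then have "?m d v y = ?m d' v y" if "y \<in> S" for y
      using sum_mono_inv[of "?m d v" S "?m d' v" y] le that fin by blast
    then have small: "d y \<le> d v" if "y \<in> S" "y \<noteq> v" for y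
      using that pos by (fastforce simp: d'_def min_def split: if_splits)
    have "card (S - {v}) \<noteq> 0" using s2 v fin by (simp add: card_Diff_singleton)
    then obtain y where y: "y \<in> S" "y \<noteq> v" by (metis Diff_iff card.empty ex_in_conv insertI1)
    have dv: "d' v = q + 1" using ext[OF v] ext[OF y(1)] small[OF y] pos y by (auto simp: d'_def)
    have dy: "d' y = q" if "y \<in> S" "y \<noteq> v" for y
      using ext[OF that(1)] small[OF that] pos dv that by (auto simp: d'_def)
    have "sum d' S = d' v + sum d' (S - {v})" using fin v by (simp add: sum.remove)
    also have "sum d' (S - {v}) = (\<Sum>y\<in>S - {v}. q)" by (intro sum.cong) (auto simp: dy)
    also have "\<dots> = q * (int (card S) - 1)" using v fin s2 by (simp add: card_Diff_singleton of_nat_diff)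
    finally show False using D' dv r1 by (simp add: algebra_simps)
  qed
  moreover from this have "d' = d" by (auto simp: d'_def)
  ultimately show "sum d S = q * int (card S) + r \<and> (\<forall>x\<in>S. d x = q \<or> d x = q + 1)"
    using ext by (simp add: \<delta>_def)
qed

lemma min_sum_two_values:
  assumes fin: "finite S" and d: "\<And>x. x \<in> S \<Longrightarrow> d x = q \<or> d x = q + 1"
    and D: "sum d S = q * int (card S) + r"
  shows "min_sum S d = q * int (card S) * (int (card S) - 1) + r * (r - 1)"
proof -
  define R where "R = {x \<in> S. d x = q + 1}"
  let ?i = "\<lambda>x. if x \<in> R then 1 else (0::int)"
  have RS: "R \<subseteq> S" and finR: "finite R" using fin by (auto simp: R_def)
  have di: "d x = q + ?i x" if "x \<in> S" for x using d[OF that] that by (auto simp: R_def)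
  have S_i: "(\<Sum>x\<in>S. ?i x) = int (card R)"
    using fin RS by (simp add: sum.If_cases Int_absorb1 inf.absorb2)
  have "sum d S = (\<Sum>x\<in>S. q + ?i x)" by (intro sum.cong di refl)
  then have r: "r = int (card R)" using D S_i by (simp add: sum.distrib)
  \<comment> \<open>For the values \<open>q\<close> and \<open>q + 1\<close> the minimum is
    \<open>q\<close> plus the product of the indicators of the larger value.\<close>
  have "min_sum S d = (\<Sum>x\<in>S. \<Sum>y\<in>S. (q + ?i x * ?i y) - (if x = y then q + ?i x else 0))"
    unfolding min_sum_def by (intro sum.cong refl) (auto simp: di)
  also have "\<dots> = int (card S) * (int (card S) * q) + (\<Sum>x\<in>S. ?i x) * (\<Sum>x\<in>S. ?i x)
      - (int (card S) * q + (\<Sum>x\<in>S. ?i x))"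
    using fin by (simp add: sum_subtractf sum.distrib sum_product flip: sum_distrib_left)
  also have "\<dots> = q * int (card S) * (int (card S) - 1) + r * (r - 1)"
    unfolding S_i r by (simp add: algebra_simps)
  finally show ?thesis .
qed

text \<open>Here \<open>X\<close> is the total excess and \<open>s\<close> the number of branch vertices. The bound \<open>R\<close> comes from
  \<open>min (d x) (d y) \<le> (d x + d y) / 2\<close>; it is sharpened near \<open>s = n / 4\<close> by \<open>Q6\<close> and \<open>Q5\<close>, the values
  for degrees in \<open>{6, 7}\<close> and in \<open>{5, 6}\<close>.\<close>

lemma extremal_0:
  fixes k s X :: int
  assumes k: "8 \<le> k"
    and R: "X \<le> 2 * (s - 1) * (4 * k - 2 * s)"
    and Q5: "0 \<le> 8 * k - 7 * s \<Longrightarrow> 8 * k - 7 * s \<le> s \<Longrightarrow>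
      X \<le> 3 * s * (s - 1) + (8 * k - 7 * s) * (8 * k - 7 * s - 1)"
  shows "X \<le> 4 * k * k - 4 * k" "X = 4 * k * k - 4 * k \<Longrightarrow> s = k"
proof -
  \<comment> \<open>\<open>R\<close> equals the claimed value at both \<open>s = k\<close> and
    \<open>s = k + 1\<close> and is smaller elsewhere. At \<open>s = k + 1\<close> the value
    \<open>Q5\<close> breaks the tie, since it falls below the claim exactly when
    \<open>k > 7\<close>.\<close>
  have "X \<le> 4 * k * k - 4 * k \<and> (X = 4 * k * k - 4 * k \<longrightarrow> s = k)"
  proof (cases "s = k + 1")
    case True
    have "X \<le> 3 * (k + 1) * k + (k - 7) * (k - 8)" using Q5 k unfolding True by simp
    then show ?thesis using k by (simp add: algebra_simps)
  next
    case False
    have e: "4 * k * k - 4 * k - 2 * (s - 1) * (4 * k - 2 * s) = 4 * ((s - k) * (s - k - 1))"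
      by (simp add: algebra_simps)
    have "0 < (s - k) * (s - k - 1)" if "s \<noteq> k"
      using that False by (cases "s < k") (auto intro: mult_neg_neg mult_pos_pos)
    with e R show ?thesis by (cases "s = k") auto
  qed
  then show "X \<le> 4 * k * k - 4 * k" "X = 4 * k * k - 4 * k \<Longrightarrow> s = k" by auto
qed

text \<open>For \<open>s = k - i\<close> with \<open>9 * i + 2 \<le> k\<close> the bound
  \<open>Q6\<close> applies, for \<open>s = k + j\<close> with \<open>7 * j \<le> k + 2\<close> the
  bound \<open>Q5\<close>; further out the parabola \<open>R\<close> has dropped far enough. At
  \<open>i = 3\<close> the factor \<open>4 * k - 34 * i - 14\<close> is \<open>4 * k - 116\<close>,
  and 30 is the least \<open>k\<close> making it positive.\<close>

lemma extremal_1: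
  fixes k s X :: int
  assumes k: "30 \<le> k"
    and R: "X \<le> 2 * (s - 1) * (4 * k + 1 - 2 * s)"
    and Q6: "0 \<le> 8 * k + 2 - 8 * s \<Longrightarrow> 8 * k + 2 - 8 * s \<le> s \<Longrightarrow>
      X \<le> 4 * s * (s - 1) + (8 * k + 2 - 8 * s) * (8 * k + 2 - 8 * s - 1)"
    and Q5: "0 \<le> 8 * k + 2 - 7 * s \<Longrightarrow> 8 * k + 2 - 7 * s \<le> s \<Longrightarrow>
      X \<le> 3 * s * (s - 1) + (8 * k + 2 - 7 * s) * (8 * k + 2 - 7 * s - 1)"
  shows "X \<le> 4 * k * k - 4 * k + 2" "X = 4 * k * k - 4 * k + 2 \<Longrightarrow> s = k"
proof -
  have "X \<le> 4 * k * k - 4 * k + 2 \<and> (X = 4 * k * k - 4 * k + 2 \<longrightarrow> s = k)"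
  proof (cases "s \<le> k")
    case True
    define i where "i = k - s"
    have s: "s = k - i" and i: "0 \<le> i" using True by (auto simp: i_def)
    show ?thesis
    proof (cases "9 * i + 2 \<le> k")
      case le: True
      have "X \<le> 4 * s * (s - 1) + (8 * k + 2 - 8 * s) * (8 * k + 2 - 8 * s - 1)"
        using Q6 le i unfolding s by simp
      also have "\<dots> = 4 * k * k - 4 * k + 2 - 2 * (i * (4 * k - 34 * i - 14))"
        unfolding s by (simp add: algebra_simps)
      finally have X: "X \<le> \<dots>" .
      have "0 < i * (4 * k - 34 * i - 14)" if "i \<noteq> 0"
        using that i le k by (intro mult_pos_pos) auto
      then show ?thesis using X s by (cases "i = 0") auto
    next
      case False
      define m where "m = i * i"
      \<comment> \<open>\<open>i \<ge> 3\<close> follows from \<open>k \<ge> 30\<close>; the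
        multiple 3 is chosen so that \<open>2 * m + 3 * i \<ge> 9 * i\<close>, which meets the
        failed condition \<open>9 * i + 2 \<le> k\<close>.\<close>
      have "3 * i \<le> m" unfolding m_def using False k by (intro mult_right_mono) auto
      then have "0 < 2 * m + 3 * i + 2 - k" using False k by linarith
      moreover have "X \<le> 4 * k * k - 4 * k + 2 - 2 * (2 * m + 3 * i + 2 - k)"
        using R unfolding s m_def by (simp add: algebra_simps)
      ultimately show ?thesis by auto
    qed
  next
    case False
    define j where "j = s - k"
    have s: "s = k + j" and j: "1 \<le> j" using False by (auto simp: j_def)
    show ?thesis
    proof (cases "7 * j \<le> k + 2")
      case le: True
      have "X \<le> 3 * s * (s - 1) + (8 * k + 2 - 7 * s) * (8 * k + 2 - 7 * s - 1)"
        using Q5 le j unfolding s by simp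
      also have "\<dots> = 4 * k * k - 4 * k + 2 - 2 * (4 * (j * k) + 12 * j - 26 * (j * j) - 2 * k)"
        unfolding s by (simp add: algebra_simps)
      finally have X: "X \<le> \<dots>" .
      \<comment> \<open>Estimating \<open>j * j\<close> through \<open>7 * j \<le> k + 2\<close>
        leaves at least \<open>2 * (j * k) / 7\<close>, which covers \<open>2 * k\<close> only from
        \<open>j = 7\<close> on; smaller \<open>j\<close> are checked one by one.\<close>
      have "0 < 4 * (j * k) + 12 * j - 26 * (j * j) - 2 * k"
      proof (cases "j \<le> 6")
        case True
        then have "j = 1 \<or> j = 2 \<or> j = 3 \<or> j = 4 \<or> j = 5 \<or> j = 6" using j by auto
        then show ?thesis using k le by auto
      next
        case False
        have "j * (7 * j) \<le> j * (k + 2)" using False le by (intro mult_left_mono) auto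
        then have "7 * (j * j) \<le> j * k + 2 * j" by (simp add: algebra_simps)
        moreover have "7 * k \<le> j * k" using False k by (intro mult_right_mono) auto
        ultimately show ?thesis using False by linarith
      qed
      then show ?thesis using X by auto
    next
      case nle: False
      define m where "m = j * j"
      have "5 * j \<le> m" unfolding m_def using nle k by (intro mult_right_mono) auto
      then have "0 < 2 * m - 3 * j + 2 - k" using nle k by linarith
      moreover have "X \<le> 4 * k * k - 4 * k + 2 - 2 * (2 * m - 3 * j + 2 - k)"
        using R unfolding s m_def by (simp add: algebra_simps)
      ultimately show ?thesis by auto
    qed
  qed
  then show "X \<le> 4 * k * k - 4 * k + 2" "X = 4 * k * k - 4 * k + 2 \<Longrightarrow> s = k" by auto
qed

text \<open>\<open>Q6\<close> at \<open>s = k\<close> and \<open>Q5\<close> at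
  \<open>s = k + 1\<close> have the same value, hence two extremal families. For
  \<open>k = 67\<close> and \<open>i = 7\<close> the factor \<open>4 * k - 34 * i - 30\<close>
  vanishes within the range of \<open>Q6\<close>; this tie explains the threshold 68.\<close>

lemma extremal_2:
  fixes k s X :: int
  assumes k: "68 \<le> k"
    and R: "X \<le> 2 * (s - 1) * (4 * k + 2 - 2 * s)"
    and Q6: "0 \<le> 8 * k + 4 - 8 * s \<Longrightarrow> 8 * k + 4 - 8 * s \<le> s \<Longrightarrow>
      X \<le> 4 * s * (s - 1) + (8 * k + 4 - 8 * s) * (8 * k + 4 - 8 * s - 1)"
    and Q5: "0 \<le> 8 * k + 4 - 7 * s \<Longrightarrow> 8 * k + 4 - 7 * s \<le> s \<Longrightarrow>
      X \<le> 3 * s * (s - 1) + (8 * k + 4 - 7 * s) * (8 * k + 4 - 7 * s - 1)"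
  shows "X \<le> 4 * k * k - 4 * k + 12" "X = 4 * k * k - 4 * k + 12 \<Longrightarrow> s = k \<or> s = k + 1"
proof -
  have "X \<le> 4 * k * k - 4 * k + 12 \<and> (X = 4 * k * k - 4 * k + 12 \<longrightarrow> s = k \<or> s = k + 1)"
  proof (cases "s \<le> k")
    case True
    define i where "i = k - s"
    have s: "s = k - i" and i: "0 \<le> i" using True by (auto simp: i_def)
    show ?thesis
    proof (cases "9 * i + 4 \<le> k")
      case le: True
      have "X \<le> 4 * s * (s - 1) + (8 * k + 4 - 8 * s) * (8 * k + 4 - 8 * s - 1)"
        using Q6 le i unfolding s by simp
      also have "\<dots> = 4 * k * k - 4 * k + 12 - 2 * (i * (4 * k - 34 * i - 30))"
        unfolding s by (simp add: algebra_simps)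
      finally have X: "X \<le> \<dots>" .
      have "0 < i * (4 * k - 34 * i - 30)" if "i \<noteq> 0"
        using that i le k by (intro mult_pos_pos) auto
      then show ?thesis using X s by (cases "i = 0") auto
    next
      case False
      define m where "m = i * i"
      have "7 * i \<le> m" unfolding m_def using False k by (intro mult_right_mono) auto
      then have "0 < 2 * m + 4 * i + 8 - 2 * k" using False k by linarith
      moreover have "X \<le> 4 * k * k - 4 * k + 12 - 2 * (2 * m + 4 * i + 8 - 2 * k)"
        using R unfolding s m_def by (simp add: algebra_simps)
      ultimately show ?thesis by auto
    qed
  next
    case False
    define j where "j = s - k"
    have s: "s = k + j" and j: "1 \<le> j" using False by (auto simp: j_def)
    show ?thesis
    proof (cases "7 * j \<le> k + 4")
      case le: True
      have "X \<le> 3 * s * (s - 1) + (8 * k + 4 - 7 * s) * (8 * k + 4 - 7 * s - 1)"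
        using Q5 le j unfolding s by simp
      also have "\<dots> = 4 * k * k - 4 * k + 12 - 2 * ((j - 1) * (4 * k - 26 * j))"
        unfolding s by (simp add: algebra_simps)
      finally have X: "X \<le> \<dots>" .
      have "0 < (j - 1) * (4 * k - 26 * j)" if "j \<noteq> 1"
        using that j le k by (intro mult_pos_pos) auto
      then show ?thesis using X s by (cases "j = 1") auto
    next
      case nle: False
      define m where "m = j * j"
      have "9 * j \<le> m" unfolding m_def using nle k by (intro mult_right_mono) auto
      then have "0 < 2 * m - 4 * j + 8 - 2 * k" using nle k by linarith
      moreover have "X \<le> 4 * k * k - 4 * k + 12 - 2 * (2 * m - 4 * j + 8 - 2 * k)"
        using R unfolding s m_def by (simp add: algebra_simps)
      ultimately show ?thesis by auto
    qed
  qed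
  then show "X \<le> 4 * k * k - 4 * k + 12" "X = 4 * k * k - 4 * k + 12 \<Longrightarrow> s = k \<or> s = k + 1" by auto
qed

text \<open>As a function of \<open>s\<close>, \<open>R\<close> peaks at \<open>k + 5 / 4\<close>,
  which favours \<open>s = k + 1\<close>. The threshold comes from the right:
  \<open>4 * k + 14 - 26 * j\<close> vanishes at \<open>k = 29\<close>, \<open>j = 5\<close>, still
  within the range of \<open>Q5\<close>.\<close>

lemma extremal_3:
  fixes k s X :: int
  assumes k: "30 \<le> k"
    and R: "X \<le> 2 * (s - 1) * (4 * k + 3 - 2 * s)"
    and Q6: "0 \<le> 8 * k + 6 - 8 * s \<Longrightarrow> 8 * k + 6 - 8 * s \<le> s \<Longrightarrow>
      X \<le> 4 * s * (s - 1) + (8 * k + 6 - 8 * s) * (8 * k + 6 - 8 * s - 1)"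
    and Q5: "0 \<le> 8 * k + 6 - 7 * s \<Longrightarrow> 8 * k + 6 - 7 * s \<le> s \<Longrightarrow>
      X \<le> 3 * s * (s - 1) + (8 * k + 6 - 7 * s) * (8 * k + 6 - 7 * s - 1)"
  shows "X \<le> 4 * k * k + 2" "X = 4 * k * k + 2 \<Longrightarrow> s = k + 1"
proof -
  have "X \<le> 4 * k * k + 2 \<and> (X = 4 * k * k + 2 \<longrightarrow> s = k + 1)"
  proof (cases "s \<le> k")
    case True
    define i where "i = k - s"
    have s: "s = k - i" and i: "0 \<le> i" using True by (auto simp: i_def)
    show ?thesis
    proof (cases "9 * i + 6 \<le> k")
      case le: True
      have "X \<le> 4 * s * (s - 1) + (8 * k + 6 - 8 * s) * (8 * k + 6 - 8 * s - 1)"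
        using Q6 le i unfolding s by simp
      also have "\<dots> = 4 * k * k + 2 - 2 * (4 * (i * k) + 2 * k - 34 * (i * i) - 46 * i - 14)"
        unfolding s by (simp add: algebra_simps)
      finally have X: "X \<le> \<dots>" .
      have "0 < 4 * (i * k) + 2 * k - 34 * (i * i) - 46 * i - 14"
      proof (cases "i \<le> 2")
        case True
        then have "i = 0 \<or> i = 1 \<or> i = 2" using i by auto
        then show ?thesis using k le by auto
      next
        case False
        \<comment> \<open>The factor \<open>4 * i + 2\<close> is chosen so that the slack of
          \<open>9 * i + 6 \<le> k\<close> absorbs all terms containing \<open>k\<close>.\<close>
        have "0 \<le> (4 * i + 2) * (k - 9 * i - 6)" using False le by (intro mult_nonneg_nonneg) auto
        then have "36 * (i * i) + 42 * i + 12 \<le> 4 * (i * k) + 2 * k" by (simp add: algebra_simps)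
        moreover have "3 * i \<le> i * i" using False by (intro mult_right_mono) auto
        ultimately show ?thesis using False by linarith
      qed
      then show ?thesis using X by auto
    next
      case False
      define m where "m = i * i"
      have "3 * i \<le> m" unfolding m_def using False k by (intro mult_right_mono) auto
      then have "0 < 2 * m + 5 * i + 4 - k" using False k by linarith
      moreover have "X \<le> 4 * k * k + 2 - 2 * (2 * m + 5 * i + 4 - k)"
        using R unfolding s m_def by (simp add: algebra_simps)
      ultimately show ?thesis by auto
    qed
  next
    case False
    define j where "j = s - k"
    have s: "s = k + j" and j: "1 \<le> j" using False by (auto simp: j_def)
    show ?thesis
    proof (cases "7 * j \<le> k + 6")
      case le: True
      have "X \<le> 3 * s * (s - 1) + (8 * k + 6 - 7 * s) * (8 * k + 6 - 7 * s - 1)"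
        using Q5 le j unfolding s by simp
      also have "\<dots> = 4 * k * k + 2 - 2 * ((j - 1) * (4 * k + 14 - 26 * j))"
        unfolding s by (simp add: algebra_simps)
      finally have X: "X \<le> \<dots>" .
      have "0 < (j - 1) * (4 * k + 14 - 26 * j)" if "j \<noteq> 1"
        using that j le k by (intro mult_pos_pos) auto
      then show ?thesis using X s by (cases "j = 1") auto
    next
      case nle: False
      define m where "m = j * j"
      have "6 * j \<le> m" unfolding m_def using nle k by (intro mult_right_mono) auto
      then have "0 < 2 * m - 5 * j + 4 - k" using nle k by linarith
      moreover have "X \<le> 4 * k * k + 2 - 2 * (2 * m - 5 * j + 4 - k)"
        using R unfolding s m_def by (simp add: algebra_simps)
      ultimately show ?thesis by auto
    qed
  qed
  then show "X \<le> 4 * k * k + 2" "X = 4 * k * k + 2 \<Longrightarrow> s = k + 1" by auto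
qed

section \<open>Isomorphism and subdivision\<close>

text \<open>\<open>mgraph_iso\<close> with its two bijections exposed, so that individual vertices
  can be followed.\<close>

definition iso_maps ::
    "('v, 'e) mgraph \<Rightarrow> ('w, 'f) mgraph \<Rightarrow> ('v \<Rightarrow> 'w) \<Rightarrow> ('e \<Rightarrow> 'f) \<Rightarrow> bool" where
  "iso_maps G K f g \<longleftrightarrow> bij_betw f (verts G) (verts K) \<and> bij_betw g (edges G) (edges K) \<and>
     (\<forall>e\<in>edges G. ends K (g e) = f ` ends G e)"

lemma iso_maps_inverse:
  assumes G: "multigraph G" and iso: "iso_maps G K f g"
  shows "iso_maps K G (inv_into (verts G) f) (inv_into (edges G) g)"
proof -
  let ?f = "inv_into (verts G) f" and ?g = "inv_into (edges G) g"
  have b: "bij_betw f (verts G) (verts K)" "bij_betw g (edges G) (edges K)"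
    and e: "\<And>e. e \<in> edges G \<Longrightarrow> ends K (g e) = f ` ends G e"
    using iso by (auto simp: iso_maps_def)
  have "ends G (?g k) = ?f ` ends K k" if k: "k \<in> edges K" for k
  proof -
    obtain h where h: "h \<in> edges G" "k = g h" using b(2) k by (auto simp: bij_betw_def)
    have "ends G h \<subseteq> verts G" using G h by (simp add: multigraph_def)
    then have "?f ` f ` ends G h = ends G h" using b(1) by (simp add: bij_betw_def inv_into_image_cancel)
    moreover have "?g k = h" using b(2) h by (simp add: bij_betw_def)
    ultimately show ?thesis using e[OF h(1)] h(2) by simp
  qed
  with b show ?thesis by (simp add: iso_maps_def bij_betw_inv_into)
qed

lemma iso_local_connectivity_le:
  assumes G: "multigraph G" and K: "multigraph K" and iso: "iso_maps G K f g"
    and xy: "x \<in> verts G" "y \<in> verts G" "x \<noteq> y"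
  shows "local_connectivity G x y \<le> local_connectivity K (f x) (f y)"
proof -
  have inj: "inj_on f (verts G)" "inj_on g (edges G)"
    and im: "f ` verts G = verts K" "g ` edges G = edges K"
    and e: "\<And>e. e \<in> edges G \<Longrightarrow> ends K (g e) = f ` ends G e"
    using iso by (auto simp: iso_maps_def bij_betw_def)
  obtain \<F> where \<F>: "route_system G x y \<F>" "card \<F> = local_connectivity G x y"
    using local_connectivity_attained[OF G xy(3,1)] by metis
  have span: "\<Union> (ends K ` g ` F) = f ` \<Union> (ends G ` F)" if "F \<subseteq> edges G" for F
    using e that by (auto simp: subset_iff)
  have spV: "\<Union> (ends G ` F) \<subseteq> verts G" if "F \<subseteq> edges G" for F
    using that G by (auto simp: multigraph_def)
  have "card \<F> \<le> local_connectivity K (f x) (f y)"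
  proof (rule le_local_connectivity_image[where h = "\<lambda>F. g ` F"])
    fix F assume F: "F \<in> \<F>"
    note FE = route_systemD(1)[OF \<F>(1) F]
    show "g ` F \<subseteq> edges K" using FE im by blast
    show "joins K (g ` F) (f x) (f y)"
      using route_systemD(2)[OF \<F>(1) F]
    proof (rule joins_morphism)
      fix h p q assume h: "h \<in> F" "ends G h = {p, q}"
      then have "ends K (g h) = {f p, f q}" using e[of h] FE by auto
      then show "joins K (g ` F) (f p) (f q)" using h by (intro joins_edge[of "g h"]) auto
    qed
  next
    fix F F' assume FF: "F \<in> \<F>" "F' \<in> \<F>" "F \<noteq> F'"
    note FE = route_systemD(1)[OF \<F>(1) FF(1)] route_systemD(1)[OF \<F>(1) FF(2)]
    have "g ` F \<inter> g ` F' = g ` (F \<inter> F')" using inj(2) FE by (simp add: inj_on_image_Int)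
    then show "g ` F \<inter> g ` F' = {}" using route_systemD(3)[OF \<F>(1) FF] by simp
    have "f ` \<Union> (ends G ` F) \<inter> f ` \<Union> (ends G ` F') = f ` (\<Union> (ends G ` F) \<inter> \<Union> (ends G ` F'))"
      using inj_on_image_Int[OF inj(1) spV[OF FE(1)] spV[OF FE(2)]] by simp
    also have "\<dots> \<subseteq> f ` {x, y}" by (rule image_mono[OF route_systemD(4)[OF \<F>(1) FF]])
    finally show "\<Union> (ends K ` g ` F) \<inter> \<Union> (ends K ` g ` F') \<subseteq> {f x, f y}"
      unfolding span[OF FE(1)] span[OF FE(2)] by simp
  next
    show "f x \<noteq> f y" using inj(1) xy by (simp add: inj_on_eq_iff)
    show "f x \<in> verts K" using im xy by blast
  qed (fact K)
  with \<F>(2) show ?thesis by simp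
qed

lemma iso_local_connectivity:
  assumes G: "multigraph G" and K: "multigraph K" and iso: "iso_maps G K f g"
    and xy: "x \<in> verts G" "y \<in> verts G" "x \<noteq> y"
  shows "local_connectivity K (f x) (f y) = local_connectivity G x y"
proof (rule antisym)
  have b: "bij_betw f (verts G) (verts K)" using iso by (simp add: iso_maps_def)
  then have "f x \<in> verts K" "f y \<in> verts K" "f x \<noteq> f y"
    "inv_into (verts G) f (f x) = x" "inv_into (verts G) f (f y) = y"
    using xy by (auto simp: bij_betw_def inj_on_eq_iff)
  with iso_local_connectivity_le[OF K G iso_maps_inverse[OF G iso], of "f x" "f y"]
  show "local_connectivity K (f x) (f y) \<le> local_connectivity G x y" by simp
qed (rule iso_local_connectivity_le[OF assms])

lemma iso_vdegree:
  assumes G: "multigraph G" and iso: "iso_maps G K f g" and x: "x \<in> verts G"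
  shows "vdegree K (f x) = vdegree G x"
proof -
  have inj: "inj_on f (verts G)" "inj_on g (edges G)"
    and im: "g ` edges G = edges K"
    and e: "\<And>e. e \<in> edges G \<Longrightarrow> ends K (g e) = f ` ends G e"
    using iso by (auto simp: iso_maps_def bij_betw_def)
  have "f x \<in> f ` ends G h \<longleftrightarrow> x \<in> ends G h" if "h \<in> edges G" for h
    using G that x inj(1) by (intro inj_on_image_mem_iff) (auto simp: multigraph_def)
  then have "{k \<in> edges K. f x \<in> ends K k} = g ` {h \<in> edges G. x \<in> ends G h}"
    unfolding im[symmetric] using e by auto
  moreover have "inj_on g {h \<in> edges G. x \<in> ends G h}" using inj(2) by (rule inj_on_subset) auto
  ultimately show ?thesis by (simp add: vdegree_def card_image)
qed

section \<open>Subdividing every edge\<close>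

lemma subdivide_simps [simp]:
  "verts (subdivide H) = Inl ` verts H \<union> Inr ` edges H"
  "edges (subdivide H) = {(e, v). e \<in> edges H \<and> v \<in> ends H e}"
  "ends (subdivide H) (e, v) = {Inl v, Inr e}"
  by (simp_all add: subdivide_def)

lemma subdivide_multigraph:
  assumes "multigraph H"
  shows "multigraph (subdivide H)"
proof -
  have fin: "finite (verts H)" "finite (edges H)" "\<And>e. e \<in> edges H \<Longrightarrow> ends H e \<subseteq> verts H"
    using assms by (auto simp: multigraph_def)
  have "{(e, v). e \<in> edges H \<and> v \<in> ends H e} \<subseteq> edges H \<times> verts H" using fin(3) by auto
  then have "finite {(e, v). e \<in> edges H \<and> v \<in> ends H e}" by (rule finite_subset) (simp add: fin)
  then show ?thesis using fin by (auto simp: multigraph_def)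
qed

lemma subdivide_vdegree_old:
  "vdegree (subdivide H) (Inl v) = vdegree H v"
proof -
  have "{k \<in> edges (subdivide H). Inl v \<in> ends (subdivide H) k} = (\<lambda>e. (e, v)) ` {e \<in> edges H. v \<in> ends H e}"
    by auto
  then show ?thesis by (simp add: vdegree_def card_image inj_on_def)
qed

lemma subdivide_vdegree_new:
  assumes "multigraph H" "e \<in> edges H"
  shows "vdegree (subdivide H) (Inr e) = 2"
proof -
  have "{k \<in> edges (subdivide H). Inr e \<in> ends (subdivide H) k} = Pair e ` ends H e"
    using assms(2) by auto
  then show ?thesis using assms by (simp add: vdegree_def card_image inj_on_def multigraph_def)
qed

text \<open>Each edge of a route is replaced by its two halves; a new vertex lies on one route only
  because routes share no edges.\<close>

lemma subdivide_local_connectivity_ge: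
  assumes H: "multigraph H" and uv: "u \<in> verts H" "v \<in> verts H" "u \<noteq> v"
  shows "local_connectivity H u v \<le> local_connectivity (subdivide H) (Inl u) (Inl v)"
proof -
  let ?K = "subdivide H"
  obtain \<F> where \<F>: "route_system H u v \<F>" "card \<F> = local_connectivity H u v"
    using local_connectivity_attained[OF H uv(3,1)] by metis
  have span: "\<Union> (ends ?K ` Sigma F (ends H)) \<subseteq> Inl ` \<Union> (ends H ` F) \<union> Inr ` F" for F
  proof
    fix z assume "z \<in> \<Union> (ends ?K ` Sigma F (ends H))"
    then obtain e w where ew: "e \<in> F" "w \<in> ends H e" "z = Inl w \<or> z = Inr e" by auto
    then have "w \<in> \<Union> (ends H ` F)" by blast
    with ew show "z \<in> Inl ` \<Union> (ends H ` F) \<union> Inr ` F" by blast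
  qed
  have "card \<F> \<le> local_connectivity ?K (Inl u) (Inl v)"
  proof (rule le_local_connectivity_image[where h = "\<lambda>F. Sigma F (ends H)"])
    fix F assume F: "F \<in> \<F>"
    show "Sigma F (ends H) \<subseteq> edges ?K" using route_systemD(1)[OF \<F>(1) F] by auto
    show "joins ?K (Sigma F (ends H)) (Inl u) (Inl v)"
      using route_systemD(2)[OF \<F>(1) F]
    proof (rule joins_morphism)
      fix e p q assume e: "e \<in> F" "ends H e = {p, q}"
      have "joins ?K (Sigma F (ends H)) (Inl p) (Inr e)"
        using e by (intro joins_edge[of "(e, p)"]) auto
      moreover have "joins ?K (Sigma F (ends H)) (Inr e) (Inl q)"
        using e by (intro joins_edge[of "(e, q)"]) auto
      ultimately show "joins ?K (Sigma F (ends H)) (Inl p) (Inl q)" by (rule joins_trans)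
    qed
  next
    fix F F' assume FF: "F \<in> \<F>" "F' \<in> \<F>" "F \<noteq> F'"
    have dis: "F \<inter> F' = {}" by (rule route_systemD(3)[OF \<F>(1) FF])
    then show "Sigma F (ends H) \<inter> Sigma F' (ends H) = {}" by blast
    have "(Inl ` \<Union> (ends H ` F) \<union> Inr ` F) \<inter> (Inl ` \<Union> (ends H ` F') \<union> Inr ` F') \<subseteq> {Inl u, Inl v}"
      using route_systemD(4)[OF \<F>(1) FF] dis by auto
    from subset_trans[OF Int_mono[OF span span] this]
    show "\<Union> (ends ?K ` Sigma F (ends H)) \<inter> \<Union> (ends ?K ` Sigma F' (ends H)) \<subseteq> {Inl u, Inl v}" .
  qed (use uv subdivide_multigraph[OF H] in auto)
  with \<F>(2) show ?thesis by simp
qed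

text \<open>A new vertex of which only one half-edge is used is mapped back to the end of that half-edge.\<close>

lemma subdivide_local_connectivity_le:
  assumes H: "multigraph H" and uv: "u \<in> verts H" "v \<in> verts H" "u \<noteq> v"
  shows "local_connectivity (subdivide H) (Inl u) (Inl v) \<le> local_connectivity H u v"
proof -
  let ?K = "subdivide H"
  note K = subdivide_multigraph[OF H]
  obtain \<F> where \<F>: "route_system ?K (Inl u) (Inl v) \<F>" "card \<F> = local_connectivity ?K (Inl u) (Inl v)"
    using local_connectivity_attained[OF K, of "Inl u" "Inl v"] uv by auto
  define \<phi> where "\<phi> F = {e \<in> edges H. \<forall>w\<in>ends H e. (e, w) \<in> F}" for F :: "('b \<times> 'a) set"
  have "card \<F> \<le> local_connectivity H u v"
  proof (rule le_local_connectivity_image[where h = \<phi>])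
    fix F assume F: "F \<in> \<F>"
    note FE = route_systemD(1)[OF \<F>(1) F]
    show "\<phi> F \<subseteq> edges H" by (auto simp: \<phi>_def)
    \<comment> \<open>If both halves of \<open>e\<close> lie in the route, either choice will do,
      because \<open>e\<close> then belongs to \<open>\<phi> F\<close>.\<close>
    define r where "r z = (case z of Inl w \<Rightarrow> w | Inr e \<Rightarrow> (SOME w. (e, w) \<in> F))" for z :: "'a + 'b"
    have half: "joins H (\<phi> F) w (r (Inr e))" if "(e, w) \<in> F" for e w
    proof -
      have r: "(e, r (Inr e)) \<in> F" unfolding r_def using that by (auto intro: someI)
      have e: "e \<in> edges H" "w \<in> ends H e" "r (Inr e) \<in> ends H e" using that r FE by auto
      show ?thesis
      proof (cases "w = r (Inr e)")
        case False
        obtain p q where "ends H e = {p, q}" by (rule multigraph_ends[OF H e(1)])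
        with False e(2,3) have "ends H e = {w, r (Inr e)}" by auto
        then show ?thesis using that r e by (intro joins_edge[of e]) (auto simp: \<phi>_def)
      qed simp
    qed
    have "joins H (\<phi> F) (r (Inl u)) (r (Inl v))"
      using route_systemD(2)[OF \<F>(1) F]
    proof (rule joins_morphism)
      fix k p q assume k: "k \<in> F" "ends ?K k = {p, q}"
      obtain e w where ew: "k = (e, w)" by (cases k)
      then have "p = Inl w \<and> q = Inr e \<or> p = Inr e \<and> q = Inl w"
        using k(2) by (auto simp: doubleton_eq_iff)
      moreover have "joins H (\<phi> F) (r (Inl w)) (r (Inr e))"
        using half[of e w] k(1) ew by (simp add: r_def)
      ultimately show "joins H (\<phi> F) (r p) (r q)" using joins_sym by metis
    qed
    then show "joins H (\<phi> F) u v" by (simp add: r_def)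
  next
    fix F F' assume FF: "F \<in> \<F>" "F' \<in> \<F>" "F \<noteq> F'"
    have dis: "F \<inter> F' = {}" by (rule route_systemD(3)[OF \<F>(1) FF])
    show "\<phi> F \<inter> \<phi> F' = {}"
    proof (rule ccontr)
      assume "\<phi> F \<inter> \<phi> F' \<noteq> {}"
      then obtain e where e: "e \<in> edges H" "\<forall>w\<in>ends H e. (e, w) \<in> F" "\<forall>w\<in>ends H e. (e, w) \<in> F'"
        by (auto simp: \<phi>_def)
      obtain p q where "ends H e = {p, q}" by (rule multigraph_ends[OF H e(1)])
      then have "(e, p) \<in> F \<inter> F'" using e by auto
      with dis show False by simp
    qed
    show "\<Union> (ends H ` \<phi> F) \<inter> \<Union> (ends H ` \<phi> F') \<subseteq> {u, v}"
    proof
      fix z assume z: "z \<in> \<Union> (ends H ` \<phi> F) \<inter> \<Union> (ends H ` \<phi> F')"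
      have "Inl z \<in> \<Union> (ends ?K ` F)" if zF: "z \<in> \<Union> (ends H ` \<phi> F)" for F
      proof -
        obtain e where "(e, z) \<in> F" using zF by (auto simp: \<phi>_def)
        then show ?thesis by (intro UN_I[of "(e, z)"]) auto
      qed
      with z have "Inl z \<in> \<Union> (ends ?K ` F) \<inter> \<Union> (ends ?K ` F')" by blast
      from subsetD[OF route_systemD(4)[OF \<F>(1) FF] this] show "z \<in> {u, v}" by simp
    qed
  qed (use uv H in auto)
  with \<F>(2) show ?thesis by simp
qed

lemma subdivide_local_connectivity:
  assumes "multigraph H" "u \<in> verts H" "v \<in> verts H" "u \<noteq> v"
  shows "local_connectivity (subdivide H) (Inl u) (Inl v) = local_connectivity H u v"
  using subdivide_local_connectivity_le[OF assms] subdivide_local_connectivity_ge[OF assms] by simp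

section \<open>Degree sums and recovery of the subdivided graph\<close>

lemma handshake:
  assumes "finite (edges G)" "finite X"
  shows "(\<Sum>x\<in>X. vdegree G x) = (\<Sum>e\<in>edges G. card (ends G e \<inter> X))"
proof -
  have "vdegree G x = (\<Sum>e\<in>edges G. if x \<in> ends G e then 1 else 0)" for x
    using assms(1) by (simp add: vdegree_def sum.If_cases Int_def)
  then have "(\<Sum>x\<in>X. vdegree G x) = (\<Sum>e\<in>edges G. \<Sum>x\<in>X. if x \<in> ends G e then 1 else 0)"
    by (simp add: sum.swap[of _ X])
  also have "\<dots> = (\<Sum>e\<in>edges G. card (ends G e \<inter> X))"
    using assms(2) by (intro sum.cong) (simp_all add: sum.If_cases Int_def conj_commute)
  finally show ?thesis .
qed

lemma degree_sum:
  assumes "multigraph G"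
  shows "(\<Sum>x\<in>verts G. vdegree G x) = 2 * card (edges G)"
proof -
  have "(\<Sum>e\<in>edges G. card (ends G e \<inter> verts G)) = (\<Sum>e\<in>edges G. 2)"
    using assms by (intro sum.cong) (auto simp: multigraph_def Int_absorb2)
  then show ?thesis using handshake[of G "verts G"] assms by (simp add: multigraph_def)
qed

text \<open>Each edge has at least as many ends outside \<open>S\<close> as inside. Double counting
  compares the degree sum over \<open>S\<close> with that over the complement, where all degrees are
  at most 2.\<close>

lemma reduced_degree_sum:
  assumes G: "multigraph G" and red: "\<And>h. h \<in> edges G \<Longrightarrow> \<not> ends G h \<subseteq> branch_verts G"
  defines "S \<equiv> branch_verts G"
  shows "(\<Sum>x\<in>S. vdegree G x) \<le> 2 * card (verts G - S)"
    "(\<Sum>x\<in>S. vdegree G x) = 2 * card (verts G - S) \<Longrightarrow>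
      (\<forall>h\<in>edges G. card (ends G h \<inter> S) = 1) \<and> (\<forall>t\<in>verts G - S. vdegree G t = 2)"
proof -
  let ?T = "verts G - S"
  have fin: "finite (edges G)" "finite (verts G)" and SV: "S \<subseteq> verts G"
    using G by (auto simp: multigraph_def S_def branch_verts_def)
  have finS: "finite S" and finT: "finite ?T" using SV fin finite_subset by auto
  have le: "card (ends G h \<inter> S) \<le> card (ends G h \<inter> ?T)"
    and eq: "card (ends G h \<inter> S) = card (ends G h \<inter> ?T) \<Longrightarrow> card (ends G h \<inter> S) = 1"
    if h: "h \<in> edges G" for h
  proof -
    have e: "ends G h \<subseteq> verts G" "card (ends G h) = 2" using G h by (auto simp: multigraph_def)
    then have fe: "finite (ends G h)" by (metis card.infinite zero_neq_numeral)
    have "ends G h = (ends G h \<inter> S) \<union> (ends G h \<inter> ?T)" using e by blast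
    then have c: "card (ends G h \<inter> S) + card (ends G h \<inter> ?T) = 2"
      using card_Un_disjoint[of "ends G h \<inter> S" "ends G h \<inter> ?T"] fe e(2) by auto
    have "ends G h \<inter> S \<subset> ends G h" using red[OF h] by (auto simp: S_def)
    then have "card (ends G h \<inter> S) < 2" using psubset_card_mono[OF fe] e(2) by metis
    with c show "card (ends G h \<inter> S) \<le> card (ends G h \<inter> ?T)"
      "card (ends G h \<inter> S) = card (ends G h \<inter> ?T) \<Longrightarrow> card (ends G h \<inter> S) = 1" by linarith+
  qed
  have dT: "vdegree G t \<le> 2" if "t \<in> ?T" for t using that by (auto simp: S_def branch_verts_def)
  have 1: "(\<Sum>x\<in>S. vdegree G x) \<le> (\<Sum>t\<in>?T. vdegree G t)"
    unfolding handshake[OF fin(1) finS] handshake[OF fin(1) finT] by (intro sum_mono le)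
  have 2: "(\<Sum>t\<in>?T. vdegree G t) \<le> (\<Sum>t\<in>?T. 2)" by (intro sum_mono dT)
  have 3: "(\<Sum>t\<in>?T. 2) = 2 * card ?T" by simp
  show "(\<Sum>x\<in>S. vdegree G x) \<le> 2 * card ?T" using 1 2 3 by linarith
  assume "(\<Sum>x\<in>S. vdegree G x) = 2 * card ?T"
  with 1 2 3 have e1: "(\<Sum>e\<in>edges G. card (ends G e \<inter> S)) = (\<Sum>e\<in>edges G. card (ends G e \<inter> ?T))"
    and e2: "(\<Sum>t\<in>?T. vdegree G t) = (\<Sum>t\<in>?T. 2)"
    using handshake[OF fin(1) finS] handshake[OF fin(1) finT] by linarith+
  have "card (ends G h \<inter> S) = 1" if "h \<in> edges G" for h
    using sum_mono_inv[OF e1 le that fin(1)] eq[OF that] by blast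
  moreover have "vdegree G t = 2" if "t \<in> ?T" for t
    using sum_mono_inv[OF e2 dT that finT] .
  ultimately show "(\<forall>h\<in>edges G. card (ends G h \<inter> S) = 1) \<and> (\<forall>t\<in>?T. vdegree G t = 2)" by blast
qed

lemma min_sum_shift:
  assumes "finite S"
  shows "(\<Sum>x\<in>S. \<Sum>y\<in>S. if x = y then 0 else min (d x) (d y) - 2) =
    min_sum S d - 2 * int (card S) * (int (card S) - 1)"
proof -
  have "(\<Sum>x\<in>S. \<Sum>y\<in>S. if x = y then 0 else min (d x) (d y) - 2) =
      (\<Sum>x\<in>S. \<Sum>y\<in>S. (if x = y then 0 else min (d x) (d y)) - (2 - (if x = y then 2 else 0)))"
    by (intro sum.cong) auto
  also have "\<dots> = min_sum S d - (int (card S) * (2 * int (card S)) - 2 * int (card S))"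
    unfolding min_sum_def using assms by (simp add: sum_subtractf sum.distrib algebra_simps)
  finally show ?thesis by (simp add: algebra_simps)
qed

text \<open>\<open>W\<close> may be larger than the set of branch vertices: for a subdivision it
  consists of all old vertices, possibly including some of degree 2.\<close>

lemma total_excess_restrict:
  assumes G: "multigraph G" and W: "W \<subseteq> verts G" "\<And>x. x \<in> verts G - W \<Longrightarrow> vdegree G x \<le> 2"
  shows "total_excess G = (\<Sum>x\<in>W. \<Sum>y\<in>W. excess G x y)"
proof -
  have fin: "finite (verts G)" using G by (simp add: multigraph_def)
  have z: "excess G x y = 0" if "x \<in> verts G - W" "y \<in> verts G" for x y
    using local_connectivity_le_degree[OF G, of x y] W(2)[OF that(1)] that by (auto simp: excess_def)
  have z': "excess G x y = 0" if "x \<in> verts G" "y \<in> verts G - W" for x y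
    using z[OF that(2,1)] by (simp add: excess_commute)
  have "(\<Sum>y\<in>verts G. excess G x y) = (\<Sum>y\<in>W. excess G x y)" if x: "x \<in> verts G" for x
    by (rule sum.mono_neutral_right[OF fin W(1)]) (intro ballI z'[OF x])
  then have "total_excess G = (\<Sum>x\<in>verts G. \<Sum>y\<in>W. excess G x y)"
    unfolding total_excess_def by (rule sum.cong[OF refl])
  also have "\<dots> = (\<Sum>x\<in>W. \<Sum>y\<in>W. excess G x y)"
  proof (rule sum.mono_neutral_right[OF fin W(1)], rule ballI)
    fix x assume x: "x \<in> verts G - W"
    show "(\<Sum>y\<in>W. excess G x y) = 0"
      by (rule sum.neutral) (intro ballI z[OF x], use W(1) in blast)
  qed
  finally show ?thesis .
qed

text \<open>The bound holds term by term, so equality of the sums forces equality for every pair.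
  This is how ideal connectivity enters.\<close>

lemma total_excess_min_sum:
  assumes G: "multigraph G"
  defines "S \<equiv> branch_verts G" and "d \<equiv> \<lambda>x. int (vdegree G x)"
  shows "int (total_excess G) \<le> min_sum S d - 2 * int (card S) * (int (card S) - 1)"
    "int (total_excess G) = min_sum S d - 2 * int (card S) * (int (card S) - 1) \<Longrightarrow>
      x \<in> S \<Longrightarrow> y \<in> S \<Longrightarrow> x \<noteq> y \<Longrightarrow> local_connectivity G x y = min (vdegree G x) (vdegree G y)"
proof -
  have SV: "S \<subseteq> verts G" by (auto simp: S_def branch_verts_def)
  have finS: "finite S" using SV G by (auto simp: multigraph_def intro: finite_subset)
  have tot: "int (total_excess G) = (\<Sum>x\<in>S. \<Sum>y\<in>S. int (excess G x y))"
    by (subst total_excess_restrict[OF G SV]) (auto simp: S_def branch_verts_def)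
  let ?m = "\<lambda>x y. if x = y then 0 else min (d x) (d y) - 2"
  have le: "int (excess G x y) \<le> ?m x y" if "x \<in> S" "y \<in> S" for x y
  proof (cases "x = y")
    case False
    have "3 \<le> vdegree G x" "3 \<le> vdegree G y" using that by (auto simp: S_def branch_verts_def)
    moreover have "local_connectivity G x y \<le> min (vdegree G x) (vdegree G y)"
      using local_connectivity_le_min_degree[OF G False] that SV by blast
    ultimately show ?thesis using False unfolding excess_def d_def by (simp, linarith)
  qed simp
  have le': "(\<Sum>y\<in>S. int (excess G x y)) \<le> (\<Sum>y\<in>S. ?m x y)" if "x \<in> S" for x
    using that by (intro sum_mono le)
  show "int (total_excess G) \<le> min_sum S d - 2 * int (card S) * (int (card S) - 1)"
    unfolding tot min_sum_shift[OF finS, symmetric] by (intro sum_mono le')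
  assume eq: "int (total_excess G) = min_sum S d - 2 * int (card S) * (int (card S) - 1)"
    and xy: "x \<in> S" "y \<in> S" "x \<noteq> y"
  have "(\<Sum>y\<in>S. int (excess G x y)) = (\<Sum>y\<in>S. ?m x y)"
    using eq unfolding tot min_sum_shift[OF finS, symmetric]
    by (rule sum_mono_inv) (use le' xy finS in auto)
  then have "int (excess G x y) = ?m x y"
    by (rule sum_mono_inv) (use le xy finS in auto)
  moreover have "3 \<le> vdegree G x" "3 \<le> vdegree G y" using xy by (auto simp: S_def branch_verts_def)
  ultimately show "local_connectivity G x y = min (vdegree G x) (vdegree G y)"
    using xy(3) unfolding excess_def d_def by (simp split: if_splits)
qed

text \<open>A second edge with these ends would also join the two sides of the cut for
  \<open>g\<close>.\<close>

lemma critical_simple: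
  assumes "critical G" "g \<in> edges G" "h \<in> edges G" "ends G g = ends G h"
  shows "g = h"
proof (rule ccontr)
  assume "g \<noteq> h"
  obtain A c B where sep: "separation G g A c B" using criticalD(3)[OF assms(1,2)] by blast
  obtain x y where "x \<in> A" "y \<in> B" "ends G g = {x, y}" by (rule separation_ends[OF sep])
  then show False
    using separationD(2-4)[OF sep] separationD(5)[OF sep assms(3)] \<open>g \<noteq> h\<close> assms(4) by auto
qed

text \<open>The vertices outside the branch set become the edges of \<open>H\<close>, with their
  neighbours as ends. By \<open>critical_simple\<close> the two neighbours are distinct, so
  \<open>H\<close> has no loops; parallel edges may arise from different vertices with the same
  neighbours.\<close>

lemma exists_unsubdivided:
  fixes G :: "('v, 'e) mgraph"
  assumes crit: "critical G"
    and one: "\<And>h. h \<in> edges G \<Longrightarrow> card (ends G h \<inter> branch_verts G) = 1"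
    and two: "\<And>t. t \<in> verts G - branch_verts G \<Longrightarrow> vdegree G t = 2"
  shows "\<exists>(H :: (nat, nat) mgraph) a f g. multigraph H \<and> iso_maps G (subdivide H) f g \<and>
    verts H = a ` branch_verts G \<and> inj_on a (branch_verts G) \<and> (\<forall>x\<in>branch_verts G. f x = Inl (a x)) \<and>
    card (edges H) = card (verts G - branch_verts G)"
proof -
  note G = criticalD(1)[OF crit]
  let ?S = "branch_verts G" and ?T = "verts G - branch_verts G"
  have fin: "finite (edges G)" "finite (verts G)" and SV: "?S \<subseteq> verts G"
    using G by (auto simp: multigraph_def branch_verts_def)
  have "\<exists>x t. ends G h = {x, t} \<and> x \<in> ?S \<and> t \<in> ?T" if h: "h \<in> edges G" for h
  proof -
    obtain x where x: "ends G h \<inter> ?S = {x}" using one[OF h] by (auto simp: card_1_singleton_iff)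
    obtain p q where pq: "ends G h = {p, q}" "p \<noteq> q" "p \<in> verts G" "q \<in> verts G"
      by (rule multigraph_ends[OF G h])
    have xS: "x \<in> {p, q}" "x \<in> ?S" and only: "\<And>z. z \<in> {p, q} \<Longrightarrow> z \<in> ?S \<Longrightarrow> z = x"
      using x unfolding pq(1) by blast+
    show ?thesis
    proof (cases "p = x")
      case True
      then have "q \<notin> ?S" using only[of q] pq(2) by auto
      then show ?thesis using pq True xS(2) by blast
    next
      case False
      then have "q = x" "p \<notin> ?S" using only[of p] xS(1) by auto
      moreover have "ends G h = {q, p}" using pq(1) by (simp add: insert_commute)
      ultimately show ?thesis using pq(3) xS(2) by blast
    qed
  qed
  then obtain \<sigma> \<tau> where st: "\<And>h. h \<in> edges G \<Longrightarrow> ends G h = {\<sigma> h, \<tau> h}"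
    "\<And>h. h \<in> edges G \<Longrightarrow> \<sigma> h \<in> ?S" "\<And>h. h \<in> edges G \<Longrightarrow> \<tau> h \<in> ?T"
    by metis
  \<comment> \<open>One injection into the naturals names both vertices and edges of
    \<open>H\<close>, since these live in separate name spaces.\<close>
  obtain a :: "'v \<Rightarrow> nat" where a: "inj_on a (verts G)"
    using finite_imp_inj_to_nat_seg[OF fin(2)] by blast
  define N where "N t = \<sigma> ` {h \<in> edges G. \<tau> h = t}" for t
  have N2: "card (N t) = 2" if t: "t \<in> ?T" for t
  proof -
    have "{h \<in> edges G. \<tau> h = t} = {h \<in> edges G. t \<in> ends G h}" using st t by fastforce
    then have "card {h \<in> edges G. \<tau> h = t} = 2" using two[OF t] by (simp add: vdegree_def)
    moreover have "inj_on \<sigma> {h \<in> edges G. \<tau> h = t}"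
      by (intro inj_onI critical_simple[OF crit]) (auto simp: st(1))
    ultimately show ?thesis by (simp add: N_def card_image)
  qed
  have NS: "N t \<subseteq> ?S" for t using st(2) by (auto simp: N_def)
  have finT: "finite ?T" and finS: "finite ?S" using fin SV finite_subset by auto
  have aS: "inj_on a ?S" and aT: "inj_on a ?T" using inj_on_subset[OF a] SV by auto
  define H :: "(nat, nat) mgraph" where
    "H = \<lparr>verts = a ` ?S, edges = a ` ?T, ends = (\<lambda>i. a ` N (inv_into ?T a i))\<rparr>"
  have endsH: "ends H (a t) = a ` N t" if "t \<in> ?T" for t
    using that aT by (simp add: H_def)
  have H: "multigraph H"
  proof -
    have "ends H e \<subseteq> verts H \<and> card (ends H e) = 2" if e: "e \<in> edges H" for e
    proof -
      obtain t where t: "t \<in> ?T" "e = a t" using e by (auto simp: H_def)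
      have "card (a ` N t) = 2" using card_image[OF inj_on_subset[OF aS NS]] N2[OF t(1)] by simp
      then show ?thesis using endsH[OF t(1)] t(2) NS[of t] by (auto simp: H_def)
    qed
    then show ?thesis using finS finT by (simp add: multigraph_def H_def)
  qed
  define f where "f x = (if x \<in> ?S then Inl (a x) else Inr (a x))" for x
  define g where "g h = (a (\<tau> h), a (\<sigma> h))" for h
  have "bij_betw f (verts G) (verts (subdivide H))"
  proof (rule bij_betw_imageI)
    show "inj_on f (verts G)" using a by (auto simp: f_def inj_on_def)
    have "f ` verts G = f ` ?S \<union> f ` ?T" using SV by blast
    also have "f ` ?S = Inl ` a ` ?S" by (auto simp: f_def)
    also have "f ` ?T = Inr ` a ` ?T" by (auto simp: f_def image_iff)
    finally show "f ` verts G = verts (subdivide H)" by (simp add: H_def)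
  qed
  moreover have "bij_betw g (edges G) (edges (subdivide H))"
  proof (rule bij_betw_imageI)
    show "inj_on g (edges G)"
    proof (rule inj_onI)
      fix h h' assume h: "h \<in> edges G" "h' \<in> edges G" "g h = g h'"
      then have "\<tau> h = \<tau> h'" "\<sigma> h = \<sigma> h'"
        using inj_onD[OF aT _ st(3)[OF h(1)] st(3)[OF h(2)]] inj_onD[OF aS _ st(2)[OF h(1)] st(2)[OF h(2)]]
        by (simp_all add: g_def)
      then show "h = h'" using critical_simple[OF crit h(1,2)] st(1)[OF h(1)] st(1)[OF h(2)] by simp
    qed
    show "g ` edges G = edges (subdivide H)"
    proof (intro subset_antisym subsetI)
      fix k assume "k \<in> g ` edges G"
      then obtain h where h: "h \<in> edges G" "k = g h" by blast
      have "a (\<sigma> h) \<in> ends H (a (\<tau> h))" using endsH[OF st(3)[OF h(1)]] h(1) by (auto simp: N_def)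
      then show "k \<in> edges (subdivide H)" using st(3)[OF h(1)] h(2) by (auto simp: g_def H_def)
    next
      fix k assume "k \<in> edges (subdivide H)"
      then obtain e v where k: "k = (e, v)" "e \<in> edges H" "v \<in> ends H e" by auto
      obtain t where t: "t \<in> ?T" "e = a t" using k(2) by (auto simp: H_def)
      then obtain h where "h \<in> edges G" "\<tau> h = t" "v = a (\<sigma> h)"
        using k(3) endsH[OF t(1)] by (auto simp: N_def)
      then show "k \<in> g ` edges G" using k(1) t(2) by (auto simp: g_def)
    qed
  qed
  moreover have "ends (subdivide H) (g h) = f ` ends G h" if "h \<in> edges G" for h
    using st[OF that] by (simp add: g_def f_def insert_commute)
  ultimately have "iso_maps G (subdivide H) f g" by (simp add: iso_maps_def)
  moreover have "verts H = a ` ?S" by (simp add: H_def)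
  moreover have "card (edges H) = card ?T" using card_image[OF aT] by (simp add: H_def)
  moreover have "\<forall>x\<in>?S. f x = Inl (a x)" by (simp add: f_def)
  ultimately show ?thesis using H aS by blast
qed

section \<open>Excess of reduced graphs\<close>

lemma sum_pairs:
  fixes p :: "'a set \<Rightarrow> real"
  assumes "finite V"
  shows "2 * (\<Sum>S\<in>{S. S \<subseteq> V \<and> card S = 2}. p S) = (\<Sum>x\<in>V. \<Sum>y\<in>V. if x = y then 0 else p {x, y})"
  using assms
proof (induction V rule: finite_induct)
  case empty
  have "{S. S \<subseteq> ({} :: 'a set) \<and> card S = 2} = {}" by auto
  then show ?case by (simp only: sum.empty mult_zero_right)
next
  case (insert z X)
  let ?P = "\<lambda>V. {S. S \<subseteq> V \<and> card S = 2}"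
  have finP: "finite (?P X)" using insert.hyps(1) by simp
  have "?P (insert z X) = ?P X \<union> (\<lambda>y. {z, y}) ` X"
  proof (intro subset_antisym subsetI)
    fix S assume S: "S \<in> ?P (insert z X)"
    show "S \<in> ?P X \<union> (\<lambda>y. {z, y}) ` X"
    proof (cases "z \<in> S")
      case True
      then obtain y where "S = {z, y}" "y \<noteq> z" using S by (auto simp: card_2_iff)
      then show ?thesis using S by auto
    qed (use S in auto)
  next
    fix S assume "S \<in> ?P X \<union> (\<lambda>y. {z, y}) ` X"
    then consider "S \<in> ?P X" | y where "y \<in> X" "S = {z, y}" by blast
    then show "S \<in> ?P (insert z X)"
    proof cases
      case 2
      then have "z \<noteq> y" using insert.hyps(2) by auto
      then show ?thesis using 2 by simp
    qed auto
  qed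
  moreover have "?P X \<inter> (\<lambda>y. {z, y}) ` X = {}" using insert.hyps(2) by auto
  moreover have "inj_on (\<lambda>y. {z, y}) X" by (auto simp: inj_on_def doubleton_eq_iff)
  ultimately have "(\<Sum>S\<in>?P (insert z X). p S) = (\<Sum>S\<in>?P X. p S) + (\<Sum>y\<in>X. p {z, y})"
    using finP insert.hyps(1) by (simp add: sum.union_disjoint sum.reindex)
  moreover have "(\<Sum>x\<in>insert z X. \<Sum>y\<in>insert z X. if x = y then 0 else p {x, y}) =
      (\<Sum>x\<in>X. \<Sum>y\<in>X. if x = y then 0 else p {x, y}) + 2 * (\<Sum>y\<in>X. p {z, y})"
  proof -
    have "(\<Sum>y\<in>X. if z = y then 0 else p {z, y}) = (\<Sum>y\<in>X. p {z, y})"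
      "(\<Sum>x\<in>X. if x = z then 0 else p {x, z}) = (\<Sum>y\<in>X. p {z, y})"
      using insert.hyps(2) by (auto intro!: sum.cong simp: insert_commute)
    then show ?thesis using insert.hyps by (simp add: sum.distrib)
  qed
  ultimately show ?case using insert.IH by simp
qed

lemma average_connectivity_excess:
  assumes crit: "critical G" and n3: "3 \<le> card (verts G)"
  shows "average_connectivity G =
    2 + real (total_excess G) / (real (card (verts G)) * (real (card (verts G)) - 1))"
proof -
  let ?V = "verts G" and ?n = "real (card (verts G))"
  have fin: "finite ?V" using criticalD(1)[OF crit] by (simp add: multigraph_def)
  have "2 * (\<Sum>S \<in> {S. S \<subseteq> ?V \<and> card S = 2}. real (pair_connectivity G S))
      = (\<Sum>x\<in>?V. \<Sum>y\<in>?V. if x = y then 0 else real (pair_connectivity G {x, y}))"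
    by (rule sum_pairs[OF fin])
  also have "\<dots> = (\<Sum>x\<in>?V. \<Sum>y\<in>?V. 2 - (if x = y then 2 else 0) + real (excess G x y))"
    using two_le_local_connectivity[OF crit n3]
    by (intro sum.cong refl) (auto simp: excess_def pair_connectivity_eq of_nat_diff)
  also have "\<dots> = 2 * ?n * (?n - 1) + real (total_excess G)"
    using fin by (simp add: sum.distrib sum_subtractf total_excess_def algebra_simps)
  finally have sum: "(\<Sum>S \<in> {S. S \<subseteq> ?V \<and> card S = 2}. real (pair_connectivity G S))
      = ?n * (?n - 1) + real (total_excess G) / 2" by simp
  have "2 * real (card ?V choose 2) = ?n * (?n - 1)"
  proof -
    have "even (card ?V * (card ?V - 1))" by (cases "even (card ?V)") auto
    then have "2 * (card ?V choose 2) = card ?V * (card ?V - 1)"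
      unfolding choose_two by (rule dvd_mult_div_cancel)
    then have "2 * real (card ?V choose 2) = real (card ?V * (card ?V - 1))"
      by (metis of_nat_mult of_nat_numeral)
    then show ?thesis using n3 by (simp add: of_nat_diff)
  qed
  then have c: "real (card ?V choose 2) = ?n * (?n - 1) / 2" by simp
  have "?n * (?n - 1) \<noteq> 0" using n3 by simp
  then show ?thesis
    unfolding average_connectivity_def graph_order_def sum c by (simp add: field_simps)
qed

section \<open>Numerical bounds for reduced graphs\<close>

definition reduced :: "('v, 'e) mgraph \<Rightarrow> bool" where
  "reduced G \<longleftrightarrow> critical G \<and> (\<forall>h\<in>edges G. \<not> ends G h \<subseteq> branch_verts G)"

lemma reduced_multigraph: "reduced G \<Longrightarrow> multigraph G"
  using criticalD(1) by (auto simp: reduced_def)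

lemma branch_verts_finite:
  assumes "multigraph G"
  shows "finite (branch_verts G)" "branch_verts G \<subseteq> verts G"
    "int (card (verts G - branch_verts G)) = int (card (verts G)) - int (card (branch_verts G))"
proof -
  show s: "branch_verts G \<subseteq> verts G" by (auto simp: branch_verts_def)
  have fin: "finite (verts G)" using assms by (simp add: multigraph_def)
  show f: "finite (branch_verts G)" using s fin by (rule finite_subset)
  show "int (card (verts G - branch_verts G)) = int (card (verts G)) - int (card (branch_verts G))"
    using card_Diff_subset[OF f s] card_mono[OF fin s] by simp
qed

lemma reduced_branch_sum:
  assumes "reduced G"
  shows "(\<Sum>x\<in>branch_verts G. int (vdegree G x)) \<le> 2 * (int (card (verts G)) - int (card (branch_verts G)))"
proof -
  have G: "multigraph G" by (rule reduced_multigraph[OF assms])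
  have "(\<Sum>x\<in>branch_verts G. vdegree G x) \<le> 2 * card (verts G - branch_verts G)"
    by (rule reduced_degree_sum(1)[OF G]) (use assms in \<open>auto simp: reduced_def\<close>)
  then have "int (\<Sum>x\<in>branch_verts G. vdegree G x) \<le> int (2 * card (verts G - branch_verts G))" by linarith
  then show ?thesis using branch_verts_finite(3)[OF G] by simp
qed

lemma few_branch_verts:
  assumes "multigraph G" "card (branch_verts G) < 2"
  shows "total_excess G = 0"
proof -
  let ?S = "branch_verts G"
  have "card ?S = 0 \<or> card ?S = 1" using assms(2) by auto
  then have "?S = {} \<or> (\<exists>x. ?S = {x})"
    using branch_verts_finite(1)[OF assms(1)] by (auto simp: card_1_singleton_iff)
  moreover have "int (total_excess G) \<le> min_sum ?S (\<lambda>x. int (vdegree G x)) - 2 * int (card ?S) * (int (card ?S) - 1)"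
    by (rule total_excess_min_sum(1)[OF assms(1)])
  ultimately show ?thesis by (auto simp: min_sum_def)
qed

lemma reduced_bounds:
  assumes red: "reduced G" and s2: "2 \<le> card (branch_verts G)"
  defines "n \<equiv> int (card (verts G))" and "s \<equiv> int (card (branch_verts G))"
    and "X \<equiv> int (total_excess G)"
  shows "X \<le> 2 * (s - 1) * (n - 2 * s)"
    "r = 2 * (n - s) - q * s \<Longrightarrow> 0 \<le> r \<Longrightarrow> r \<le> s \<Longrightarrow> X \<le> (q - 2) * s * (s - 1) + r * (r - 1)"
proof -
  have G: "multigraph G" by (rule reduced_multigraph[OF red])
  let ?S = "branch_verts G" and ?d = "\<lambda>x. int (vdegree G x)"
  note fin = branch_verts_finite(1)[OF G]
  have X: "X \<le> min_sum ?S ?d - 2 * s * (s - 1)"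
    unfolding X_def s_def by (rule total_excess_min_sum(1)[OF G])
  have D: "sum ?d ?S \<le> 2 * (n - s)" unfolding n_def s_def by (rule reduced_branch_sum[OF red])
  have "min_sum ?S ?d \<le> (s - 1) * sum ?d ?S" unfolding s_def by (rule min_sum_le_mean[OF fin])
  also have "\<dots> \<le> (s - 1) * (2 * (n - s))" using D s2 by (intro mult_left_mono) (auto simp: s_def)
  finally have "X \<le> (s - 1) * (2 * (n - s)) - 2 * s * (s - 1)" using X by linarith
  also have "\<dots> = 2 * (s - 1) * (n - 2 * s)" by (simp add: algebra_simps)
  finally show "X \<le> 2 * (s - 1) * (n - 2 * s)" .
  assume r: "r = 2 * (n - s) - q * s" "0 \<le> r" "r \<le> s"
  have "min_sum ?S ?d \<le> q * s * (s - 1) + r * (r - 1)"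
    unfolding s_def by (rule min_sum_bound(1)[OF fin])
      (use D r s2 in \<open>auto simp: s_def\<close>)
  with X have "X \<le> q * s * (s - 1) + r * (r - 1) - 2 * s * (s - 1)" by linarith
  then show "X \<le> (q - 2) * s * (s - 1) + r * (r - 1)" by (simp add: algebra_simps)
qed

text \<open>\<open>N\<close> is only an upper bound for the order because the estimate is also
  applied to graphs that have lost vertices by contraction.\<close>

lemma reduced_mean_bound:
  assumes red: "reduced G" and N: "int (card (verts G)) \<le> N"
  shows "4 * int (total_excess G) \<le> (N - 2)\<^sup>2"
proof (cases "2 \<le> card (branch_verts G)")
  case True
  have G: "multigraph G" by (rule reduced_multigraph[OF red])
  define n s where "n = int (card (verts G))" and "s = int (card (branch_verts G))"
  have "s \<le> n"
    using branch_verts_finite(2)[OF G] G unfolding n_def s_def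
    by (simp add: card_mono multigraph_def)
  then have n2: "2 \<le> n" using True by (simp add: s_def)
  have "4 * int (total_excess G) \<le> 8 * (s - 1) * (n - 2 * s)"
    using reduced_bounds(1)[OF red True] unfolding n_def s_def by linarith
  \<comment> \<open>Completing the square: the factors \<open>4 * (s - 1)\<close> and
    \<open>2 * (n - 2 * s)\<close> have the fixed sum \<open>2 * (n - 2)\<close>, and they are equal
    at \<open>s = (n + 2) / 4\<close>.\<close>
  also have "\<dots> = (n - 2)\<^sup>2 - (n - 2 - 4 * (s - 1))\<^sup>2" by (simp add: power2_eq_square algebra_simps)
  also have "\<dots> \<le> (n - 2)\<^sup>2" by simp
  also have "\<dots> \<le> (N - 2)\<^sup>2" using n2 N unfolding n_def by (intro power_mono) auto
  finally show ?thesis .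
next
  case False
  then show ?thesis
    using few_branch_verts[OF reduced_multigraph[OF red]] by simp
qed

lemma reduced_or_smaller:
  assumes "critical G"
  obtains "reduced G" | G' :: "('v, 'e) mgraph" where "reduced G'" "total_excess G \<le> total_excess G'"
    "card (verts G') < card (verts (G :: ('v, 'e) mgraph))"
proof -
  obtain G' :: "('v, 'e) mgraph" where G': "critical G'" "total_excess G \<le> total_excess G'"
    "card (verts G') \<le> card (verts G)" "card (verts G') = card (verts G) \<Longrightarrow> G' = G"
    "\<And>h. h \<in> edges G' \<Longrightarrow> \<not> ends G' h \<subseteq> branch_verts G'"
    using exists_reduced[OF assms] by metis
  then have "reduced G'" by (simp add: reduced_def)
  with G' that show thesis by (cases "card (verts G') = card (verts G)") auto
qed

text \<open>Such a graph is dominated by a reduced one with at least one vertex less, so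
  \<open>n - 1\<close> takes the place of \<open>n\<close> in the mean bound.\<close>

lemma smaller_mean_bound:
  assumes "critical G" "\<not> reduced G"
  shows "4 * int (total_excess G) \<le> (int (card (verts G)) - 3)\<^sup>2"
  using assms(1)
proof (cases rule: reduced_or_smaller)
  case (2 G')
  then show ?thesis using reduced_mean_bound[OF 2(1), of "int (card (verts G)) - 1"] by simp
qed (use assms in auto)

lemma critical_mean_bound:
  assumes "critical G" "3 \<le> card (verts G)"
  shows "4 * int (total_excess G) \<le> (int (card (verts G)) - 2)\<^sup>2"
  using assms(1)
proof (cases rule: reduced_or_smaller)
  case 1
  then show ?thesis using reduced_mean_bound by blast
next
  case (2 G')
  then show ?thesis using reduced_mean_bound[OF 2(1), of "int (card (verts G))"] by simp
qed

lemma iso_ideally_connected: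
  assumes crit: "critical G" and H: "multigraph H" and iso: "iso_maps G (subdivide H) f g"
    and a: "verts H = a ` S" "inj_on a S" "\<And>x. x \<in> S \<Longrightarrow> f x = Inl (a x)" and S: "S \<subseteq> verts G"
  shows "x \<in> S \<Longrightarrow> vdegree H (a x) = vdegree G x"
    "x \<in> S \<Longrightarrow> y \<in> S \<Longrightarrow> x \<noteq> y \<Longrightarrow> local_connectivity H (a x) (a y) = local_connectivity G x y"
proof -
  note G = criticalD(1)[OF crit]
  show "vdegree H (a x) = vdegree G x" if "x \<in> S"
    using iso_vdegree[OF G iso, of x] a(3)[OF that] S that by (auto simp: subdivide_vdegree_old)
  assume xy: "x \<in> S" "y \<in> S" "x \<noteq> y"
  then have "a x \<noteq> a y" "a x \<in> verts H" "a y \<in> verts H" using a(1,2) by (auto simp: inj_on_eq_iff)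
  then show "local_connectivity H (a x) (a y) = local_connectivity G x y"
    using subdivide_local_connectivity[OF H, of "a x" "a y"] a(3) xy S
      iso_local_connectivity[OF G subdivide_multigraph[OF H] iso, of x y] by auto
qed

section \<open>The extremal graphs\<close>

text \<open>The form delivered by the equality case of \<open>min_sum_bound\<close>. When
  \<open>2 * m\<close> is at least \<open>q * s\<close> and less than \<open>(q + 1) * s\<close>,
  the degree condition is the same as near regularity.\<close>

definition extremal_base :: "nat \<Rightarrow> int \<Rightarrow> int \<Rightarrow> ('v, 'e) mgraph \<Rightarrow> bool" where
  "extremal_base q s m H \<longleftrightarrow> ideally_connected H \<and>
     (\<forall>v\<in>verts H. vdegree H v = q \<or> vdegree H v = q + 1) \<and>
     int (graph_order H) = s \<and> int (graph_size H) = m"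

text \<open>The excess is bounded through the sum of minima, and that sum by its extremal value;
  both bounds must be tight. The first gives ideal connectivity, the second the degrees and the full
  degree sum, which makes \<open>G\<close> a subdivision.\<close>

lemma reduced_tight:
  fixes G :: "('v, 'e) mgraph"
  assumes red: "reduced G" and s2: "2 \<le> card (branch_verts G)"
  defines "n \<equiv> int (card (verts G))" and "s \<equiv> int (card (branch_verts G))"
  assumes r_def: "r = 2 * (n - s) - int q * s" and r: "0 \<le> r" "r \<le> s" "r \<noteq> 1"
    and X: "int (total_excess G) = (int q - 2) * s * (s - 1) + r * (r - 1)"
  shows "full_subdivision_of G (extremal_base q s (n - s))"
proof -
  have crit: "critical G" using red by (simp add: reduced_def)
  note G = criticalD(1)[OF crit]
  let ?S = "branch_verts G" and ?d = "\<lambda>x. int (vdegree G x)"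
  note fin = branch_verts_finite[OF G]
  have D: "sum ?d ?S \<le> 2 * (n - s)" unfolding n_def s_def by (rule reduced_branch_sum[OF red])
  have D': "sum ?d ?S \<le> int q * int (card ?S) + r" using D by (simp add: r_def s_def)
  have r': "0 \<le> r" "r \<le> int (card ?S)" using r by (simp_all add: s_def)
  note B = min_sum_bound[OF fin(1) D' r' s2]
  have up: "int (total_excess G) \<le> min_sum ?S ?d - 2 * int (card ?S) * (int (card ?S) - 1)"
    by (rule total_excess_min_sum(1)[OF G])
  have X': "int (total_excess G) = int q * int (card ?S) * (int (card ?S) - 1) + r * (r - 1)
      - 2 * int (card ?S) * (int (card ?S) - 1)"
    unfolding X s_def by (simp add: algebra_simps)
  have m: "min_sum ?S ?d = int q * int (card ?S) * (int (card ?S) - 1) + r * (r - 1)"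
    using up X' B(1) by linarith
  have deg: "sum ?d ?S = int q * int (card ?S) + r" "\<forall>x\<in>?S. ?d x = int q \<or> ?d x = int q + 1"
    using B(2)[OF m r(3)] by auto
  have conn: "local_connectivity G x y = min (vdegree G x) (vdegree G y)"
    if "x \<in> ?S" "y \<in> ?S" "x \<noteq> y" for x y
    using total_excess_min_sum(2)[OF G _ that] X' m by simp
  have "int (\<Sum>x\<in>?S. vdegree G x) = int (2 * card (verts G - ?S))"
    using deg(1) fin(3) by (simp add: r_def s_def n_def)
  then have "(\<Sum>x\<in>?S. vdegree G x) = 2 * card (verts G - ?S)" by linarith
  then have one: "\<forall>h\<in>edges G. card (ends G h \<inter> ?S) = 1" and two: "\<forall>t\<in>verts G - ?S. vdegree G t = 2"
    using reduced_degree_sum(2)[OF G] red by (auto simp: reduced_def)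
  obtain H :: "(nat, nat) mgraph" and a f g where H: "multigraph H" and iso: "iso_maps G (subdivide H) f g"
    and a: "verts H = a ` ?S" "inj_on a ?S" "\<forall>x\<in>?S. f x = Inl (a x)"
    and size: "card (edges H) = card (verts G - ?S)"
    using exists_unsubdivided[OF crit] one two by metis
  note I = iso_ideally_connected[OF crit H iso a(1,2) _ fin(2)]
  have "ideally_connected H"
    unfolding ideally_connected_def
  proof (intro ballI impI)
    fix u v assume uv: "u \<in> verts H" "v \<in> verts H" "u \<noteq> v"
    then obtain x y where xy: "u = a x" "v = a y" "x \<in> ?S" "y \<in> ?S" using a(1) by blast
    then show "local_connectivity H u v = min (vdegree H u) (vdegree H v)"
      using I(1)[of x] I(1)[of y] I(2)[of x y] a(3) conn[of x y] uv(3) by auto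
  qed
  moreover have "vdegree H v = q \<or> vdegree H v = q + 1" if vH: "v \<in> verts H" for v
  proof -
    obtain x where x: "v = a x" "x \<in> ?S" using a(1) vH by blast
    have "vdegree H (a x) = vdegree G x" using I(1)[OF _ x(2)] a(3) by blast
    moreover have "int (vdegree G x) = int q \<or> int (vdegree G x) = int q + 1" using deg(2) x(2) by blast
    ultimately show ?thesis using x(1) by auto
  qed
  moreover have "int (graph_order H) = s"
    using card_image[OF a(2)] a(1) by (simp add: graph_order_def s_def)
  moreover have "int (graph_size H) = n - s"
    using size fin(3) by (simp add: graph_size_def s_def n_def)
  moreover have "mgraph_iso G (subdivide H)"
    using iso unfolding mgraph_iso_def iso_maps_def by blast
  ultimately show ?thesis unfolding full_subdivision_of_def extremal_base_def using H by blast
qed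

text \<open>With \<open>2 \<le> q\<close> no difference between old vertices is truncated, so ideal
  connectivity turns the excess into a sum of minima of two adjacent values.\<close>

lemma total_excess_subdivision:
  assumes crit: "critical G" and H: "multigraph H" and iso: "mgraph_iso G (subdivide H)"
    and base: "extremal_base q s m H" and q: "2 \<le> q" and r: "2 * m = int q * s + r"
  shows "int (total_excess G) = (int q - 2) * s * (s - 1) + r * (r - 1)"
proof -
  note G = criticalD(1)[OF crit] and K = subdivide_multigraph[OF H]
  let ?K = "subdivide H" and ?d = "\<lambda>x. int (vdegree H x)"
  obtain f g where fg: "iso_maps G ?K f g" using iso unfolding mgraph_iso_def iso_maps_def by blast
  have bij: "bij_betw f (verts G) (verts ?K)" using fg by (simp add: iso_maps_def)
  have fin: "finite (verts H)" "finite (edges H)" using H by (auto simp: multigraph_def)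
  have s: "s = int (card (verts H))" and m: "m = int (card (edges H))"
    using base by (simp_all add: extremal_base_def graph_order_def graph_size_def)
  have deg: "vdegree H v = q \<or> vdegree H v = q + 1" if "v \<in> verts H" for v
    using base that by (simp add: extremal_base_def)
  have ex: "excess G x y = excess ?K (f x) (f y)" if "x \<in> verts G" "y \<in> verts G" for x y
    using iso_local_connectivity[OF G K fg that] bij that
    by (auto simp: excess_def bij_betw_def inj_on_eq_iff)
  have "total_excess G = (\<Sum>x\<in>verts G. \<Sum>y\<in>verts G. excess ?K (f x) (f y))"
    unfolding total_excess_def by (intro sum.cong refl ex)
  also have "\<dots> = (\<Sum>x\<in>verts G. \<Sum>y\<in>verts ?K. excess ?K (f x) y)"
    by (intro sum.cong refl sum.reindex_bij_betw[OF bij])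
  also have "\<dots> = total_excess ?K"
    unfolding total_excess_def
    by (rule sum.reindex_bij_betw[OF bij, where g = "\<lambda>x. \<Sum>y\<in>verts ?K. excess ?K x y"])
  also have "\<dots> = (\<Sum>x\<in>Inl ` verts H. \<Sum>y\<in>Inl ` verts H. excess ?K x y)"
    by (rule total_excess_restrict[OF K]) (auto simp: subdivide_vdegree_new[OF H])
  also have "\<dots> = (\<Sum>x\<in>verts H. \<Sum>y\<in>verts H. excess ?K (Inl x) (Inl y))"
    by (simp add: sum.reindex)
  finally have "int (total_excess G) = (\<Sum>x\<in>verts H. \<Sum>y\<in>verts H. int (excess ?K (Inl x) (Inl y)))"
    by simp
  also have "\<dots> = (\<Sum>x\<in>verts H. \<Sum>y\<in>verts H. if x = y then 0 else min (?d x) (?d y) - 2)"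
  proof (intro sum.cong refl)
    fix x y assume xy: "x \<in> verts H" "y \<in> verts H"
    show "int (excess ?K (Inl x) (Inl y)) = (if x = y then 0 else min (?d x) (?d y) - 2)"
    proof (cases "x = y")
      case False
      have "local_connectivity ?K (Inl x) (Inl y) = min (vdegree H x) (vdegree H y)"
        using subdivide_local_connectivity[OF H xy False] base xy False
        by (simp add: extremal_base_def ideally_connected_def)
      moreover have "2 \<le> min (vdegree H x) (vdegree H y)" using deg[OF xy(1)] deg[OF xy(2)] q by auto
      ultimately show ?thesis using False by (simp add: excess_def of_nat_diff of_nat_min)
    qed simp
  qed
  also have "\<dots> = min_sum (verts H) ?d - 2 * s * (s - 1)"
    unfolding s by (rule min_sum_shift[OF fin(1)])
  also have "min_sum (verts H) ?d = int q * s * (s - 1) + r * (r - 1)"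
    unfolding s
  proof (rule min_sum_two_values[OF fin(1)])
    show "?d x = int q \<or> ?d x = int q + 1" if "x \<in> verts H" for x using deg[OF that] by auto
    have "int (\<Sum>x\<in>verts H. vdegree H x) = 2 * m" using degree_sum[OF H] by (simp add: m)
    then show "sum ?d (verts H) = int q * int (card (verts H)) + r" using r by (simp add: s)
  qed
  finally show "int (total_excess G) = (int q - 2) * s * (s - 1) + r * (r - 1)"
    by (simp add: algebra_simps)
qed

lemma extremal_base_nearly_regular:
  assumes "multigraph H" "extremal_base q s m H" "0 < s"
  shows "nearly_regular H"
proof -
  have ne: "verts H \<noteq> {}" and fin: "finite (verts H)"
    using assms by (auto simp: extremal_base_def graph_order_def multigraph_def)
  have "vdegree H v \<le> q + 1" "q \<le> vdegree H v" if "v \<in> verts H" for v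
    using assms(2) that by (auto simp: extremal_base_def)
  then have "max_degree H \<le> q + 1" "q \<le> min_degree H"
    using ne fin by (simp_all add: max_degree_def min_degree_def)
  then show ?thesis by (simp add: nearly_regular_def)
qed

text \<open>The mean degree is at least the minimum degree \<open>p\<close>, and less than
  \<open>p + 1\<close> because some vertex attains \<open>p\<close>. It is also at least
  \<open>q\<close> and less than \<open>q + 1\<close>, so \<open>p = q\<close>.\<close>

lemma nearly_regular_extremal_base:
  assumes H: "multigraph H" and "ideally_connected H" and nr: "nearly_regular H"
    and s: "int (graph_order H) = s" and m: "int (graph_size H) = m"
    and r: "2 * m = int q * s + r" "0 \<le> r" "r < s"
  shows "extremal_base q s m H"
proof -
  let ?V = "verts H"
  have fin: "finite ?V" using H by (simp add: multigraph_def)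
  have ne: "?V \<noteq> {}" using s r by (auto simp: graph_order_def)
  have s': "s = int (card ?V)" using s by (simp add: graph_order_def)
  define p where "p = min_degree H"
  have lo: "p \<le> vdegree H v" and hi: "vdegree H v \<le> p + 1" if "v \<in> ?V" for v
  proof -
    show "p \<le> vdegree H v" unfolding p_def min_degree_def using fin that by simp
    have "vdegree H v \<le> max_degree H" unfolding max_degree_def using fin that by simp
    then show "vdegree H v \<le> p + 1" using nr unfolding nearly_regular_def p_def by linarith
  qed
  have "min_degree H \<in> vdegree H ` ?V" unfolding min_degree_def using fin ne by (intro Min_in) auto
  then obtain w where w: "w \<in> ?V" "vdegree H w = p" by (auto simp: p_def)
  have tot: "int (\<Sum>v\<in>?V. vdegree H v) = int q * s + r"
    using degree_sum[OF H] m r(1) by (simp add: graph_size_def)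
  have "(\<Sum>v\<in>?V. p) \<le> (\<Sum>v\<in>?V. vdegree H v)" by (intro sum_mono lo)
  then have "int (card ?V * p) \<le> int (\<Sum>v\<in>?V. vdegree H v)" unfolding of_nat_le_iff by simp
  then have 1: "int p * s \<le> int q * s + r" using tot by (simp add: s' mult.commute)
  have "(\<Sum>v\<in>?V. vdegree H v) < (\<Sum>v\<in>?V. p + 1)"
    using hi w by (intro sum_strict_mono_ex1 fin) (auto intro!: bexI[of _ w])
  then have "int (\<Sum>v\<in>?V. vdegree H v) < int (card ?V * (p + 1))" unfolding of_nat_less_iff by simp
  then have 2: "int q * s + r < (int p + 1) * s" using tot by (simp add: s' algebra_simps)
  have "int p = int q"
  proof (rule antisym; rule ccontr)
    assume "\<not> int p \<le> int q"
    then have "(int q + 1) * s \<le> int p * s" using s' by (intro mult_right_mono) auto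
    then show False using 1 r(3) by (simp add: algebra_simps)
  next
    assume "\<not> int q \<le> int p"
    then have "(int p + 1) * s \<le> int q * s" using s' by (intro mult_right_mono) auto
    then show False using 2 r(2) by linarith
  qed
  then have "vdegree H v = q \<or> vdegree H v = q + 1" if "v \<in> ?V" for v
    using lo[OF that] hi[OF that] by auto
  then show ?thesis using assms by (simp add: extremal_base_def)
qed

text \<open>All degrees are at least \<open>q\<close>, so a single degree \<open>q + 1\<close> would
  push the degree sum above \<open>q * s\<close>.\<close>

lemma regular_extremal_base:
  assumes H: "multigraph H" and base: "extremal_base q s m H" and m: "2 * m = int q * s"
  shows "regular q H"
proof -
  have fin: "finite (verts H)" using H by (simp add: multigraph_def)
  have d: "vdegree H v = q \<or> vdegree H v = q + 1" if "v \<in> verts H" for v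
    using base that by (simp add: extremal_base_def)
  have "int (\<Sum>v\<in>verts H. vdegree H v) = int (\<Sum>v\<in>verts H. q)"
    using degree_sum[OF H] base m by (simp add: extremal_base_def graph_size_def graph_order_def mult.commute)
  then have eq: "(\<Sum>v\<in>verts H. q) = (\<Sum>v\<in>verts H. vdegree H v)" by linarith
  have "q = vdegree H v" if "v \<in> verts H" for v
    by (rule sum_mono_inv[OF eq _ that fin]) (use d in force)
  then show ?thesis by (simp add: regular_def)
qed

lemma nearly_regular_base_iff:
  assumes "multigraph H" "2 * m = int q * s + r" "0 \<le> r" "r < s"
  shows "ideally_connected H \<and> nearly_regular H \<and> int (graph_order H) = s \<and> int (graph_size H) = m \<longleftrightarrow>
    extremal_base q s m H"
  using nearly_regular_extremal_base[OF assms(1) _ _ _ _ assms(2-4)]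
    extremal_base_nearly_regular[OF assms(1), of q s m] assms(3,4)
  by (auto simp: extremal_base_def)

lemma regular_base_iff:
  assumes H: "multigraph H" and m: "2 * m = int q * s"
  shows "ideally_connected H \<and> regular q H \<and> int (graph_order H) = s \<longleftrightarrow> extremal_base q s m H"
proof
  assume a: "ideally_connected H \<and> regular q H \<and> int (graph_order H) = s"
  then have "(\<Sum>v\<in>verts H. vdegree H v) = (\<Sum>v\<in>verts H. q)" by (intro sum.cong) (auto simp: regular_def)
  then have "2 * card (edges H) = card (verts H) * q" using degree_sum[OF H] by simp
  then have "int (2 * card (edges H)) = int (card (verts H) * q)" by (rule arg_cong)
  then have "int (graph_size H) = m"
    using a m by (simp add: graph_size_def graph_order_def mult.commute)
  with a show "extremal_base q s m H" by (simp add: extremal_base_def regular_def)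
next
  assume b: "extremal_base q s m H"
  with regular_extremal_base[OF H b m]
  show "ideally_connected H \<and> regular q H \<and> int (graph_order H) = s" by (simp add: extremal_base_def)
qed

lemma full_subdivision_of_cong:
  assumes "\<And>H. multigraph H \<Longrightarrow> P H \<longleftrightarrow> Q H"
  shows "full_subdivision_of G P \<longleftrightarrow> full_subdivision_of G Q"
  using assms unfolding full_subdivision_of_def by blast

lemma full_subdivision_of_disj:
  "full_subdivision_of G (\<lambda>H. P H \<or> Q H) \<longleftrightarrow> full_subdivision_of G P \<or> full_subdivision_of G Q"
  unfolding full_subdivision_of_def by blast

lemma total_excess_full_subdivision:
  assumes "critical G" "full_subdivision_of G (extremal_base q s m)" "2 \<le> q" "2 * m = int q * s + r"
  shows "int (total_excess G) = (int q - 2) * s * (s - 1) + r * (r - 1)"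
  using assms total_excess_subdivision unfolding full_subdivision_of_def by blast

section \<open>The extremal values\<close>

lemma excess_bound_0:
  fixes G :: "('v, 'e) mgraph"
  assumes crit: "critical G" and n: "int (card (verts G)) = 4 * k" and k: "8 \<le> k"
  shows "int (total_excess G) \<le> 4 * k * k - 4 * k"
    "int (total_excess G) = 4 * k * k - 4 * k \<longleftrightarrow> full_subdivision_of G (extremal_base 6 k (3 * k))"
proof -
  let ?X = "int (total_excess G)" and ?s = "int (card (branch_verts G))"
  have pos: "0 < 4 * k * k - 4 * k" using k by (simp add: mult.assoc)
  have "?X \<le> 4 * k * k - 4 * k \<and>
    (?X = 4 * k * k - 4 * k \<longrightarrow> full_subdivision_of G (extremal_base 6 k (3 * k)))"
  proof (cases "reduced G")
    case False
    have "4 * ?X \<le> (4 * k - 3)\<^sup>2" using smaller_mean_bound[OF crit False] n by simp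
    also have "\<dots> = 4 * (4 * k * k - 4 * k) + (9 - 8 * k)" by (simp add: power2_eq_square algebra_simps)
    finally show ?thesis using k by auto
  next
    case red: True
    show ?thesis
    proof (cases "2 \<le> card (branch_verts G)")
      case False
      then have "?X = 0" using few_branch_verts[OF reduced_multigraph[OF red]] by simp
      with pos have "?X < 4 * k * k - 4 * k" by linarith
      then show ?thesis by auto
    next
      case s2: True
      note B = reduced_bounds[OF red s2, unfolded n]
      have R: "?X \<le> 2 * (?s - 1) * (4 * k - 2 * ?s)" by (rule B(1))
      have Q5: "?X \<le> 3 * ?s * (?s - 1) + (8 * k - 7 * ?s) * (8 * k - 7 * ?s - 1)"
        if "0 \<le> 8 * k - 7 * ?s" "8 * k - 7 * ?s \<le> ?s"
        using B(2)[of "8 * k - 7 * ?s" 5] that by simp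
      note E = extremal_0[OF k R Q5]
      have "full_subdivision_of G (extremal_base 6 k (3 * k))" if X: "?X = 4 * k * k - 4 * k"
      proof -
        have s: "?s = k" by (rule E(2)[OF _ _ X])
        \<comment> \<open>With \<open>s = k\<close> the degree sum is \<open>6 * k\<close>, hence
          \<open>q = 6\<close> and \<open>r = 0\<close>.\<close>
        show ?thesis
          using reduced_tight[OF red s2, unfolded n s, of 0 6] X k by (simp add: algebra_simps)
      qed
      then show ?thesis using E(1) by blast
    qed
  qed
  moreover have "?X = 4 * k * k - 4 * k" if "full_subdivision_of G (extremal_base 6 k (3 * k))"
    using total_excess_full_subdivision[OF crit that, of 0] by (simp add: algebra_simps)
  ultimately show "?X \<le> 4 * k * k - 4 * k"
    "?X = 4 * k * k - 4 * k \<longleftrightarrow> full_subdivision_of G (extremal_base 6 k (3 * k))" by blast+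
qed

lemma excess_bound_1:
  fixes G :: "('v, 'e) mgraph"
  assumes crit: "critical G" and n: "int (card (verts G)) = 4 * k + 1" and k: "30 \<le> k"
  shows "int (total_excess G) \<le> 4 * k * k - 4 * k + 2"
    "int (total_excess G) = 4 * k * k - 4 * k + 2 \<longleftrightarrow>
      full_subdivision_of G (extremal_base 6 k (3 * k + 1))"
proof -
  let ?X = "int (total_excess G)" and ?s = "int (card (branch_verts G))"
  have pos: "0 < 4 * k * k - 4 * k" using k by (simp add: mult.assoc)
  have "?X \<le> 4 * k * k - 4 * k + 2 \<and>
    (?X = 4 * k * k - 4 * k + 2 \<longrightarrow> full_subdivision_of G (extremal_base 6 k (3 * k + 1)))"
  proof (cases "reduced G")
    case False
    \<comment> \<open>After a contraction the mean bound is \<open>4 * k * k - 4 * k + 1\<close>,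
      one below the claimed value.\<close>
    have "4 * ?X \<le> (4 * k - 2)\<^sup>2" using smaller_mean_bound[OF crit False] n by simp
    also have "\<dots> = 4 * (4 * k * k - 4 * k + 1)" by (simp add: power2_eq_square algebra_simps)
    finally show ?thesis by auto
  next
    case red: True
    show ?thesis
    proof (cases "2 \<le> card (branch_verts G)")
      case False
      then have "?X = 0" using few_branch_verts[OF reduced_multigraph[OF red]] by simp
      with pos have "?X < 4 * k * k - 4 * k + 2" by linarith
      then show ?thesis by auto
    next
      case s2: True
      note B = reduced_bounds[OF red s2, unfolded n]
      have R: "?X \<le> 2 * (?s - 1) * (4 * k + 1 - 2 * ?s)" by (rule B(1))
      have Q6: "?X \<le> 4 * ?s * (?s - 1) + (8 * k + 2 - 8 * ?s) * (8 * k + 2 - 8 * ?s - 1)"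
        if "0 \<le> 8 * k + 2 - 8 * ?s" "8 * k + 2 - 8 * ?s \<le> ?s"
        using B(2)[of "8 * k + 2 - 8 * ?s" 6] that by simp
      have Q5: "?X \<le> 3 * ?s * (?s - 1) + (8 * k + 2 - 7 * ?s) * (8 * k + 2 - 7 * ?s - 1)"
        if "0 \<le> 8 * k + 2 - 7 * ?s" "8 * k + 2 - 7 * ?s \<le> ?s"
        using B(2)[of "8 * k + 2 - 7 * ?s" 5] that by simp
      note E = extremal_1[OF k R Q6 Q5]
      have "full_subdivision_of G (extremal_base 6 k (3 * k + 1))" if X: "?X = 4 * k * k - 4 * k + 2"
      proof -
        have s: "?s = k" by (rule E(2)[OF _ _ _ _ X])
        show ?thesis
          using reduced_tight[OF red s2, unfolded n s, of 2 6] X k by (simp add: algebra_simps)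
      qed
      then show ?thesis using E(1) by blast
    qed
  qed
  moreover have "?X = 4 * k * k - 4 * k + 2" if "full_subdivision_of G (extremal_base 6 k (3 * k + 1))"
    using total_excess_full_subdivision[OF crit that, of 2] by (simp add: algebra_simps)
  ultimately show "?X \<le> 4 * k * k - 4 * k + 2"
    "?X = 4 * k * k - 4 * k + 2 \<longleftrightarrow> full_subdivision_of G (extremal_base 6 k (3 * k + 1))" by blast+
qed

text \<open>For order \<open>4 * k + 1\<close> the mean bound is roughly
  \<open>4 * k * k - 2 * k\<close>, which exceeds the claim. A graph that is not reduced is
  therefore compared with the exact value from \<open>excess_bound_1\<close>, and
  \<open>reduced_or_smaller\<close> is used to get hold of the dominating graph itself.\<close>

lemma excess_bound_2:
  fixes G :: "('v, 'e) mgraph"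
  assumes crit: "critical G" and n: "int (card (verts G)) = 4 * k + 2" and k: "68 \<le> k"
  shows "int (total_excess G) \<le> 4 * k * k - 4 * k + 12"
    "int (total_excess G) = 4 * k * k - 4 * k + 12 \<longleftrightarrow>
      full_subdivision_of G (extremal_base 6 k (3 * k + 2)) \<or>
      full_subdivision_of G (extremal_base 5 (k + 1) (3 * k + 1))"
proof -
  let ?X = "int (total_excess G)" and ?s = "int (card (branch_verts G))"
  let ?P = "full_subdivision_of G (extremal_base 6 k (3 * k + 2)) \<or>
      full_subdivision_of G (extremal_base 5 (k + 1) (3 * k + 1))"
  have pos: "0 < 4 * k * k - 4 * k" using k by (simp add: mult.assoc)
  have "?X \<le> 4 * k * k - 4 * k + 12 \<and> (?X = 4 * k * k - 4 * k + 12 \<longrightarrow> ?P)"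
    using crit
  proof (cases rule: reduced_or_smaller)
    case (2 G')
    have "int (total_excess G') \<le> 4 * k * k - 4 * k + 2"
    proof (cases "int (card (verts G')) = 4 * k + 1")
      case True
      then show ?thesis using excess_bound_1(1)[of G' k] 2(1) k by (simp add: reduced_def)
    next
      case False
      then have "4 * int (total_excess G') \<le> (4 * k - 2)\<^sup>2"
        using reduced_mean_bound[OF 2(1), of "4 * k"] 2(3) n by simp
      also have "\<dots> = 4 * (4 * k * k - 4 * k + 1)" by (simp add: power2_eq_square algebra_simps)
      finally show ?thesis by auto
    qed
    then show ?thesis using 2(2) by auto
  next
    case red: 1
    show ?thesis
    proof (cases "2 \<le> card (branch_verts G)")
      case False
      then have "?X = 0" using few_branch_verts[OF reduced_multigraph[OF red]] by simp
      with pos have "?X < 4 * k * k - 4 * k + 12" by linarith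
      then show ?thesis by auto
    next
      case s2: True
      note B = reduced_bounds[OF red s2, unfolded n]
      have R: "?X \<le> 2 * (?s - 1) * (4 * k + 2 - 2 * ?s)" by (rule B(1))
      have Q6: "?X \<le> 4 * ?s * (?s - 1) + (8 * k + 4 - 8 * ?s) * (8 * k + 4 - 8 * ?s - 1)"
        if "0 \<le> 8 * k + 4 - 8 * ?s" "8 * k + 4 - 8 * ?s \<le> ?s"
        using B(2)[of "8 * k + 4 - 8 * ?s" 6] that by simp
      have Q5: "?X \<le> 3 * ?s * (?s - 1) + (8 * k + 4 - 7 * ?s) * (8 * k + 4 - 7 * ?s - 1)"
        if "0 \<le> 8 * k + 4 - 7 * ?s" "8 * k + 4 - 7 * ?s \<le> ?s"
        using B(2)[of "8 * k + 4 - 7 * ?s" 5] that by simp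
      note E = extremal_2[OF k R Q6 Q5]
      have ?P if X: "?X = 4 * k * k - 4 * k + 12"
      proof -
        have "?s = k \<or> ?s = k + 1" by (rule E(2)[OF _ _ _ _ X])
        then show ?thesis
        proof
          assume s: "?s = k"
          show ?thesis
            using reduced_tight[OF red s2, unfolded n s, of 4 6] X k by (simp add: algebra_simps)
        next
          assume s: "?s = k + 1"
          \<comment> \<open>Here the degree sum is
            \<open>2 * (3 * k + 1) = 5 * (k + 1) + (k - 3)\<close>.\<close>
          show ?thesis
            using reduced_tight[OF red s2, unfolded n s, of "k - 3" 5] X k by (simp add: algebra_simps)
        qed
      qed
      then show ?thesis using E(1) by blast
    qed
  qed
  moreover have "?X = 4 * k * k - 4 * k + 12" if ?P
    using that
  proof
    assume a: "full_subdivision_of G (extremal_base 6 k (3 * k + 2))"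
    show ?thesis using total_excess_full_subdivision[OF crit a, of 4] by (simp add: algebra_simps)
  next
    assume a: "full_subdivision_of G (extremal_base 5 (k + 1) (3 * k + 1))"
    show ?thesis using total_excess_full_subdivision[OF crit a, of "k - 3"] by (simp add: algebra_simps)
  qed
  ultimately show "?X \<le> 4 * k * k - 4 * k + 12" "?X = 4 * k * k - 4 * k + 12 \<longleftrightarrow> ?P" by blast+
qed

lemma excess_bound_3:
  fixes G :: "('v, 'e) mgraph"
  assumes crit: "critical G" and n: "int (card (verts G)) = 4 * k + 3" and k: "30 \<le> k"
  shows "int (total_excess G) \<le> 4 * k * k + 2"
    "int (total_excess G) = 4 * k * k + 2 \<longleftrightarrow>
      full_subdivision_of G (extremal_base 5 (k + 1) (3 * k + 2))"
proof -
  let ?X = "int (total_excess G)" and ?s = "int (card (branch_verts G))"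
  have pos: "0 < 4 * k * k + 2" using k by (simp add: mult.assoc add_nonneg_pos)
  have "?X \<le> 4 * k * k + 2 \<and>
    (?X = 4 * k * k + 2 \<longrightarrow> full_subdivision_of G (extremal_base 5 (k + 1) (3 * k + 2)))"
  proof (cases "reduced G")
    case False
    \<comment> \<open>After a contraction the mean bound is \<open>4 * k * k\<close>, two below the
      claimed value.\<close>
    have "4 * ?X \<le> (4 * k)\<^sup>2" using smaller_mean_bound[OF crit False] n by simp
    also have "\<dots> = 4 * (4 * k * k)" by (simp add: power2_eq_square)
    finally show ?thesis by auto
  next
    case red: True
    show ?thesis
    proof (cases "2 \<le> card (branch_verts G)")
      case False
      then have "?X = 0" using few_branch_verts[OF reduced_multigraph[OF red]] by simp
      with pos have "?X < 4 * k * k + 2" by linarith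
      then show ?thesis by auto
    next
      case s2: True
      note B = reduced_bounds[OF red s2, unfolded n]
      have R: "?X \<le> 2 * (?s - 1) * (4 * k + 3 - 2 * ?s)" by (rule B(1))
      have Q6: "?X \<le> 4 * ?s * (?s - 1) + (8 * k + 6 - 8 * ?s) * (8 * k + 6 - 8 * ?s - 1)"
        if "0 \<le> 8 * k + 6 - 8 * ?s" "8 * k + 6 - 8 * ?s \<le> ?s"
        using B(2)[of "8 * k + 6 - 8 * ?s" 6] that by simp
      have Q5: "?X \<le> 3 * ?s * (?s - 1) + (8 * k + 6 - 7 * ?s) * (8 * k + 6 - 7 * ?s - 1)"
        if "0 \<le> 8 * k + 6 - 7 * ?s" "8 * k + 6 - 7 * ?s \<le> ?s"
        using B(2)[of "8 * k + 6 - 7 * ?s" 5] that by simp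
      note E = extremal_3[OF k R Q6 Q5]
      have "full_subdivision_of G (extremal_base 5 (k + 1) (3 * k + 2))" if X: "?X = 4 * k * k + 2"
      proof -
        have s: "?s = k + 1" by (rule E(2)[OF _ _ _ _ X])
        \<comment> \<open>Here the degree sum is
          \<open>2 * (3 * k + 2) = 5 * (k + 1) + (k - 1)\<close>.\<close>
        show ?thesis
          using reduced_tight[OF red s2, unfolded n s, of "k - 1" 5] X k by (simp add: algebra_simps)
      qed
      then show ?thesis using E(1) by blast
    qed
  qed
  moreover have "?X = 4 * k * k + 2" if "full_subdivision_of G (extremal_base 5 (k + 1) (3 * k + 2))"
    using total_excess_full_subdivision[OF crit that, of "k - 1"] by (simp add: algebra_simps)
  ultimately show "?X \<le> 4 * k * k + 2"
    "?X = 4 * k * k + 2 \<longleftrightarrow> full_subdivision_of G (extremal_base 5 (k + 1) (3 * k + 2))" by blast+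
qed

section \<open>From the excess to the average connectivity\<close>

lemma average_connectivity_iff:
  assumes "critical G" "3 \<le> card (verts G)" and n: "n = card (verts G)"
    and z: "z = 4 * real_of_int b"
  shows "average_connectivity G \<le> 2 + z / (4 * real n * (real n - 1)) \<longleftrightarrow> int (total_excess G) \<le> b"
    "average_connectivity G = 2 + z / (4 * real n * (real n - 1)) \<longleftrightarrow> int (total_excess G) = b"
proof -
  have pos: "0 < real n * (real n - 1)" using assms(2) n by simp
  have zz: "z / (4 * real n * (real n - 1)) = real_of_int b / (real n * (real n - 1))"
    by (simp add: z mult.assoc)
  have X: "average_connectivity G = 2 + real_of_int (int (total_excess G)) / (real n * (real n - 1))"
    using average_connectivity_excess[OF assms(1,2)] by (simp add: n)
  show "average_connectivity G \<le> 2 + z / (4 * real n * (real n - 1)) \<longleftrightarrow> int (total_excess G) \<le> b"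
    unfolding X zz add_le_cancel_left divide_le_cancel of_int_le_iff using pos by auto
  show "average_connectivity G = 2 + z / (4 * real n * (real n - 1)) \<longleftrightarrow> int (total_excess G) = b"
    unfolding X zz add_left_cancel divide_cancel_right of_int_eq_iff using pos by auto
qed

theorem theorem2p11:
  fixes G :: "('v, 'e) mgraph" and n :: nat
  assumes "multigraph G"
    and "minimally_2_connected G"
    and "graph_order G = n"
  shows
    "average_connectivity G \<le> 2 + (real n - 2)\<^sup>2 / (4 * real n * (real n - 1)) \<and>
     2 + (real n - 2)\<^sup>2 / (4 * real n * (real n - 1)) < 9 / 4 \<and>
     (\<forall>k l :: int. int n = 4 * k + l \<and> 0 \<le> l \<and> l < 4 \<longrightarrow>
       (k \<ge> 8 \<and> l = 0 \<longrightarrow>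
          average_connectivity G \<le> 2 + ((real n)\<^sup>2 - 4 * real n) / (4 * real n * (real n - 1)) \<and>
          2 + ((real n)\<^sup>2 - 4 * real n) / (4 * real n * (real n - 1))
            = 2 + (real n - 4) / (4 * (real n - 1)) \<and>
          (average_connectivity G = 2 + ((real n)\<^sup>2 - 4 * real n) / (4 * real n * (real n - 1)) \<longleftrightarrow>
             full_subdivision_of G (\<lambda>H. ideally_connected H \<and> regular 6 H \<and>
               int (graph_order H) = k))) \<and>
       (k \<ge> 30 \<and> l = 1 \<longrightarrow>
          average_connectivity G \<le> 2 + ((real n)\<^sup>2 - 6 * real n + 13) / (4 * real n * (real n - 1)) \<and>
          (average_connectivity G = 2 + ((real n)\<^sup>2 - 6 * real n + 13) / (4 * real n * (real n - 1)) \<longleftrightarrow>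
             full_subdivision_of G (\<lambda>H. ideally_connected H \<and> nearly_regular H \<and>
               int (graph_order H) = k \<and>
               int (graph_size H) = int n - k \<and> int n - k = 3 * k + 1))) \<and>
       (k \<ge> 68 \<and> l = 2 \<longrightarrow>
          average_connectivity G \<le> 2 + ((real n)\<^sup>2 - 8 * real n + 60) / (4 * real n * (real n - 1)) \<and>
          (average_connectivity G = 2 + ((real n)\<^sup>2 - 8 * real n + 60) / (4 * real n * (real n - 1)) \<longleftrightarrow>
             full_subdivision_of G (\<lambda>H. ideally_connected H \<and> nearly_regular H \<and>
               (int (graph_order H) = k \<and>
                int (graph_size H) = int n - k \<and> int n - k = 3 * k + 2 \<or>
                int (graph_order H) = k + 1 \<and>
                int (graph_size H) = int n - k - 1 \<and> int n - k - 1 = 3 * k + 1)))) \<and>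
       (k \<ge> 30 \<and> l = 3 \<longrightarrow>
          average_connectivity G \<le> 2 + ((real n)\<^sup>2 - 6 * real n + 17) / (4 * real n * (real n - 1)) \<and>
          (average_connectivity G = 2 + ((real n)\<^sup>2 - 6 * real n + 17) / (4 * real n * (real n - 1)) \<longleftrightarrow>
             full_subdivision_of G (\<lambda>H. ideally_connected H \<and> nearly_regular H \<and>
               int (graph_order H) = k + 1 \<and>
               int (graph_size H) = int n - k - 1 \<and> int n - k - 1 = 3 * k + 2))))"
proof -
  note crit = minimally_2_connected_critical(1)[OF assms(1,2)]
    and n3 = minimally_2_connected_critical(2)[OF assms(1,2)]
  have n: "n = card (verts G)" using assms(3) by (simp add: graph_order_def)
  have n3': "3 \<le> n" using n3 n by simp
  note A = average_connectivity_iff[OF crit n3 n]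
  have pos: "0 < real n * (real n - 1)" using n3' by simp
  have F1: "average_connectivity G \<le> 2 + (real n - 2)\<^sup>2 / (4 * real n * (real n - 1))"
  proof -
    have "real_of_int (4 * int (total_excess G)) \<le> real_of_int ((int n - 2)\<^sup>2)"
      unfolding of_int_le_iff using critical_mean_bound[OF crit n3] n by simp
    then have "4 * real (total_excess G) \<le> (real n - 2)\<^sup>2" by simp
    then have "4 * real (total_excess G) / (4 * real n * (real n - 1)) \<le>
        (real n - 2)\<^sup>2 / (4 * real n * (real n - 1))"
      using pos by (intro divide_right_mono) auto
    then show ?thesis using average_connectivity_excess[OF crit n3] n by simp
  qed
  have F2: "2 + (real n - 2)\<^sup>2 / (4 * real n * (real n - 1)) < 9 / 4"
  proof -
    have "(real n - 2)\<^sup>2 < real n * (real n - 1)" using n3' by (simp add: power2_eq_square algebra_simps)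
    then have "(real n - 2)\<^sup>2 / (real n * (real n - 1)) < 1" using pos by simp
    then show ?thesis by (simp add: mult.assoc)
  qed
  have C0: "average_connectivity G \<le> 2 + ((real n)\<^sup>2 - 4 * real n) / (4 * real n * (real n - 1)) \<and>
      2 + ((real n)\<^sup>2 - 4 * real n) / (4 * real n * (real n - 1)) = 2 + (real n - 4) / (4 * (real n - 1)) \<and>
      (average_connectivity G = 2 + ((real n)\<^sup>2 - 4 * real n) / (4 * real n * (real n - 1)) \<longleftrightarrow>
        full_subdivision_of G (\<lambda>H. ideally_connected H \<and> regular 6 H \<and> int (graph_order H) = k))"
    if k: "8 \<le> k" and nl: "int n = 4 * k + l" "l = 0" for k l
  proof -
    have nk: "int n = 4 * k" using nl by simp
    have rn: "real n = 4 * real_of_int k" using arg_cong[OF nk, of real_of_int] by simp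
    have z: "(real n)\<^sup>2 - 4 * real n = 4 * real_of_int (4 * k * k - 4 * k)"
      unfolding rn by (simp add: power2_eq_square algebra_simps)
    have nv: "int (card (verts G)) = 4 * k" using nk n by simp
    have "((real n)\<^sup>2 - 4 * real n) / (4 * real n * (real n - 1)) = (real n - 4) / (4 * (real n - 1))"
      using n3' by (simp add: divide_simps power2_eq_square) (simp add: algebra_simps)
    \<comment> \<open>A 6-regular graph of order \<open>k\<close> has size \<open>3 * k\<close>, so
      the size need not be prescribed.\<close>
    moreover have "full_subdivision_of G (\<lambda>H. ideally_connected H \<and> regular 6 H \<and> int (graph_order H) = k)
        \<longleftrightarrow> full_subdivision_of G (extremal_base 6 k (3 * k))"
      by (intro full_subdivision_of_cong regular_base_iff) auto
    ultimately show ?thesis unfolding A[OF z] using excess_bound_0[OF crit nv k] by simp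
  qed
  have C1: "average_connectivity G \<le> 2 + ((real n)\<^sup>2 - 6 * real n + 13) / (4 * real n * (real n - 1)) \<and>
      (average_connectivity G = 2 + ((real n)\<^sup>2 - 6 * real n + 13) / (4 * real n * (real n - 1)) \<longleftrightarrow>
        full_subdivision_of G (\<lambda>H. ideally_connected H \<and> nearly_regular H \<and> int (graph_order H) = k \<and>
          int (graph_size H) = int n - k \<and> int n - k = 3 * k + 1))"
    if k: "30 \<le> k" and nl: "int n = 4 * k + l" "l = 1" for k l
  proof -
    have nk: "int n = 4 * k + 1" using nl by simp
    have rn: "real n = 4 * real_of_int k + 1" using arg_cong[OF nk, of real_of_int] by simp
    have z: "(real n)\<^sup>2 - 6 * real n + 13 = 4 * real_of_int (4 * k * k - 4 * k + 2)"
      unfolding rn by (simp add: power2_eq_square algebra_simps)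
    have nv: "int (card (verts G)) = 4 * k + 1" using nk n by simp
    have "full_subdivision_of G (\<lambda>H. ideally_connected H \<and> nearly_regular H \<and> int (graph_order H) = k \<and>
          int (graph_size H) = int n - k \<and> int n - k = 3 * k + 1)
        \<longleftrightarrow> full_subdivision_of G (extremal_base 6 k (3 * k + 1))"
    proof (rule full_subdivision_of_cong)
      fix H :: "(nat, nat) mgraph" assume "multigraph H"
      \<comment> \<open>\<open>2 * (3 * k + 1) = 6 * k + 2\<close>, so near regularity means degrees
        6 and 7.\<close>
      from nearly_regular_base_iff[OF this, of "3 * k + 1" 6 k 2] k nk
      show "ideally_connected H \<and> nearly_regular H \<and> int (graph_order H) = k \<and>
          int (graph_size H) = int n - k \<and> int n - k = 3 * k + 1 \<longleftrightarrow> extremal_base 6 k (3 * k + 1) H"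
        by auto
    qed
    then show ?thesis unfolding A[OF z] using excess_bound_1[OF crit nv k] by simp
  qed
  have C2: "average_connectivity G \<le> 2 + ((real n)\<^sup>2 - 8 * real n + 60) / (4 * real n * (real n - 1)) \<and>
      (average_connectivity G = 2 + ((real n)\<^sup>2 - 8 * real n + 60) / (4 * real n * (real n - 1)) \<longleftrightarrow>
        full_subdivision_of G (\<lambda>H. ideally_connected H \<and> nearly_regular H \<and>
          (int (graph_order H) = k \<and> int (graph_size H) = int n - k \<and> int n - k = 3 * k + 2 \<or>
           int (graph_order H) = k + 1 \<and> int (graph_size H) = int n - k - 1 \<and> int n - k - 1 = 3 * k + 1)))"
    if k: "68 \<le> k" and nl: "int n = 4 * k + l" "l = 2" for k l
  proof -
    have nk: "int n = 4 * k + 2" using nl by simp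
    have rn: "real n = 4 * real_of_int k + 2" using arg_cong[OF nk, of real_of_int] by simp
    have z: "(real n)\<^sup>2 - 8 * real n + 60 = 4 * real_of_int (4 * k * k - 4 * k + 12)"
      unfolding rn by (simp add: power2_eq_square algebra_simps)
    have nv: "int (card (verts G)) = 4 * k + 2" using nk n by simp
    have "full_subdivision_of G (\<lambda>H. ideally_connected H \<and> nearly_regular H \<and>
          (int (graph_order H) = k \<and> int (graph_size H) = int n - k \<and> int n - k = 3 * k + 2 \<or>
           int (graph_order H) = k + 1 \<and> int (graph_size H) = int n - k - 1 \<and> int n - k - 1 = 3 * k + 1))
        \<longleftrightarrow> full_subdivision_of G (\<lambda>H. extremal_base 6 k (3 * k + 2) H \<or> extremal_base 5 (k + 1) (3 * k + 1) H)"
    proof (rule full_subdivision_of_cong)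
      fix H :: "(nat, nat) mgraph" assume "multigraph H"
      \<comment> \<open>On \<open>k\<close> vertices near regularity means degrees 6 and 7 with
        remainder 4, on \<open>k + 1\<close> vertices degrees 5 and 6 with remainder
        \<open>k - 3\<close>.\<close>
      from nearly_regular_base_iff[OF this, of "3 * k + 2" 6 k 4]
        nearly_regular_base_iff[OF this, of "3 * k + 1" 5 "k + 1" "k - 3"] k nk
      show "ideally_connected H \<and> nearly_regular H \<and>
          (int (graph_order H) = k \<and> int (graph_size H) = int n - k \<and> int n - k = 3 * k + 2 \<or>
           int (graph_order H) = k + 1 \<and> int (graph_size H) = int n - k - 1 \<and> int n - k - 1 = 3 * k + 1)
          \<longleftrightarrow> extremal_base 6 k (3 * k + 2) H \<or> extremal_base 5 (k + 1) (3 * k + 1) H"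
        by auto
    qed
    then show ?thesis unfolding A[OF z] full_subdivision_of_disj using excess_bound_2[OF crit nv k] by simp
  qed
  have C3: "average_connectivity G \<le> 2 + ((real n)\<^sup>2 - 6 * real n + 17) / (4 * real n * (real n - 1)) \<and>
      (average_connectivity G = 2 + ((real n)\<^sup>2 - 6 * real n + 17) / (4 * real n * (real n - 1)) \<longleftrightarrow>
        full_subdivision_of G (\<lambda>H. ideally_connected H \<and> nearly_regular H \<and> int (graph_order H) = k + 1 \<and>
          int (graph_size H) = int n - k - 1 \<and> int n - k - 1 = 3 * k + 2))"
    if k: "30 \<le> k" and nl: "int n = 4 * k + l" "l = 3" for k l
  proof -
    have nk: "int n = 4 * k + 3" using nl by simp
    have rn: "real n = 4 * real_of_int k + 3" using arg_cong[OF nk, of real_of_int] by simp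
    have z: "(real n)\<^sup>2 - 6 * real n + 17 = 4 * real_of_int (4 * k * k + 2)"
      unfolding rn by (simp add: power2_eq_square algebra_simps)
    have nv: "int (card (verts G)) = 4 * k + 3" using nk n by simp
    have "full_subdivision_of G (\<lambda>H. ideally_connected H \<and> nearly_regular H \<and> int (graph_order H) = k + 1 \<and>
          int (graph_size H) = int n - k - 1 \<and> int n - k - 1 = 3 * k + 2)
        \<longleftrightarrow> full_subdivision_of G (extremal_base 5 (k + 1) (3 * k + 2))"
    proof (rule full_subdivision_of_cong)
      fix H :: "(nat, nat) mgraph" assume "multigraph H"
      \<comment> \<open>\<open>2 * (3 * k + 2) = 5 * (k + 1) + (k - 1)\<close>, so near regularity
        means degrees 5 and 6.\<close>
      from nearly_regular_base_iff[OF this, of "3 * k + 2" 5 "k + 1" "k - 1"] k nk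
      show "ideally_connected H \<and> nearly_regular H \<and> int (graph_order H) = k + 1 \<and>
          int (graph_size H) = int n - k - 1 \<and> int n - k - 1 = 3 * k + 2
          \<longleftrightarrow> extremal_base 5 (k + 1) (3 * k + 2) H"
        by auto
    qed
    then show ?thesis unfolding A[OF z] using excess_bound_3[OF crit nv k] by simp
  qed
  show ?thesis
    by (intro conjI[OF F1 conjI[OF F2]] allI impI conjI[OF impI conjI[OF impI conjI[OF impI impI]]])
      (elim conjE, (rule C0 C1 C2 C3; assumption))+
qed

end
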